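(* Consider the inclusions of 2-categories of comprehension categories (with pseudo maps) $$\mathbf{CompCat}_{\mathrm{repl}}\hookrightarrow\mathbf{CompCat}_{\mathrm{sub}}\hookrightarrow\mathbf{CompCat}_{\mathrm{full}}\hookrightarrow\mathbf{CompCat}.$$ The first two inclusions, $\mathbf{CompCat}_{\mathrm{repl}}\hookrightarrow\mathbf{CompCat}_{\mathrm{sub}}$ and $\mathbf{CompCat}_{\mathrm{sub}}\hookrightarrow\mathbf{CompCat}_{\mathrm{full}}$, are equivalences of 2-categories, and the third inclusion $\mathbf{CompCat}_{\mathrm{full}}\hookrightarrow\mathbf{CompCat}$ has a left adjoint.
   Context: **Comprehension categories.** A comprehension category $(\mathcal C,\mathcal T,p,\chi)$ is a category $\mathcal C$, a fibration $p:\mathcal T\to\mathcal C$, and a functor $\chi:\mathcal T\to\mathcal C^{\to}$ (comprehension) to the arrow category with $\mathrm{cod}\circ\chi=p$ strictly, sending $p$-cartesian maps to pullback squares. Write $\mathcal T_\Gamma=p^{-1}(\Gamma)$; for $A\in\mathcal T_\Gamma$ the domain of $\chi(A)$ is written $\Gamma.A$. A *pseudo map* $(F,\bar F,\varphi):(\mathcal C,\mathcal T,p,\chi)\to(\mathcal C',\mathcal T',p',\chi')$ is a functor $F:\mathcal C\to\mathcal C'$, a functor $\bar F:\mathcal T\to\mathcal T'$ strictly over $F$ sending $p$-cartesian maps to $p'$-cartesian maps, and a natural isomorphism $\varphi:\chi'\bar F\cong F^{\to}\chi$ lying strictly over the identity of $F$. A *transformation* $(F,\bar F,\varphi)\Rightarrow(G,\bar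 G,\gamma)$ is a natural transformation $\alpha:F\Rightarrow G$ and another $\bar\alpha:\bar F\Rightarrow\bar G$ strictly over $\alpha$, with $\gamma_A\circ\chi'(\bar\alpha_A)=\alpha_{\Gamma.A}\circ\varphi_A$ for each $A\in\mathcal T_\Gamma$. $\mathbf{CompCat}$ is the 2-category of comprehension categories, pseudo maps, and transformations. A comprehension category is *full* if $\chi$ is fully faithful; *subcategorical* if $\chi$ is a full subcategory inclusion, i.e. full, faithful, and injective on objects; *replete* if it is subcategorical and $\mathcal T$ (identified with its image) is a replete, i.e. isomorphism-closed, subcategory of $\mathcal C^{\to}$. The subscripts $\mathrm{full},\mathrm{sub},\mathrm{repl}$ denote the corresponding full sub-2-categories of $\mathbf{CompCat}$. **Conventions.** 2-categories and 2-functors are strict. An equivalence of 2-categories is a 2-functor inducing equivalences on hom-categories and surjective on objects up to internal equivalence. A left adjoint is a left 2-adjoint (2-natural isomorphisms of hom-categories). *)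

theory Defs
  imports "HOL-Library.FuncSet"
begin

section \<open>Categories, functors and natural transformations\<close>

text \<open>
  Functors and natural transformations are required to be extensional (they take the value
  \<open>undefined\<close> outside their domain), so that HOL equality is equality of functors and of natural
  transformations. This matters because everything below is strict.
\<close>

record ('o, 'a) cat =
  Obj :: "'o set"
  Arr :: "'a set"
  Dom :: "'a \<Rightarrow> 'o"
  Cod :: "'a \<Rightarrow> 'o"
  Ident :: "'o \<Rightarrow> 'a"
  Comp :: "'a \<Rightarrow> 'a \<Rightarrow> 'a" (infixl "\<cdot>\<index>" 70)

definition homset :: "('o, 'a) cat \<Rightarrow> 'o \<Rightarrow> 'o \<Rightarrow> 'a set" where
  "homset C x y = {f \<in> Arr C. Dom C f = x \<and> Cod C f = y}"

locale category =
  fixes C :: "('o, 'a) cat"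
  assumes Dom_in: "f \<in> Arr C \<Longrightarrow> Dom C f \<in> Obj C"
    and Cod_in: "f \<in> Arr C \<Longrightarrow> Cod C f \<in> Obj C"
    and Ident_in: "x \<in> Obj C \<Longrightarrow> Ident C x \<in> homset C x x"
    and Comp_in: "\<lbrakk>f \<in> homset C x y; g \<in> homset C y z\<rbrakk> \<Longrightarrow> g \<cdot>\<^bsub>C\<^esub> f \<in> homset C x z"
    and Comp_Ident: "f \<in> homset C x y \<Longrightarrow> f \<cdot>\<^bsub>C\<^esub> Ident C x = f"
    and Ident_Comp: "f \<in> homset C x y \<Longrightarrow> Ident C y \<cdot>\<^bsub>C\<^esub> f = f"
    and Comp_assoc: "\<lbrakk>f \<in> homset C w x; g \<in> homset C x y; h \<in> homset C y z\<rbrakk>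
      \<Longrightarrow> h \<cdot>\<^bsub>C\<^esub> g \<cdot>\<^bsub>C\<^esub> f = h \<cdot>\<^bsub>C\<^esub> (g \<cdot>\<^bsub>C\<^esub> f)"

definition ext_category :: "('o, 'a) cat \<Rightarrow> bool" where
  "ext_category C \<longleftrightarrow> category C \<and>
     Dom C \<in> extensional (Arr C) \<and> Cod C \<in> extensional (Arr C) \<and>
     Ident C \<in> extensional (Obj C) \<and>
     (\<forall>f g. \<not> (f \<in> Arr C \<and> g \<in> Arr C \<and> Dom C g = Cod C f) \<longrightarrow> g \<cdot>\<^bsub>C\<^esub> f = undefined)"

definition iso_arrow :: "('o, 'a) cat \<Rightarrow> 'a \<Rightarrow> bool" where
  "iso_arrow C f \<longleftrightarrow> f \<in> Arr C \<and>
     (\<exists>g \<in> homset C (Cod C f) (Dom C f).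
        g \<cdot>\<^bsub>C\<^esub> f = Ident C (Dom C f) \<and> f \<cdot>\<^bsub>C\<^esub> g = Ident C (Cod C f))"

definition isomorphic :: "('o, 'a) cat \<Rightarrow> 'o \<Rightarrow> 'o \<Rightarrow> bool" where
  "isomorphic C x y \<longleftrightarrow> (\<exists>f \<in> homset C x y. iso_arrow C f)"

definition prod_cat :: "('o, 'a) cat \<Rightarrow> ('p, 'b) cat \<Rightarrow> ('o \<times> 'p, 'a \<times> 'b) cat" where
  "prod_cat C D = \<lparr>
     Obj = Obj C \<times> Obj D,
     Arr = Arr C \<times> Arr D,
     Dom = map_prod (Dom C) (Dom D),
     Cod = map_prod (Cod C) (Cod D),
     Ident = map_prod (Ident C) (Ident D),
     Comp = (\<lambda>(g, g') (f, f'). (g \<cdot>\<^bsub>C\<^esub> f, g' \<cdot>\<^bsub>D\<^esub> f')) \<rparr>"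

record ('o, 'a, 'p, 'b) ftor =
  OM :: "'o \<Rightarrow> 'p"
  AM :: "'a \<Rightarrow> 'b"

locale cat_functor = C: category C + D: category D
  for C :: "('o, 'a) cat" and D :: "('p, 'b) cat" +
  fixes F :: "('o, 'a, 'p, 'b) ftor"
  assumes OM_ext: "OM F \<in> extensional (Obj C)"
    and AM_ext: "AM F \<in> extensional (Arr C)"
    and OM_in: "x \<in> Obj C \<Longrightarrow> OM F x \<in> Obj D"
    and AM_in: "f \<in> homset C x y \<Longrightarrow> AM F f \<in> homset D (OM F x) (OM F y)"
    and AM_Ident: "x \<in> Obj C \<Longrightarrow> AM F (Ident C x) = Ident D (OM F x)"
    and AM_Comp: "\<lbrakk>f \<in> homset C x y; g \<in> homset C y z\<rbrakk>
      \<Longrightarrow> AM F (g \<cdot>\<^bsub>C\<^esub> f) = AM F g \<cdot>\<^bsub>D\<^esub> AM F f"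

definition id_ftor :: "('o, 'a) cat \<Rightarrow> ('o, 'a, 'o, 'a) ftor" where
  "id_ftor C = \<lparr> OM = (\<lambda>x \<in> Obj C. x), AM = (\<lambda>f \<in> Arr C. f) \<rparr>"

text \<open>\<open>fcomp C G F\<close> is the composite of \<open>F\<close> with domain \<open>C\<close> followed by \<open>G\<close>.\<close>

definition fcomp :: "('o, 'a) cat \<Rightarrow> ('p, 'b, 'q, 'c) ftor \<Rightarrow> ('o, 'a, 'p, 'b) ftor
    \<Rightarrow> ('o, 'a, 'q, 'c) ftor" where
  "fcomp C G F = \<lparr> OM = (\<lambda>x \<in> Obj C. OM G (OM F x)), AM = (\<lambda>f \<in> Arr C. AM G (AM F f)) \<rparr>"

definition full_ftor :: "('o, 'a) cat \<Rightarrow> ('p, 'b) cat \<Rightarrow> ('o, 'a, 'p, 'b) ftor \<Rightarrow> bool" where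
  "full_ftor C D F \<longleftrightarrow>
     (\<forall>x \<in> Obj C. \<forall>y \<in> Obj C. \<forall>g \<in> homset D (OM F x) (OM F y). \<exists>f \<in> homset C x y. AM F f = g)"

definition faithful_ftor :: "('o, 'a) cat \<Rightarrow> ('o, 'a, 'p, 'b) ftor \<Rightarrow> bool" where
  "faithful_ftor C F \<longleftrightarrow> (\<forall>x \<in> Obj C. \<forall>y \<in> Obj C. inj_on (AM F) (homset C x y))"

definition nat_trans :: "('o, 'a) cat \<Rightarrow> ('p, 'b) cat \<Rightarrow> ('o, 'a, 'p, 'b) ftor
    \<Rightarrow> ('o, 'a, 'p, 'b) ftor \<Rightarrow> ('o \<Rightarrow> 'b) \<Rightarrow> bool" where
  "nat_trans C D F G \<tau> \<longleftrightarrow> cat_functor C D F \<and> cat_functor C D G \<and>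
     \<tau> \<in> extensional (Obj C) \<and>
     (\<forall>x \<in> Obj C. \<tau> x \<in> homset D (OM F x) (OM G x)) \<and>
     (\<forall>f \<in> Arr C. \<tau> (Cod C f) \<cdot>\<^bsub>D\<^esub> AM F f = AM G f \<cdot>\<^bsub>D\<^esub> \<tau> (Dom C f))"

definition nat_iso :: "('o, 'a) cat \<Rightarrow> ('p, 'b) cat \<Rightarrow> ('o, 'a, 'p, 'b) ftor
    \<Rightarrow> ('o, 'a, 'p, 'b) ftor \<Rightarrow> ('o \<Rightarrow> 'b) \<Rightarrow> bool" where
  "nat_iso C D F G \<tau> \<longleftrightarrow> nat_trans C D F G \<tau> \<and> (\<forall>x \<in> Obj C. iso_arrow D (\<tau> x))"

definition cat_equivalence :: "('o, 'a) cat \<Rightarrow> ('p, 'b) cat \<Rightarrow> ('o, 'a, 'p, 'b) ftor \<Rightarrow> bool" where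
  "cat_equivalence C D F \<longleftrightarrow> cat_functor C D F \<and>
     (\<exists>G \<eta> \<epsilon>. cat_functor D C G \<and>
        nat_iso C C (id_ftor C) (fcomp C G F) \<eta> \<and> nat_iso D D (fcomp D F G) (id_ftor D) \<epsilon>)"

definition cat_isomorphism :: "('o, 'a) cat \<Rightarrow> ('p, 'b) cat \<Rightarrow> ('o, 'a, 'p, 'b) ftor \<Rightarrow> bool" where
  "cat_isomorphism C D F \<longleftrightarrow> cat_functor C D F \<and>
     (\<exists>G. cat_functor D C G \<and> fcomp C G F = id_ftor C \<and> fcomp D F G = id_ftor D)"


section \<open>The arrow category\<close>

text \<open>
  An arrow of the arrow category from \<open>f\<close> to \<open>g\<close> is a commuting square with left side \<open>f\<close>,
  right side \<open>g\<close>, a top edge between the domains and a bottom edge between the codomains.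
\<close>

record 'a square =
  Lft :: 'a
  Rgt :: 'a
  Top :: 'a
  Bot :: 'a

definition arrow_cat :: "('o, 'a) cat \<Rightarrow> ('a, 'a square) cat" where
  "arrow_cat C = \<lparr>
     Obj = Arr C,
     Arr = {s. Lft s \<in> Arr C \<and> Rgt s \<in> Arr C \<and>
               Top s \<in> homset C (Dom C (Lft s)) (Dom C (Rgt s)) \<and>
               Bot s \<in> homset C (Cod C (Lft s)) (Cod C (Rgt s)) \<and>
               Rgt s \<cdot>\<^bsub>C\<^esub> Top s = Bot s \<cdot>\<^bsub>C\<^esub> Lft s},
     Dom = Lft,
     Cod = Rgt,
     Ident = (\<lambda>f. \<lparr> Lft = f, Rgt = f, Top = Ident C (Dom C f), Bot = Ident C (Cod C f) \<rparr>),
     Comp = (\<lambda>t s. \<lparr> Lft = Lft s, Rgt = Rgt t,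
                     Top = Top t \<cdot>\<^bsub>C\<^esub> Top s, Bot = Bot t \<cdot>\<^bsub>C\<^esub> Bot s \<rparr>) \<rparr>"

definition cod_ftor :: "('o, 'a) cat \<Rightarrow> ('a, 'a square, 'o, 'a) ftor" where
  "cod_ftor C = \<lparr> OM = (\<lambda>f \<in> Arr C. Cod C f), AM = (\<lambda>s \<in> Arr (arrow_cat C). Bot s) \<rparr>"

definition arrow_ftor :: "('o, 'a) cat \<Rightarrow> ('o, 'a, 'p, 'b) ftor
    \<Rightarrow> ('a, 'a square, 'b, 'b square) ftor" where
  "arrow_ftor C F = \<lparr>
     OM = (\<lambda>f \<in> Arr C. AM F f),
     AM = (\<lambda>s \<in> Arr (arrow_cat C).
             \<lparr> Lft = AM F (Lft s), Rgt = AM F (Rgt s), Top = AM F (Top s), Bot = AM F (Bot s) \<rparr>) \<rparr>"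

definition pullback_square :: "('o, 'a) cat \<Rightarrow> 'a square \<Rightarrow> bool" where
  "pullback_square C s \<longleftrightarrow> s \<in> Arr (arrow_cat C) \<and>
     (\<forall>h \<in> Arr C. \<forall>k \<in> Arr C.
        Dom C h = Dom C k \<and> Cod C h = Dom C (Rgt s) \<and> Cod C k = Cod C (Lft s) \<and>
        Rgt s \<cdot>\<^bsub>C\<^esub> h = Bot s \<cdot>\<^bsub>C\<^esub> k \<longrightarrow>
        (\<exists>!m. m \<in> homset C (Dom C h) (Dom C (Lft s)) \<and>
              Top s \<cdot>\<^bsub>C\<^esub> m = h \<and> Lft s \<cdot>\<^bsub>C\<^esub> m = k))"


section \<open>Fibrations\<close>

definition cartesian :: "('o, 'a) cat \<Rightarrow> ('p, 'b) cat \<Rightarrow> ('o, 'a, 'p, 'b) ftor \<Rightarrow> 'a \<Rightarrow> bool" where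
  "cartesian T C p s \<longleftrightarrow> s \<in> Arr T \<and>
     (\<forall>t \<in> Arr T. \<forall>w \<in> homset C (OM p (Dom T t)) (OM p (Dom T s)).
        Cod T t = Cod T s \<and> AM p t = AM p s \<cdot>\<^bsub>C\<^esub> w \<longrightarrow>
        (\<exists>!r. r \<in> homset T (Dom T t) (Dom T s) \<and> AM p r = w \<and> s \<cdot>\<^bsub>T\<^esub> r = t))"

definition fibration :: "('o, 'a) cat \<Rightarrow> ('p, 'b) cat \<Rightarrow> ('o, 'a, 'p, 'b) ftor \<Rightarrow> bool" where
  "fibration T C p \<longleftrightarrow> cat_functor T C p \<and>
     (\<forall>A \<in> Obj T. \<forall>f \<in> Arr C. Cod C f = OM p A \<longrightarrow>
        (\<exists>s. cartesian T C p s \<and> Cod T s = A \<and> AM p s = f))"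


section \<open>Comprehension categories\<close>

text \<open>
  All categories involved have their objects and arrows in one type \<open>'u\<close>, which fixes the notion
  of size: for infinite \<open>'u\<close> these are, up to renaming, the categories with at most \<open>|'u|\<close> many
  objects and arrows.
\<close>

record 'u compcat =
  Base :: "('u, 'u) cat"
  Total :: "('u, 'u) cat"
  Proj :: "('u, 'u, 'u, 'u) ftor"
  Compr :: "('u, 'u, 'u, 'u square) ftor"

locale comprehension_category =
  fixes X :: "'u compcat"
  assumes Base: "ext_category (Base X)"
    and Total: "ext_category (Total X)"
    and Proj: "fibration (Total X) (Base X) (Proj X)"
    and Compr: "cat_functor (Total X) (arrow_cat (Base X)) (Compr X)"
    and cod_Compr: "fcomp (Total X) (cod_ftor (Base X)) (Compr X) = Proj X"
    and Compr_cartesian: "cartesian (Total X) (Base X) (Proj X) s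
      \<Longrightarrow> pullback_square (Base X) (AM (Compr X) s)"

record 'u pmap =
  BaseF :: "('u, 'u, 'u, 'u) ftor"
  TotF :: "('u, 'u, 'u, 'u) ftor"
  Cmp :: "'u \<Rightarrow> 'u square"

locale pseudo_map =
  X: comprehension_category X + Y: comprehension_category Y
  for X Y :: "'u compcat" +
  fixes P :: "'u pmap"
  assumes BaseF: "cat_functor (Base X) (Base Y) (BaseF P)"
    and TotF: "cat_functor (Total X) (Total Y) (TotF P)"
    and TotF_over: "fcomp (Total X) (Proj Y) (TotF P) = fcomp (Total X) (BaseF P) (Proj X)"
    and TotF_cartesian: "cartesian (Total X) (Base X) (Proj X) s
      \<Longrightarrow> cartesian (Total Y) (Base Y) (Proj Y) (AM (TotF P) s)"
    and Cmp: "nat_iso (Total X) (arrow_cat (Base Y))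
      (fcomp (Total X) (Compr Y) (TotF P))
      (fcomp (Total X) (arrow_ftor (Base X) (BaseF P)) (Compr X)) (Cmp P)"
    and Cmp_over: "A \<in> Obj (Total X) \<Longrightarrow>
      AM (cod_ftor (Base Y)) (Cmp P A) = Ident (Base Y) (OM (BaseF P) (OM (Proj X) A))"

record 'u trafo =
  Src :: "'u pmap"
  Tgt :: "'u pmap"
  BaseT :: "'u \<Rightarrow> 'u"
  TotT :: "'u \<Rightarrow> 'u"

locale transformation =
  Src: pseudo_map X Y "Src t" + Tgt: pseudo_map X Y "Tgt t"
  for X Y :: "'u compcat" and t :: "'u trafo" +
  assumes BaseT: "nat_trans (Base X) (Base Y) (BaseF (Src t)) (BaseF (Tgt t)) (BaseT t)"
    and TotT: "nat_trans (Total X) (Total Y) (TotF (Src t)) (TotF (Tgt t)) (TotT t)"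
    and TotT_over: "A \<in> Obj (Total X) \<Longrightarrow> AM (Proj Y) (TotT t A) = BaseT t (OM (Proj X) A)"
    and TotT_Cmp: "A \<in> Obj (Total X) \<Longrightarrow>
      Top (Cmp (Tgt t) A) \<cdot>\<^bsub>Base Y\<^esub> Top (AM (Compr Y) (TotT t A))
      = BaseT t (Dom (Base X) (OM (Compr X) A)) \<cdot>\<^bsub>Base Y\<^esub> Top (Cmp (Src t) A)"

definition full_compcat :: "'u compcat \<Rightarrow> bool" where
  "full_compcat X \<longleftrightarrow> full_ftor (Total X) (arrow_cat (Base X)) (Compr X) \<and>
     faithful_ftor (Total X) (Compr X)"

definition subcategorical :: "'u compcat \<Rightarrow> bool" where
  "subcategorical X \<longleftrightarrow> full_ftor (Total X) (arrow_cat (Base X)) (Compr X) \<and>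
     faithful_ftor (Total X) (Compr X) \<and> inj_on (OM (Compr X)) (Obj (Total X))"

definition replete :: "'u compcat \<Rightarrow> bool" where
  "replete X \<longleftrightarrow> subcategorical X \<and>
     (\<forall>f \<in> OM (Compr X) ` Obj (Total X). \<forall>g \<in> Obj (arrow_cat (Base X)).
        isomorphic (arrow_cat (Base X)) f g \<longrightarrow> g \<in> OM (Compr X) ` Obj (Total X))"


section \<open>Strict 2-categories\<close>

text \<open>
  A 2-category is given as a \<open>Cat\<close>-enriched category: a category \<open>HomCat K a b\<close> for each pair of
  objects (whose composition is vertical composition) and a composition functor
  \<open>HComp K a b c\<close> from \<open>HomCat K b c \<times> HomCat K a b\<close> to \<open>HomCat K a c\<close>.
\<close>

record ('o, 'm, 't) twocat =
  Ob0 :: "'o set"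
  HomCat :: "'o \<Rightarrow> 'o \<Rightarrow> ('m, 't) cat"
  One :: "'o \<Rightarrow> 'm"
  HComp :: "'o \<Rightarrow> 'o \<Rightarrow> 'o \<Rightarrow> ('m \<times> 'm, 't \<times> 't, 'm, 't) ftor"

abbreviation comp1 :: "('o, 'm, 't) twocat \<Rightarrow> 'o \<Rightarrow> 'o \<Rightarrow> 'o \<Rightarrow> 'm \<Rightarrow> 'm \<Rightarrow> 'm" where
  "comp1 K a b c g f \<equiv> OM (HComp K a b c) (g, f)"

abbreviation comp2 :: "('o, 'm, 't) twocat \<Rightarrow> 'o \<Rightarrow> 'o \<Rightarrow> 'o \<Rightarrow> 't \<Rightarrow> 't \<Rightarrow> 't" where
  "comp2 K a b c \<beta> \<alpha> \<equiv> AM (HComp K a b c) (\<beta>, \<alpha>)"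

locale two_category =
  fixes K :: "('o, 'm, 't) twocat"
  assumes HomCat: "\<lbrakk>a \<in> Ob0 K; b \<in> Ob0 K\<rbrakk> \<Longrightarrow> category (HomCat K a b)"
    and One_in: "a \<in> Ob0 K \<Longrightarrow> One K a \<in> Obj (HomCat K a a)"
    and HComp: "\<lbrakk>a \<in> Ob0 K; b \<in> Ob0 K; c \<in> Ob0 K\<rbrakk> \<Longrightarrow>
      cat_functor (prod_cat (HomCat K b c) (HomCat K a b)) (HomCat K a c) (HComp K a b c)"
    and comp1_One: "\<lbrakk>a \<in> Ob0 K; b \<in> Ob0 K; f \<in> Obj (HomCat K a b)\<rbrakk> \<Longrightarrow>
      comp1 K a a b f (One K a) = f"
    and One_comp1: "\<lbrakk>a \<in> Ob0 K; b \<in> Ob0 K; f \<in> Obj (HomCat K a b)\<rbrakk> \<Longrightarrow>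
      comp1 K a b b (One K b) f = f"
    and comp2_One: "\<lbrakk>a \<in> Ob0 K; b \<in> Ob0 K; \<alpha> \<in> Arr (HomCat K a b)\<rbrakk> \<Longrightarrow>
      comp2 K a a b \<alpha> (Ident (HomCat K a a) (One K a)) = \<alpha>"
    and One_comp2: "\<lbrakk>a \<in> Ob0 K; b \<in> Ob0 K; \<alpha> \<in> Arr (HomCat K a b)\<rbrakk> \<Longrightarrow>
      comp2 K a b b (Ident (HomCat K b b) (One K b)) \<alpha> = \<alpha>"
    and comp1_assoc: "\<lbrakk>a \<in> Ob0 K; b \<in> Ob0 K; c \<in> Ob0 K; d \<in> Ob0 K;
        f \<in> Obj (HomCat K a b); g \<in> Obj (HomCat K b c); h \<in> Obj (HomCat K c d)\<rbrakk> \<Longrightarrow>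
      comp1 K a b d (comp1 K b c d h g) f = comp1 K a c d h (comp1 K a b c g f)"
    and comp2_assoc: "\<lbrakk>a \<in> Ob0 K; b \<in> Ob0 K; c \<in> Ob0 K; d \<in> Ob0 K;
        \<alpha> \<in> Arr (HomCat K a b); \<beta> \<in> Arr (HomCat K b c); \<gamma> \<in> Arr (HomCat K c d)\<rbrakk> \<Longrightarrow>
      comp2 K a b d (comp2 K b c d \<gamma> \<beta>) \<alpha> = comp2 K a c d \<gamma> (comp2 K a b c \<beta> \<alpha>)"

record ('o, 'm, 't, 'p, 'n, 's) twoftor =
  ObM :: "'o \<Rightarrow> 'p"
  HomM :: "'o \<Rightarrow> 'o \<Rightarrow> ('m, 't, 'n, 's) ftor"

locale two_functor = K: two_category K + L: two_category L
  for K :: "('o, 'm, 't) twocat" and L :: "('p, 'n, 's) twocat" +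
  fixes F :: "('o, 'm, 't, 'p, 'n, 's) twoftor"
  assumes ObM_in: "a \<in> Ob0 K \<Longrightarrow> ObM F a \<in> Ob0 L"
    and HomM: "\<lbrakk>a \<in> Ob0 K; b \<in> Ob0 K\<rbrakk> \<Longrightarrow>
      cat_functor (HomCat K a b) (HomCat L (ObM F a) (ObM F b)) (HomM F a b)"
    and HomM_One: "a \<in> Ob0 K \<Longrightarrow> OM (HomM F a a) (One K a) = One L (ObM F a)"
    and HomM_comp1: "\<lbrakk>a \<in> Ob0 K; b \<in> Ob0 K; c \<in> Ob0 K;
        f \<in> Obj (HomCat K a b); g \<in> Obj (HomCat K b c)\<rbrakk> \<Longrightarrow>
      OM (HomM F a c) (comp1 K a b c g f)
      = comp1 L (ObM F a) (ObM F b) (ObM F c) (OM (HomM F b c) g) (OM (HomM F a b) f)"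
    and HomM_comp2: "\<lbrakk>a \<in> Ob0 K; b \<in> Ob0 K; c \<in> Ob0 K;
        \<alpha> \<in> Arr (HomCat K a b); \<beta> \<in> Arr (HomCat K b c)\<rbrakk> \<Longrightarrow>
      AM (HomM F a c) (comp2 K a b c \<beta> \<alpha>)
      = comp2 L (ObM F a) (ObM F b) (ObM F c) (AM (HomM F b c) \<beta>) (AM (HomM F a b) \<alpha>)"

definition internally_equivalent :: "('o, 'm, 't) twocat \<Rightarrow> 'o \<Rightarrow> 'o \<Rightarrow> bool" where
  "internally_equivalent K a b \<longleftrightarrow>
     (\<exists>f \<in> Obj (HomCat K a b). \<exists>g \<in> Obj (HomCat K b a).
        isomorphic (HomCat K a a) (One K a) (comp1 K a b a g f) \<and>
        isomorphic (HomCat K b b) (comp1 K b a b f g) (One K b))"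

definition two_equivalence :: "('o, 'm, 't) twocat \<Rightarrow> ('p, 'n, 's) twocat
    \<Rightarrow> ('o, 'm, 't, 'p, 'n, 's) twoftor \<Rightarrow> bool" where
  "two_equivalence K L F \<longleftrightarrow> two_functor K L F \<and>
     (\<forall>a \<in> Ob0 K. \<forall>b \<in> Ob0 K.
        cat_equivalence (HomCat K a b) (HomCat L (ObM F a) (ObM F b)) (HomM F a b)) \<and>
     (\<forall>y \<in> Ob0 L. \<exists>a \<in> Ob0 K. internally_equivalent L (ObM F a) y)"

text \<open>
  2-naturality of \<open>\<theta>\<close> in both variables is stated jointly, i.e. for \<open>\<theta>\<close> as a 2-natural
  transformation between 2-functors from \<open>L\<^sup>o\<^sup>p \<times> K\<close> to \<open>Cat\<close>: \<open>\<theta>\<close> commutes with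
  whiskering by 1-cells \<open>f : x' \<rightarrow> x\<close>, \<open>g : y \<rightarrow> y'\<close> and with horizontal composition
  with 2-cells between such 1-cells. (Naturality of each functor in the hom-square on arrows is
  the case of identity 2-cells.)
\<close>

locale two_adjunction =
  F: two_functor L K F + U: two_functor K L U
  for K :: "('o, 'm, 't) twocat" and L :: "('p, 'n, 's) twocat"
    and F :: "('p, 'n, 's, 'o, 'm, 't) twoftor" and U :: "('o, 'm, 't, 'p, 'n, 's) twoftor" +
  fixes \<theta> :: "'p \<Rightarrow> 'o \<Rightarrow> ('m, 't, 'n, 's) ftor"
  assumes hom_iso: "\<lbrakk>x \<in> Ob0 L; y \<in> Ob0 K\<rbrakk> \<Longrightarrow>
      cat_isomorphism (HomCat K (ObM F x) y) (HomCat L x (ObM U y)) (\<theta> x y)"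
    and natural1: "\<lbrakk>x \<in> Ob0 L; x' \<in> Ob0 L; y \<in> Ob0 K; y' \<in> Ob0 K;
        f \<in> Obj (HomCat L x' x); h \<in> Obj (HomCat K (ObM F x) y); g \<in> Obj (HomCat K y y')\<rbrakk> \<Longrightarrow>
      OM (\<theta> x' y') (comp1 K (ObM F x') y y' g
        (comp1 K (ObM F x') (ObM F x) y h (OM (HomM F x' x) f)))
      = comp1 L x' (ObM U y) (ObM U y') (OM (HomM U y y') g)
          (comp1 L x' x (ObM U y) (OM (\<theta> x y) h) f)"
    and natural2: "\<lbrakk>x \<in> Ob0 L; x' \<in> Ob0 L; y \<in> Ob0 K; y' \<in> Ob0 K;
        \<alpha> \<in> Arr (HomCat L x' x); \<tau> \<in> Arr (HomCat K (ObM F x) y); \<beta> \<in> Arr (HomCat K y y')\<rbrakk> \<Longrightarrow>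
      AM (\<theta> x' y') (comp2 K (ObM F x') y y' \<beta>
        (comp2 K (ObM F x') (ObM F x) y \<tau> (AM (HomM F x' x) \<alpha>)))
      = comp2 L x' (ObM U y) (ObM U y') (AM (HomM U y y') \<beta>)
          (comp2 L x' x (ObM U y) (AM (\<theta> x y) \<tau>) \<alpha>)"

definition has_left_two_adjoint :: "('o, 'm, 't) twocat \<Rightarrow> ('p, 'n, 's) twocat
    \<Rightarrow> ('o, 'm, 't, 'p, 'n, 's) twoftor \<Rightarrow> bool" where
  "has_left_two_adjoint K L U \<longleftrightarrow> (\<exists>F \<theta>. two_adjunction K L F U \<theta>)"

definition full_sub2 :: "('o, 'm, 't) twocat \<Rightarrow> ('o \<Rightarrow> bool) \<Rightarrow> ('o, 'm, 't) twocat" where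
  "full_sub2 K Q = K\<lparr> Ob0 := {a \<in> Ob0 K. Q a} \<rparr>"

text \<open>The inclusion 2-functor of \<open>K\<close> into any 2-category of which \<open>K\<close> is a full sub-2-category.\<close>

definition incl2 :: "('o, 'm, 't) twocat \<Rightarrow> ('o, 'm, 't, 'o, 'm, 't) twoftor" where
  "incl2 K = \<lparr> ObM = (\<lambda>a. a), HomM = (\<lambda>a b. id_ftor (HomCat K a b)) \<rparr>"


section \<open>The 2-category of comprehension categories\<close>

definition pmap_id :: "'u compcat \<Rightarrow> 'u pmap" where
  "pmap_id X = \<lparr>
     BaseF = id_ftor (Base X),
     TotF = id_ftor (Total X),
     Cmp = (\<lambda>A \<in> Obj (Total X). Ident (arrow_cat (Base X)) (OM (Compr X) A)) \<rparr>"

definition pmap_comp :: "'u compcat \<Rightarrow> 'u compcat \<Rightarrow> 'u compcat \<Rightarrow> 'u pmap \<Rightarrow> 'u pmap \<Rightarrow> 'u pmap"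
  where
  "pmap_comp X Y Z Q P = \<lparr>
     BaseF = fcomp (Base X) (BaseF Q) (BaseF P),
     TotF = fcomp (Total X) (TotF Q) (TotF P),
     Cmp = (\<lambda>A \<in> Obj (Total X).
              AM (arrow_ftor (Base Y) (BaseF Q)) (Cmp P A)
              \<cdot>\<^bsub>arrow_cat (Base Z)\<^esub> Cmp Q (OM (TotF P) A)) \<rparr>"

definition trafo_id :: "'u compcat \<Rightarrow> 'u compcat \<Rightarrow> 'u pmap \<Rightarrow> 'u trafo" where
  "trafo_id X Y P = \<lparr> Src = P, Tgt = P,
     BaseT = (\<lambda>x \<in> Obj (Base X). Ident (Base Y) (OM (BaseF P) x)),
     TotT = (\<lambda>A \<in> Obj (Total X). Ident (Total Y) (OM (TotF P) A)) \<rparr>"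

definition trafo_vcomp :: "'u compcat \<Rightarrow> 'u compcat \<Rightarrow> 'u trafo \<Rightarrow> 'u trafo \<Rightarrow> 'u trafo" where
  "trafo_vcomp X Y u t = \<lparr> Src = Src t, Tgt = Tgt u,
     BaseT = (\<lambda>x \<in> Obj (Base X). BaseT u x \<cdot>\<^bsub>Base Y\<^esub> BaseT t x),
     TotT = (\<lambda>A \<in> Obj (Total X). TotT u A \<cdot>\<^bsub>Total Y\<^esub> TotT t A) \<rparr>"

definition trafo_hcomp :: "'u compcat \<Rightarrow> 'u compcat \<Rightarrow> 'u compcat \<Rightarrow> 'u trafo \<Rightarrow> 'u trafo \<Rightarrow> 'u trafo"
  where
  "trafo_hcomp X Y Z u t = \<lparr>
     Src = pmap_comp X Y Z (Src u) (Src t),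
     Tgt = pmap_comp X Y Z (Tgt u) (Tgt t),
     BaseT = (\<lambda>x \<in> Obj (Base X).
       BaseT u (OM (BaseF (Tgt t)) x) \<cdot>\<^bsub>Base Z\<^esub> AM (BaseF (Src u)) (BaseT t x)),
     TotT = (\<lambda>A \<in> Obj (Total X).
       TotT u (OM (TotF (Tgt t)) A) \<cdot>\<^bsub>Total Z\<^esub> AM (TotF (Src u)) (TotT t A)) \<rparr>"

definition pmap_cat :: "'u compcat \<Rightarrow> 'u compcat \<Rightarrow> ('u pmap, 'u trafo) cat" where
  "pmap_cat X Y = \<lparr>
     Obj = {P. pseudo_map X Y P},
     Arr = {t. transformation X Y t},
     Dom = Src,
     Cod = Tgt,
     Ident = trafo_id X Y,
     Comp = trafo_vcomp X Y \<rparr>"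

definition CompCat :: "('u compcat, 'u pmap, 'u trafo) twocat" where
  "CompCat = \<lparr>
     Ob0 = {X. comprehension_category X},
     HomCat = pmap_cat,
     One = pmap_id,
     HComp = (\<lambda>X Y Z. \<lparr>
       OM = restrict (\<lambda>(Q, P). pmap_comp X Y Z Q P) (Obj (pmap_cat Y Z) \<times> Obj (pmap_cat X Y)),
       AM = restrict (\<lambda>(u, t). trafo_hcomp X Y Z u t) (Arr (pmap_cat Y Z) \<times> Arr (pmap_cat X Y)) \<rparr>) \<rparr>"

definition CompCat_full :: "('u compcat, 'u pmap, 'u trafo) twocat" where
  "CompCat_full = full_sub2 CompCat full_compcat"

definition CompCat_sub :: "('u compcat, 'u pmap, 'u trafo) twocat" where
  "CompCat_sub = full_sub2 CompCat subcategorical"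

definition CompCat_repl :: "('u compcat, 'u pmap, 'u trafo) twocat" where
  "CompCat_repl = full_sub2 CompCat replete"

end

theory Submission
  imports Defs
begin

text \<open>
  A pseudo map into a full comprehension category is determined by its base functor, its action
  on the objects of the total category and its comparison squares, and a transformation between
  such maps is determined by its base component, which may be any natural transformation.

  Left adjoint: replace the arrows of the total category by all squares between comprehensions.
  Precomposition with the identity-on-objects unit changes none of the data above, so it is an
  isomorphism of hom-categories for full targets. For the extension of a pseudo map to preserve
  cartesian arrows one uses that every pullback square between comprehensions is the
  comprehension of a cartesian arrow up to a vertical isomorphism.

  Equivalences: the arrows isomorphic to a comprehension, with all squares between them, form a
  replete comprehension category, since over any base arrow isomorphisms can be made vertical by
  reindexing. For a full comprehension category, choosing vertical isomorphisms yields pseudo maps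
  in both directions over the identity of the base, and these are automatically mutually inverse
  up to isomorphism.
\<close>


section \<open>Categories\<close>

text \<open>Arrows of a total category must be elements of \<open>'u\<close>, so the squares that
  become arrows have to be coded; this is where infinity of \<open>'u\<close> enters. The full image
  keeps the old objects as labels instead of using the comprehensions themselves: objects with the
  same comprehension stay distinct, a pseudo map acts on the same objects before and after, and the
  adjunction becomes strict. The repletion does the opposite: its objects are the arrows themselves,
  which makes comprehension injective on objects, so that one construction serves both equivalences.
  The obstacle is preservation of cartesian arrows. The base functor of a pseudo map need not
  preserve pullbacks; it is only known to preserve the pullback squares that come from cartesian
  arrows, while enlarging the total category creates new cartesian arrows. Treating pullback squares
  as the cartesian arrows of the codomain functor reduces the problem to closure of cartesian arrows
  under composition and isomorphism.\<close>

context category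
begin

lemma Dom_Obj [simp]: "f \<in> Arr C \<Longrightarrow> Dom C f \<in> Obj C"
  and Cod_Obj [simp]: "f \<in> Arr C \<Longrightarrow> Cod C f \<in> Obj C"
  by (fact Dom_in Cod_in)+

lemma Ident_simps [simp]:
  assumes "x \<in> Obj C"
  shows "Ident C x \<in> Arr C" "Dom C (Ident C x) = x" "Cod C (Ident C x) = x"
  using Ident_in[OF assms] by (auto simp: homset_def)

lemma Comp_simps [simp]:
  assumes "f \<in> Arr C" "g \<in> Arr C" "Dom C g = Cod C f"
  shows "g \<cdot>\<^bsub>C\<^esub> f \<in> Arr C" "Dom C (g \<cdot>\<^bsub>C\<^esub> f) = Dom C f" "Cod C (g \<cdot>\<^bsub>C\<^esub> f) = Cod C g"
  using Comp_in[of f "Dom C f" "Cod C f" g "Cod C g"] assms by (auto simp: homset_def)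

lemma Comp_Ident_right [simp]: "f \<in> Arr C \<Longrightarrow> x = Dom C f \<Longrightarrow> f \<cdot>\<^bsub>C\<^esub> Ident C x = f"
  and Comp_Ident_left [simp]: "f \<in> Arr C \<Longrightarrow> x = Cod C f \<Longrightarrow> Ident C x \<cdot>\<^bsub>C\<^esub> f = f"
  using Comp_Ident[of f] Ident_Comp[of f] by (auto simp: homset_def)

lemma Comp_assoc_Arr:
  "\<lbrakk>f \<in> Arr C; g \<in> Arr C; h \<in> Arr C; Dom C g = Cod C f; Dom C h = Cod C g\<rbrakk>
    \<Longrightarrow> h \<cdot>\<^bsub>C\<^esub> g \<cdot>\<^bsub>C\<^esub> f = h \<cdot>\<^bsub>C\<^esub> (g \<cdot>\<^bsub>C\<^esub> f)"
  by (rule Comp_assoc[of f "Dom C f" "Cod C f" g "Cod C g" h "Cod C h"]) (auto simp: homset_def)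

lemma iso_arrowI:
  assumes "f \<in> Arr C" "g \<in> Arr C" "Dom C g = Cod C f" "Cod C g = Dom C f"
    "g \<cdot>\<^bsub>C\<^esub> f = Ident C (Dom C f)" "f \<cdot>\<^bsub>C\<^esub> g = Ident C (Cod C f)"
  shows "iso_arrow C f"
  using assms by (auto simp: iso_arrow_def homset_def)

lemma iso_arrowE:
  assumes "iso_arrow C f"
  obtains g where "f \<in> Arr C" "g \<in> Arr C" "Dom C g = Cod C f" "Cod C g = Dom C f"
    "g \<cdot>\<^bsub>C\<^esub> f = Ident C (Dom C f)" "f \<cdot>\<^bsub>C\<^esub> g = Ident C (Cod C f)" "iso_arrow C g"
  using assms by (fastforce simp: iso_arrow_def homset_def)

lemma iso_arrow_Ident [simp]: "x \<in> Obj C \<Longrightarrow> iso_arrow C (Ident C x)"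
  by (rule iso_arrowI[of _ "Ident C x"]) auto

lemma iso_arrow_Comp:
  assumes "iso_arrow C f" "iso_arrow C g" "Dom C g = Cod C f"
  shows "iso_arrow C (g \<cdot>\<^bsub>C\<^esub> f)"
proof -
  obtain f' where f: "f \<in> Arr C" "f' \<in> Arr C" "Dom C f' = Cod C f" "Cod C f' = Dom C f"
    "f' \<cdot>\<^bsub>C\<^esub> f = Ident C (Dom C f)" "f \<cdot>\<^bsub>C\<^esub> f' = Ident C (Cod C f)"
    using assms(1) iso_arrowE by metis
  obtain g' where g: "g \<in> Arr C" "g' \<in> Arr C" "Dom C g' = Cod C g" "Cod C g' = Dom C g"
    "g' \<cdot>\<^bsub>C\<^esub> g = Ident C (Dom C g)" "g \<cdot>\<^bsub>C\<^esub> g' = Ident C (Cod C g)"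
    using assms(2) iso_arrowE by metis
  have 1: "f' \<cdot>\<^bsub>C\<^esub> g' \<cdot>\<^bsub>C\<^esub> (g \<cdot>\<^bsub>C\<^esub> f) = f' \<cdot>\<^bsub>C\<^esub> ((g' \<cdot>\<^bsub>C\<^esub> g) \<cdot>\<^bsub>C\<^esub> f)"
    by (subst Comp_assoc_Arr) (use f(1-4) g(1-4) assms(3) in \<open>auto simp: Comp_assoc_Arr\<close>)
  have 2: "g \<cdot>\<^bsub>C\<^esub> f \<cdot>\<^bsub>C\<^esub> (f' \<cdot>\<^bsub>C\<^esub> g') = g \<cdot>\<^bsub>C\<^esub> ((f \<cdot>\<^bsub>C\<^esub> f') \<cdot>\<^bsub>C\<^esub> g')"
    by (subst Comp_assoc_Arr) (use f(1-4) g(1-4) assms(3) in \<open>auto simp: Comp_assoc_Arr\<close>)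
  show ?thesis
    by (rule iso_arrowI[of _ "f' \<cdot>\<^bsub>C\<^esub> g'"]) (use f g assms(3) 1 2 in auto)
qed

lemma iso_arrow_mono:
  assumes "iso_arrow C s" "u \<in> Arr C" "v \<in> Arr C" "Cod C u = Dom C s" "Cod C v = Dom C s"
    "s \<cdot>\<^bsub>C\<^esub> u = s \<cdot>\<^bsub>C\<^esub> v"
  shows "u = v"
proof -
  obtain s' where s: "s \<in> Arr C" "s' \<in> Arr C" "Dom C s' = Cod C s" "Cod C s' = Dom C s"
    "s' \<cdot>\<^bsub>C\<^esub> s = Ident C (Dom C s)"
    using assms(1) iso_arrowE by metis
  have "u = s' \<cdot>\<^bsub>C\<^esub> s \<cdot>\<^bsub>C\<^esub> u" using s assms by simp
  also have "\<dots> = s' \<cdot>\<^bsub>C\<^esub> s \<cdot>\<^bsub>C\<^esub> v" using s(1-4) assms by (simp add: Comp_assoc_Arr)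
  also have "\<dots> = v" using s assms by simp
  finally show ?thesis .
qed

lemma isomorphicI: "iso_arrow C f \<Longrightarrow> Dom C f = x \<Longrightarrow> Cod C f = y \<Longrightarrow> isomorphic C x y"
  by (auto simp: isomorphic_def homset_def iso_arrow_def)

lemma isomorphic_trans: "isomorphic C x y \<Longrightarrow> isomorphic C y z \<Longrightarrow> isomorphic C x z"
  unfolding isomorphic_def homset_def by clarsimp (metis Comp_simps iso_arrow_Comp)

lemma isomorphic_refl: "x \<in> Obj C \<Longrightarrow> isomorphic C x x"
  by (rule isomorphicI[OF iso_arrow_Ident]) auto

end

text \<open>The locale speaks of hom-sets; here membership, domain and codomain are separate
  conditions, which rewriting can discharge.\<close>

lemma categoryI:
  assumes "\<And>f. f \<in> Arr C \<Longrightarrow> Dom C f \<in> Obj C \<and> Cod C f \<in> Obj C"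
    and "\<And>x. x \<in> Obj C \<Longrightarrow> Ident C x \<in> Arr C \<and> Dom C (Ident C x) = x \<and> Cod C (Ident C x) = x"
    and "\<And>f g. \<lbrakk>f \<in> Arr C; g \<in> Arr C; Dom C g = Cod C f\<rbrakk> \<Longrightarrow>
      g \<cdot>\<^bsub>C\<^esub> f \<in> Arr C \<and> Dom C (g \<cdot>\<^bsub>C\<^esub> f) = Dom C f \<and> Cod C (g \<cdot>\<^bsub>C\<^esub> f) = Cod C g"
    and "\<And>f. f \<in> Arr C \<Longrightarrow> f \<cdot>\<^bsub>C\<^esub> Ident C (Dom C f) = f \<and> Ident C (Cod C f) \<cdot>\<^bsub>C\<^esub> f = f"
    and "\<And>f g h. \<lbrakk>f \<in> Arr C; g \<in> Arr C; h \<in> Arr C; Dom C g = Cod C f; Dom C h = Cod C g\<rbrakk> \<Longrightarrow>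
      h \<cdot>\<^bsub>C\<^esub> g \<cdot>\<^bsub>C\<^esub> f = h \<cdot>\<^bsub>C\<^esub> (g \<cdot>\<^bsub>C\<^esub> f)"
  shows "category C"
  using assms by unfold_locales (auto simp: homset_def)


section \<open>Functors and natural transformations\<close>

context cat_functor
begin

lemma AM_simps [simp]:
  assumes "f \<in> Arr C"
  shows "AM F f \<in> Arr D" "Dom D (AM F f) = OM F (Dom C f)" "Cod D (AM F f) = OM F (Cod C f)"
  using AM_in[of f "Dom C f" "Cod C f"] assms by (auto simp: homset_def)

lemmas OM_Obj [simp] = OM_in
  and AM_Ident' [simp] = AM_Ident

lemma AM_Comp_Arr:
  "\<lbrakk>f \<in> Arr C; g \<in> Arr C; Dom C g = Cod C f\<rbrakk> \<Longrightarrow> AM F (g \<cdot>\<^bsub>C\<^esub> f) = AM F g \<cdot>\<^bsub>D\<^esub> AM F f"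
  by (rule AM_Comp) (auto simp: homset_def)

lemma iso_arrow_AM: "iso_arrow C f \<Longrightarrow> iso_arrow D (AM F f)"
proof (erule C.iso_arrowE)
  fix g assume "f \<in> Arr C" "g \<in> Arr C" "Dom C g = Cod C f" "Cod C g = Dom C f"
    "g \<cdot>\<^bsub>C\<^esub> f = Ident C (Dom C f)" "f \<cdot>\<^bsub>C\<^esub> g = Ident C (Cod C f)"
  then show "iso_arrow D (AM F f)"
    by (intro D.iso_arrowI[of _ "AM F g"]) (auto simp flip: AM_Comp_Arr)
qed

end

lemma cat_functorI:
  assumes "category C" "category D"
    and "OM F \<in> extensional (Obj C)" "AM F \<in> extensional (Arr C)"
    and "\<And>x. x \<in> Obj C \<Longrightarrow> OM F x \<in> Obj D"
    and "\<And>f. f \<in> Arr C \<Longrightarrow>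
      AM F f \<in> Arr D \<and> Dom D (AM F f) = OM F (Dom C f) \<and> Cod D (AM F f) = OM F (Cod C f)"
    and "\<And>x. x \<in> Obj C \<Longrightarrow> AM F (Ident C x) = Ident D (OM F x)"
    and "\<And>f g. \<lbrakk>f \<in> Arr C; g \<in> Arr C; Dom C g = Cod C f\<rbrakk> \<Longrightarrow>
      AM F (g \<cdot>\<^bsub>C\<^esub> f) = AM F g \<cdot>\<^bsub>D\<^esub> AM F f"
  shows "cat_functor C D F"
  using assms by (intro cat_functor.intro cat_functor_axioms.intro) (auto simp: homset_def)

lemma ftor_eqI:
  fixes F :: "('o, 'a, 'p, 'b) ftor"
  assumes "cat_functor C D F" "cat_functor C D G"
    and "\<And>x. x \<in> Obj C \<Longrightarrow> OM F x = OM G x" "\<And>f. f \<in> Arr C \<Longrightarrow> AM F f = AM G f"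
  shows "F = G"
proof -
  have "OM F = OM G" "AM F = AM G"
    using assms by (meson cat_functor.OM_ext cat_functor.AM_ext extensionalityI)+
  then show ?thesis by simp
qed

lemma OM_fcomp [simp]: "x \<in> Obj C \<Longrightarrow> OM (fcomp C G F) x = OM G (OM F x)"
  and AM_fcomp [simp]: "f \<in> Arr C \<Longrightarrow> AM (fcomp C G F) f = AM G (AM F f)"
  by (auto simp: fcomp_def)

lemma OM_id_ftor [simp]: "x \<in> Obj C \<Longrightarrow> OM (id_ftor C) x = x"
  and AM_id_ftor [simp]: "f \<in> Arr C \<Longrightarrow> AM (id_ftor C) f = f"
  by (auto simp: id_ftor_def)

lemma cat_functor_id_ftor: "category C \<Longrightarrow> cat_functor C C (id_ftor C)"
proof -
  assume "category C"
  then interpret category C .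
  show ?thesis by (rule cat_functorI) (auto simp: id_ftor_def category_axioms)
qed

lemma cat_functor_fcomp:
  assumes "cat_functor C D F" "cat_functor D E G"
  shows "cat_functor C E (fcomp C G F)"
proof -
  interpret F: cat_functor C D F by fact
  interpret G: cat_functor D E G by fact
  show ?thesis
    by (rule cat_functorI)
      (auto simp: fcomp_def F.AM_Comp_Arr G.AM_Comp_Arr F.C.category_axioms G.D.category_axioms)
qed

lemma
  assumes "cat_functor C D F"
  shows fcomp_id_right: "fcomp C F (id_ftor C) = F"
    and fcomp_id_left: "fcomp C (id_ftor D) F = F"
proof -
  interpret cat_functor C D F by fact
  note functors = assms cat_functor_id_ftor[OF C.category_axioms]
    cat_functor_id_ftor[OF D.category_axioms]
  show "fcomp C F (id_ftor C) = F"
    by (rule ftor_eqI[of C D]) (auto intro: functors cat_functor_fcomp)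
  show "fcomp C (id_ftor D) F = F"
    by (rule ftor_eqI[of C D]) (auto intro: functors cat_functor_fcomp)
qed

lemma fcomp_assoc:
  "cat_functor C D F \<Longrightarrow> fcomp C (fcomp D H G) F = fcomp C H (fcomp C G F)"
  by (auto simp: fcomp_def cat_functor.AM_simps cat_functor.OM_in)

section \<open>Natural transformations and their vertical and horizontal composition\<close>

lemma nat_transI:
  assumes "cat_functor C D F" "cat_functor C D G" "\<tau> \<in> extensional (Obj C)"
    and "\<And>x. x \<in> Obj C \<Longrightarrow> \<tau> x \<in> Arr D \<and> Dom D (\<tau> x) = OM F x \<and> Cod D (\<tau> x) = OM G x"
    and "\<And>f. f \<in> Arr C \<Longrightarrow> \<tau> (Cod C f) \<cdot>\<^bsub>D\<^esub> AM F f = AM G f \<cdot>\<^bsub>D\<^esub> \<tau> (Dom C f)"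
  shows "nat_trans C D F G \<tau>"
  using assms by (auto simp: nat_trans_def homset_def)

lemma nat_transD:
  assumes "nat_trans C D F G \<tau>"
  shows "cat_functor C D F" "cat_functor C D G" "\<tau> \<in> extensional (Obj C)"
    and "x \<in> Obj C \<Longrightarrow> \<tau> x \<in> Arr D" "x \<in> Obj C \<Longrightarrow> Dom D (\<tau> x) = OM F x"
    and "x \<in> Obj C \<Longrightarrow> Cod D (\<tau> x) = OM G x"
    and "f \<in> Arr C \<Longrightarrow> \<tau> (Cod C f) \<cdot>\<^bsub>D\<^esub> AM F f = AM G f \<cdot>\<^bsub>D\<^esub> \<tau> (Dom C f)"
  using assms by (auto simp: nat_trans_def homset_def)

lemma nat_trans_Ident:
  assumes "cat_functor C D F"
  shows "nat_trans C D F F (\<lambda>x \<in> Obj C. Ident D (OM F x))"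
proof -
  interpret cat_functor C D F by fact
  show ?thesis by (rule nat_transI) (auto simp: assms)
qed

lemma nat_trans_vcomp:
  assumes "nat_trans C D F G \<sigma>" "nat_trans C D G H \<tau>"
  shows "nat_trans C D F H (\<lambda>x \<in> Obj C. \<tau> x \<cdot>\<^bsub>D\<^esub> \<sigma> x)"
proof -
  note [simp] = nat_transD(3-6)[OF assms(1)] nat_transD(3-6)[OF assms(2)]
  interpret F: cat_functor C D F using nat_transD(1)[OF assms(1)] .
  interpret G: cat_functor C D G using nat_transD(1)[OF assms(2)] .
  interpret H: cat_functor C D H using nat_transD(2)[OF assms(2)] .
  have "\<tau> (Cod C f) \<cdot>\<^bsub>D\<^esub> \<sigma> (Cod C f) \<cdot>\<^bsub>D\<^esub> AM F f = AM H f \<cdot>\<^bsub>D\<^esub> (\<tau> (Dom C f) \<cdot>\<^bsub>D\<^esub> \<sigma> (Dom C f))"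
    if "f \<in> Arr C" for f
  proof -
    have "\<tau> (Cod C f) \<cdot>\<^bsub>D\<^esub> \<sigma> (Cod C f) \<cdot>\<^bsub>D\<^esub> AM F f = \<tau> (Cod C f) \<cdot>\<^bsub>D\<^esub> (AM G f \<cdot>\<^bsub>D\<^esub> \<sigma> (Dom C f))"
      using that nat_transD(7)[OF assms(1) that] by (simp add: F.D.Comp_assoc_Arr)
    also have "\<dots> = \<tau> (Cod C f) \<cdot>\<^bsub>D\<^esub> AM G f \<cdot>\<^bsub>D\<^esub> \<sigma> (Dom C f)"
      using that by (simp add: F.D.Comp_assoc_Arr)
    also have "\<dots> = AM H f \<cdot>\<^bsub>D\<^esub> (\<tau> (Dom C f) \<cdot>\<^bsub>D\<^esub> \<sigma> (Dom C f))"
      unfolding nat_transD(7)[OF assms(2) that] using that by (simp add: F.D.Comp_assoc_Arr)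
    finally show ?thesis .
  qed
  then show ?thesis
    by (intro nat_transI) (auto simp: F.cat_functor_axioms H.cat_functor_axioms)
qed

lemma nat_trans_hcomp:
  assumes "nat_trans C D F F' \<sigma>" "nat_trans D E G G' \<tau>"
  shows "nat_trans C E (fcomp C G F) (fcomp C G' F')
    (\<lambda>x \<in> Obj C. \<tau> (OM F' x) \<cdot>\<^bsub>E\<^esub> AM G (\<sigma> x))"
proof -
  note [simp] = nat_transD(3-6)[OF assms(1)] nat_transD(3-6)[OF assms(2)]
  interpret F: cat_functor C D F using nat_transD(1)[OF assms(1)] .
  interpret F': cat_functor C D F' using nat_transD(2)[OF assms(1)] .
  interpret G: cat_functor D E G using nat_transD(1)[OF assms(2)] .
  interpret G': cat_functor D E G' using nat_transD(2)[OF assms(2)] .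
  have "\<tau> (OM F' (Cod C f)) \<cdot>\<^bsub>E\<^esub> AM G (\<sigma> (Cod C f)) \<cdot>\<^bsub>E\<^esub> AM G (AM F f)
      = AM G' (AM F' f) \<cdot>\<^bsub>E\<^esub> (\<tau> (OM F' (Dom C f)) \<cdot>\<^bsub>E\<^esub> AM G (\<sigma> (Dom C f)))" if f: "f \<in> Arr C" for f
  proof -
    have "\<tau> (OM F' (Cod C f)) \<cdot>\<^bsub>E\<^esub> AM G (\<sigma> (Cod C f)) \<cdot>\<^bsub>E\<^esub> AM G (AM F f)
        = \<tau> (OM F' (Cod C f)) \<cdot>\<^bsub>E\<^esub> AM G (\<sigma> (Cod C f) \<cdot>\<^bsub>D\<^esub> AM F f)"
      using f by (simp add: G.AM_Comp_Arr G.D.Comp_assoc_Arr)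
    also have "\<dots> = \<tau> (OM F' (Cod C f)) \<cdot>\<^bsub>E\<^esub> AM G (AM F' f) \<cdot>\<^bsub>E\<^esub> AM G (\<sigma> (Dom C f))"
      unfolding nat_transD(7)[OF assms(1) f]
      using f by (simp add: G.AM_Comp_Arr G.D.Comp_assoc_Arr)
    also have "\<dots> = AM G' (AM F' f) \<cdot>\<^bsub>E\<^esub> \<tau> (OM F' (Dom C f)) \<cdot>\<^bsub>E\<^esub> AM G (\<sigma> (Dom C f))"
      using nat_transD(7)[OF assms(2), of "AM F' f"] f by simp
    also have "\<dots> = AM G' (AM F' f) \<cdot>\<^bsub>E\<^esub> (\<tau> (OM F' (Dom C f)) \<cdot>\<^bsub>E\<^esub> AM G (\<sigma> (Dom C f)))"
      using f by (simp add: G.D.Comp_assoc_Arr)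
    finally show ?thesis .
  qed
  then show ?thesis
    by (intro nat_transI cat_functor_fcomp[of C D _ E])
      (auto simp: F.cat_functor_axioms F'.cat_functor_axioms
        G.cat_functor_axioms G'.cat_functor_axioms)
qed

lemma nat_iso_Ident:
  assumes "cat_functor C D F"
  shows "nat_iso C D F F (\<lambda>x \<in> Obj C. Ident D (OM F x))"
  using assms nat_trans_Ident[OF assms]
  by (auto simp: nat_iso_def cat_functor_def category.iso_arrow_Ident cat_functor.OM_in)

lemma cat_equivalence_id_ftor:
  assumes "category C"
  shows "cat_equivalence C C (id_ftor C)"
  unfolding cat_equivalence_def
  using nat_iso_Ident[OF cat_functor_id_ftor[OF assms]] cat_functor_id_ftor[OF assms]
    fcomp_id_left[OF cat_functor_id_ftor[OF assms]] by metis


section \<open>The arrow category\<close>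

lemma arrow_cat_simps [simp]:
  "Obj (arrow_cat C) = Arr C" "Dom (arrow_cat C) = Lft" "Cod (arrow_cat C) = Rgt"
  "Ident (arrow_cat C) f
    = \<lparr> Lft = f, Rgt = f, Top = Ident C (Dom C f), Bot = Ident C (Cod C f) \<rparr>"
  "t \<cdot>\<^bsub>arrow_cat C\<^esub> s
    = \<lparr> Lft = Lft s, Rgt = Rgt t, Top = Top t \<cdot>\<^bsub>C\<^esub> Top s, Bot = Bot t \<cdot>\<^bsub>C\<^esub> Bot s \<rparr>"
  by (auto simp: arrow_cat_def)

lemma arrow_cat_Arr_iff: "s \<in> Arr (arrow_cat C) \<longleftrightarrow> Lft s \<in> Arr C \<and> Rgt s \<in> Arr C \<and>
    Top s \<in> Arr C \<and> Dom C (Top s) = Dom C (Lft s) \<and> Cod C (Top s) = Dom C (Rgt s) \<and>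
    Bot s \<in> Arr C \<and> Dom C (Bot s) = Cod C (Lft s) \<and> Cod C (Bot s) = Cod C (Rgt s) \<and>
    Rgt s \<cdot>\<^bsub>C\<^esub> Top s = Bot s \<cdot>\<^bsub>C\<^esub> Lft s"
  by (auto simp: arrow_cat_def homset_def)

lemma square_eq_iff:
  "(s :: 'a square) = t \<longleftrightarrow> Lft s = Lft t \<and> Rgt s = Rgt t \<and> Top s = Top t \<and> Bot s = Bot t"
  by auto

lemma category_arrow_cat:
  assumes "category C"
  shows "category (arrow_cat C)"
proof -
  interpret category C by fact
  have pasting: "Rgt t \<cdot>\<^bsub>C\<^esub> (Top t \<cdot>\<^bsub>C\<^esub> Top s) = Bot t \<cdot>\<^bsub>C\<^esub> Bot s \<cdot>\<^bsub>C\<^esub> Lft s"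
    if "s \<in> Arr (arrow_cat C)" "t \<in> Arr (arrow_cat C)" "Lft t = Rgt s" for s t
  proof -
    have "Rgt t \<cdot>\<^bsub>C\<^esub> (Top t \<cdot>\<^bsub>C\<^esub> Top s) = Rgt t \<cdot>\<^bsub>C\<^esub> Top t \<cdot>\<^bsub>C\<^esub> Top s"
      by (rule Comp_assoc_Arr[symmetric]) (use that in \<open>auto simp: arrow_cat_Arr_iff\<close>)
    also have "Rgt t \<cdot>\<^bsub>C\<^esub> Top t = Bot t \<cdot>\<^bsub>C\<^esub> Rgt s"
      using that by (auto simp: arrow_cat_Arr_iff)
    also have "Bot t \<cdot>\<^bsub>C\<^esub> Rgt s \<cdot>\<^bsub>C\<^esub> Top s = Bot t \<cdot>\<^bsub>C\<^esub> (Rgt s \<cdot>\<^bsub>C\<^esub> Top s)"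
      by (rule Comp_assoc_Arr) (use that in \<open>auto simp: arrow_cat_Arr_iff\<close>)
    also have "\<dots> = Bot t \<cdot>\<^bsub>C\<^esub> Bot s \<cdot>\<^bsub>C\<^esub> Lft s"
      using that by (auto simp: arrow_cat_Arr_iff Comp_assoc_Arr)
    finally show ?thesis .
  qed
  show ?thesis
    by (rule categoryI)
      (use pasting in \<open>auto simp: arrow_cat_Arr_iff Comp_assoc_Arr square_eq_iff\<close>)
qed

lemma arrow_ftor_simps [simp]:
  "f \<in> Arr C \<Longrightarrow> OM (arrow_ftor C F) f = AM F f"
  "s \<in> Arr (arrow_cat C) \<Longrightarrow> AM (arrow_ftor C F) s
    = \<lparr> Lft = AM F (Lft s), Rgt = AM F (Rgt s), Top = AM F (Top s), Bot = AM F (Bot s) \<rparr>"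
  by (auto simp: arrow_ftor_def)

lemma cod_ftor_simps [simp]:
  "f \<in> Arr C \<Longrightarrow> OM (cod_ftor C) f = Cod C f"
  "s \<in> Arr (arrow_cat C) \<Longrightarrow> AM (cod_ftor C) s = Bot s"
  by (auto simp: cod_ftor_def)

lemma cat_functor_cod_ftor:
  assumes "category C"
  shows "cat_functor (arrow_cat C) C (cod_ftor C)"
proof -
  interpret category C by fact
  interpret A: category "arrow_cat C" by (rule category_arrow_cat) fact
  show ?thesis
    by (rule cat_functorI[OF A.category_axioms category_axioms])
      (use A.Comp_simps(1) A.Ident_simps(1) in
        \<open>auto simp: cod_ftor_def arrow_cat_Arr_iff[of _ C]\<close>)
qed

lemma cat_functor_arrow_ftor:
  assumes "cat_functor C D F"
  shows "cat_functor (arrow_cat C) (arrow_cat D) (arrow_ftor C F)"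
proof -
  interpret cat_functor C D F by fact
  interpret A: category "arrow_cat C" by (rule category_arrow_cat) (fact C.category_axioms)
  interpret B: category "arrow_cat D" by (rule category_arrow_cat) (fact D.category_axioms)
  have square: "AM (arrow_ftor C F) s \<in> Arr (arrow_cat D)" if "s \<in> Arr (arrow_cat C)" for s
    using that AM_Comp_Arr[of "Top s" "Rgt s"] AM_Comp_Arr[of "Lft s" "Bot s"]
    by (auto simp: arrow_cat_Arr_iff)
  show ?thesis
    apply (rule cat_functorI[OF A.category_axioms B.category_axioms])
    using square A.Comp_simps(1) A.Ident_simps(1)
    by (auto simp: arrow_ftor_def AM_Comp_Arr arrow_cat_Arr_iff)
qed

text \<open>The inverse square is built from the inverses of the two edges; that it commutes follows
  by composing the equation of \<open>s\<close> with both inverses. For comparison squares, whose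
  bottom is an identity, invertibility thus means invertibility of the top.\<close>

lemma iso_arrow_arrow_cat_iff:
  assumes "category C" "s \<in> Arr (arrow_cat C)"
  shows "iso_arrow (arrow_cat C) s \<longleftrightarrow> iso_arrow C (Top s) \<and> iso_arrow C (Bot s)"
proof -
  interpret category C by fact
  interpret A: category "arrow_cat C" by (rule category_arrow_cat) fact
  show ?thesis
  proof
    assume "iso_arrow (arrow_cat C) s"
    then obtain t where "t \<in> Arr (arrow_cat C)" "Lft t = Rgt s" "Rgt t = Lft s"
      "t \<cdot>\<^bsub>arrow_cat C\<^esub> s = Ident (arrow_cat C) (Lft s)"
      "s \<cdot>\<^bsub>arrow_cat C\<^esub> t = Ident (arrow_cat C) (Rgt s)"
      by (metis A.iso_arrowE arrow_cat_simps(2,3))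
    then show "iso_arrow C (Top s) \<and> iso_arrow C (Bot s)"
      using assms(2) iso_arrowI[of "Top s" "Top t"] iso_arrowI[of "Bot s" "Bot t"]
      by (simp add: arrow_cat_Arr_iff)
  next
    assume iso: "iso_arrow C (Top s) \<and> iso_arrow C (Bot s)"
    obtain a where a: "a \<in> Arr C" "Dom C a = Cod C (Top s)" "Cod C a = Dom C (Top s)"
      "a \<cdot>\<^bsub>C\<^esub> Top s = Ident C (Dom C (Top s))" "Top s \<cdot>\<^bsub>C\<^esub> a = Ident C (Cod C (Top s))"
      using iso iso_arrowE by metis
    obtain b where b: "b \<in> Arr C" "Dom C b = Cod C (Bot s)" "Cod C b = Dom C (Bot s)"
      "b \<cdot>\<^bsub>C\<^esub> Bot s = Ident C (Dom C (Bot s))" "Bot s \<cdot>\<^bsub>C\<^esub> b = Ident C (Cod C (Bot s))"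
      using iso iso_arrowE by metis
    define t where "t = \<lparr> Lft = Rgt s, Rgt = Lft s, Top = a, Bot = b \<rparr>"
    note s = assms(2)[unfolded arrow_cat_Arr_iff]
    have "Lft s \<cdot>\<^bsub>C\<^esub> a = b \<cdot>\<^bsub>C\<^esub> Bot s \<cdot>\<^bsub>C\<^esub> (Lft s \<cdot>\<^bsub>C\<^esub> a)"
      using s a(1-3) b by simp
    also have "\<dots> = b \<cdot>\<^bsub>C\<^esub> ((Bot s \<cdot>\<^bsub>C\<^esub> Lft s) \<cdot>\<^bsub>C\<^esub> a)"
      using s a(1-3) b(1-3) by (simp add: Comp_assoc_Arr)
    also have "\<dots> = b \<cdot>\<^bsub>C\<^esub> ((Rgt s \<cdot>\<^bsub>C\<^esub> Top s) \<cdot>\<^bsub>C\<^esub> a)"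
      using s by simp
    also have "\<dots> = b \<cdot>\<^bsub>C\<^esub> (Rgt s \<cdot>\<^bsub>C\<^esub> (Top s \<cdot>\<^bsub>C\<^esub> a))"
      by (subst Comp_assoc_Arr) (use s a(1-3) in auto)
    also have "\<dots> = b \<cdot>\<^bsub>C\<^esub> Rgt s"
      using s a b(1-3) by simp
    finally have "Lft s \<cdot>\<^bsub>C\<^esub> a = b \<cdot>\<^bsub>C\<^esub> Rgt s" .
    then have "t \<in> Arr (arrow_cat C)"
      using s a(1-3) b(1-3) by (simp add: t_def arrow_cat_Arr_iff)
    then show "iso_arrow (arrow_cat C) s"
      using assms(2) s a b by (intro A.iso_arrowI[of s t]) (auto simp: t_def)
  qed
qed


section \<open>Cartesian arrows\<close>

context cat_functor
begin

text \<open>Unique existence is split into a factorisation and a cancellation property in which the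
  arrow \<open>t\<close> to be factored no longer occurs, so uniqueness proofs only compare two
  arrows.\<close>

lemma cartesianI:
  assumes "s \<in> Arr C"
    and "\<And>t w. \<lbrakk>t \<in> Arr C; w \<in> Arr D; Dom D w = OM F (Dom C t); Cod D w = OM F (Dom C s);
        Cod C t = Cod C s; AM F t = AM F s \<cdot>\<^bsub>D\<^esub> w\<rbrakk> \<Longrightarrow>
      \<exists>r. r \<in> Arr C \<and> Dom C r = Dom C t \<and> Cod C r = Dom C s \<and> AM F r = w \<and> s \<cdot>\<^bsub>C\<^esub> r = t"
    and "\<And>q r. \<lbrakk>q \<in> Arr C; r \<in> Arr C; Dom C q = Dom C r; Cod C q = Dom C s; Cod C r = Dom C s;
        AM F q = AM F r; s \<cdot>\<^bsub>C\<^esub> q = s \<cdot>\<^bsub>C\<^esub> r\<rbrakk> \<Longrightarrow> q = r"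
  shows "cartesian C D F s"
  unfolding cartesian_def
proof (intro conjI ballI impI)
  show "s \<in> Arr C" by fact
next
  fix t w
  assume "t \<in> Arr C" "w \<in> homset D (OM F (Dom C t)) (OM F (Dom C s))"
    "Cod C t = Cod C s \<and> AM F t = AM F s \<cdot>\<^bsub>D\<^esub> w"
  then obtain r where
    r: "r \<in> Arr C \<and> Dom C r = Dom C t \<and> Cod C r = Dom C s \<and> AM F r = w \<and> s \<cdot>\<^bsub>C\<^esub> r = t"
    using assms(2)[of t w] by (auto simp: homset_def)
  show "\<exists>!r. r \<in> homset C (Dom C t) (Dom C s) \<and> AM F r = w \<and> s \<cdot>\<^bsub>C\<^esub> r = t"
    by (rule ex1I[of _ r]) (use r in \<open>auto simp: homset_def intro: assms(3)\<close>)
qed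

lemma cartesianD:
  assumes "cartesian C D F s"
  shows cartesian_Arr: "s \<in> Arr C"
    and cartesian_ex: "\<lbrakk>t \<in> Arr C; w \<in> Arr D; Dom D w = OM F (Dom C t); Cod D w = OM F (Dom C s);
        Cod C t = Cod C s; AM F t = AM F s \<cdot>\<^bsub>D\<^esub> w\<rbrakk> \<Longrightarrow>
      \<exists>r. r \<in> Arr C \<and> Dom C r = Dom C t \<and> Cod C r = Dom C s \<and> AM F r = w \<and> s \<cdot>\<^bsub>C\<^esub> r = t"
    and cartesian_unique: "\<lbrakk>q \<in> Arr C; r \<in> Arr C; Dom C q = Dom C r; Cod C q = Dom C s;
        Cod C r = Dom C s; AM F q = AM F r; s \<cdot>\<^bsub>C\<^esub> q = s \<cdot>\<^bsub>C\<^esub> r\<rbrakk> \<Longrightarrow> q = r"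
proof -
  show s: "s \<in> Arr C" using assms by (simp add: cartesian_def)
  have ex1: "\<exists>!r. r \<in> homset C (Dom C t) (Dom C s) \<and> AM F r = w \<and> s \<cdot>\<^bsub>C\<^esub> r = t"
    if "t \<in> Arr C" "w \<in> Arr D" "Dom D w = OM F (Dom C t)" "Cod D w = OM F (Dom C s)"
      "Cod C t = Cod C s" "AM F t = AM F s \<cdot>\<^bsub>D\<^esub> w" for t w
    using assms that by (simp add: cartesian_def homset_def)
  then show "\<lbrakk>t \<in> Arr C; w \<in> Arr D; Dom D w = OM F (Dom C t); Cod D w = OM F (Dom C s);
        Cod C t = Cod C s; AM F t = AM F s \<cdot>\<^bsub>D\<^esub> w\<rbrakk> \<Longrightarrow>
      \<exists>r. r \<in> Arr C \<and> Dom C r = Dom C t \<and> Cod C r = Dom C s \<and> AM F r = w \<and> s \<cdot>\<^bsub>C\<^esub> r = t"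
    unfolding homset_def by (metis (mono_tags, lifting) mem_Collect_eq)
  assume q: "q \<in> Arr C" "r \<in> Arr C" "Dom C q = Dom C r" "Cod C q = Dom C s" "Cod C r = Dom C s"
    "AM F q = AM F r" "s \<cdot>\<^bsub>C\<^esub> q = s \<cdot>\<^bsub>C\<^esub> r"
  show "q = r"
    using ex1[of "s \<cdot>\<^bsub>C\<^esub> q" "AM F q"] q s
    by (simp add: homset_def AM_Comp_Arr) (metis (no_types, lifting))
qed

text \<open>The factor is \<open>t\<close> followed by the inverse of \<open>s\<close>; its image is
  \<open>w\<close> because \<open>F\<close> preserves the inverse.\<close>

lemma cartesian_iso:
  assumes "iso_arrow C s"
  shows "cartesian C D F s"
proof -
  obtain s' where s: "s \<in> Arr C" "s' \<in> Arr C" "Dom C s' = Cod C s" "Cod C s' = Dom C s"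
    "s' \<cdot>\<^bsub>C\<^esub> s = Ident C (Dom C s)" "s \<cdot>\<^bsub>C\<^esub> s' = Ident C (Cod C s)"
    using assms C.iso_arrowE by metis
  show ?thesis
  proof (rule cartesianI)
    show "s \<in> Arr C" by (fact s)
  next
    fix t w
    assume t: "t \<in> Arr C" "w \<in> Arr D" "Dom D w = OM F (Dom C t)" "Cod D w = OM F (Dom C s)"
      "Cod C t = Cod C s" "AM F t = AM F s \<cdot>\<^bsub>D\<^esub> w"
    have "AM F (s' \<cdot>\<^bsub>C\<^esub> t) = AM F s' \<cdot>\<^bsub>D\<^esub> AM F s \<cdot>\<^bsub>D\<^esub> w"
      using s(1-4) t by (simp add: AM_Comp_Arr D.Comp_assoc_Arr)
    also have "\<dots> = w"
      using s t(1-5) by (simp flip: AM_Comp_Arr)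
    finally have "AM F (s' \<cdot>\<^bsub>C\<^esub> t) = w" .
    moreover have "s \<cdot>\<^bsub>C\<^esub> (s' \<cdot>\<^bsub>C\<^esub> t) = t"
      using s t(1-5) by (simp flip: C.Comp_assoc_Arr)
    ultimately show "\<exists>r. r \<in> Arr C \<and> Dom C r = Dom C t \<and> Cod C r = Dom C s \<and> AM F r = w \<and>
        s \<cdot>\<^bsub>C\<^esub> r = t"
      using s t by (intro exI[of _ "s' \<cdot>\<^bsub>C\<^esub> t"]) simp
  next
    fix q r
    assume "q \<in> Arr C" "r \<in> Arr C" "Cod C q = Dom C s" "Cod C r = Dom C s" "s \<cdot>\<^bsub>C\<^esub> q = s \<cdot>\<^bsub>C\<^esub> r"
    then show "q = r" using C.iso_arrow_mono[OF assms] by metis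
  qed
qed

text \<open>Factor twice: first through \<open>t\<close>, over \<open>w\<close> followed by
  \<open>AM F s\<close>, then through \<open>s\<close> over \<open>w\<close>. Uniqueness likewise
  cancels \<open>t\<close> and then \<open>s\<close>.\<close>

lemma cartesian_Comp:
  assumes s: "cartesian C D F s" and t: "cartesian C D F t" and st: "Dom C t = Cod C s"
  shows "cartesian C D F (t \<cdot>\<^bsub>C\<^esub> s)"
proof (rule cartesianI)
  note Arrs [simp] = cartesian_Arr[OF s] cartesian_Arr[OF t] and st [simp]
  show "t \<cdot>\<^bsub>C\<^esub> s \<in> Arr C" by simp
  {
    fix u w
    assume u: "u \<in> Arr C" "w \<in> Arr D" "Dom D w = OM F (Dom C u)"
      "Cod D w = OM F (Dom C (t \<cdot>\<^bsub>C\<^esub> s))" "Cod C u = Cod C (t \<cdot>\<^bsub>C\<^esub> s)"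
      "AM F u = AM F (t \<cdot>\<^bsub>C\<^esub> s) \<cdot>\<^bsub>D\<^esub> w"
    obtain r where r: "r \<in> Arr C" "Dom C r = Dom C u" "Cod C r = Dom C t"
      "AM F r = AM F s \<cdot>\<^bsub>D\<^esub> w" "t \<cdot>\<^bsub>C\<^esub> r = u"
      using cartesian_ex[OF t, of u "AM F s \<cdot>\<^bsub>D\<^esub> w"] u
      by (auto simp: AM_Comp_Arr D.Comp_assoc_Arr)
    obtain q where "q \<in> Arr C" "Dom C q = Dom C r" "Cod C q = Dom C s" "AM F q = w" "s \<cdot>\<^bsub>C\<^esub> q = r"
      using cartesian_ex[OF s, of r w] u r by auto
    then show "\<exists>r. r \<in> Arr C \<and> Dom C r = Dom C u \<and> Cod C r = Dom C (t \<cdot>\<^bsub>C\<^esub> s) \<and> AM F r = w \<and>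
        t \<cdot>\<^bsub>C\<^esub> s \<cdot>\<^bsub>C\<^esub> r = u"
      using r by (intro exI[of _ q]) (auto simp: C.Comp_assoc_Arr)
  }
  fix q r
  assume q: "q \<in> Arr C" "r \<in> Arr C" "Dom C q = Dom C r" "Cod C q = Dom C (t \<cdot>\<^bsub>C\<^esub> s)"
    "Cod C r = Dom C (t \<cdot>\<^bsub>C\<^esub> s)" "AM F q = AM F r" "t \<cdot>\<^bsub>C\<^esub> s \<cdot>\<^bsub>C\<^esub> q = t \<cdot>\<^bsub>C\<^esub> s \<cdot>\<^bsub>C\<^esub> r"
  have "s \<cdot>\<^bsub>C\<^esub> q = s \<cdot>\<^bsub>C\<^esub> r"
    by (rule cartesian_unique[OF t]) (use q in \<open>auto simp: C.Comp_assoc_Arr AM_Comp_Arr\<close>)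
  then show "q = r" by (rule cartesian_unique[OF s, rotated -1]) (use q in auto)
qed

text \<open>Each lift factors through the other over an identity, and the two factors are mutually
  inverse by uniqueness. This is the device by which an unknown cartesian arrow is replaced by a
  chosen one.\<close>

lemma cartesian_comparison:
  assumes s: "cartesian C D F s" and t: "cartesian C D F t"
    and "Cod C t = Cod C s" "AM F t = AM F s"
  obtains v where "iso_arrow C v" "Dom C v = Dom C t" "Cod C v = Dom C s" "s \<cdot>\<^bsub>C\<^esub> v = t"
    "AM F v = Ident D (OM F (Dom C s))"
proof -
  note Arrs [simp] = cartesian_Arr[OF s] cartesian_Arr[OF t]
  have same: "OM F (Dom C t) = OM F (Dom C s)"
    by (metis AM_simps(2) Arrs assms(4))
  obtain v where v: "v \<in> Arr C" "Dom C v = Dom C t" "Cod C v = Dom C s"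
    "AM F v = Ident D (OM F (Dom C s))" "s \<cdot>\<^bsub>C\<^esub> v = t"
    using cartesian_ex[OF s, of t "Ident D (OM F (Dom C s))"] assms(3,4) same by auto
  obtain v' where v': "v' \<in> Arr C" "Dom C v' = Dom C s" "Cod C v' = Dom C t"
    "AM F v' = Ident D (OM F (Dom C s))" "t \<cdot>\<^bsub>C\<^esub> v' = s"
    using cartesian_ex[OF t, of s "Ident D (OM F (Dom C s))"] assms(3,4) same by auto
  have "v \<cdot>\<^bsub>C\<^esub> v' = Ident C (Dom C s)"
    by (rule cartesian_unique[OF s]) (use v v' in \<open>auto simp: AM_Comp_Arr simp flip: C.Comp_assoc_Arr\<close>)
  moreover have "v' \<cdot>\<^bsub>C\<^esub> v = Ident C (Dom C t)"
    by (rule cartesian_unique[OF t])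
      (use v v' same in \<open>auto simp: AM_Comp_Arr simp flip: C.Comp_assoc_Arr\<close>)
  ultimately have "iso_arrow C v"
    using v v' by (intro C.iso_arrowI[of v v']) auto
  with v show ?thesis by (intro that)
qed

end

lemma full_ftorE:
  assumes "full_ftor C D F" "x \<in> Obj C" "y \<in> Obj C"
    "g \<in> Arr D" "Dom D g = OM F x" "Cod D g = OM F y"
  obtains f where "f \<in> Arr C" "Dom C f = x" "Cod C f = y" "AM F f = g"
  using assms unfolding full_ftor_def homset_def by blast

lemma faithful_ftorD:
  assumes "faithful_ftor C F" "category C" "f \<in> Arr C" "g \<in> Arr C"
    "Dom C f = Dom C g" "Cod C f = Cod C g" "AM F f = AM F g"
  shows "f = g"
  using assms unfolding faithful_ftor_def homset_def inj_on_def
  by (metis (mono_tags, lifting) category.Cod_in category.Dom_in mem_Collect_eq)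

text \<open>A test arrow \<open>t\<close> starts at an object of \<open>C\<close>, so the factor
  found in \<open>D\<close> runs between images of objects of \<open>C\<close>. Fullness lifts that
  factor and faithfulness lifts the equations.\<close>

lemma cartesian_reflect:
  assumes "cat_functor C D F" "full_ftor C D F" "faithful_ftor C F" "cat_functor D E G"
    and "s \<in> Arr C" "cartesian D E G (AM F s)"
  shows "cartesian C E (fcomp C G F) s"
proof -
  interpret F: cat_functor C D F by fact
  interpret G: cat_functor D E G by fact
  interpret GF: cat_functor C E "fcomp C G F" by (rule cat_functor_fcomp) fact+
  show ?thesis
  proof (rule GF.cartesianI)
    show "s \<in> Arr C" by fact
  next
    fix t w
    assume t: "t \<in> Arr C" "w \<in> Arr E" "Dom E w = OM (fcomp C G F) (Dom C t)"
      "Cod E w = OM (fcomp C G F) (Dom C s)" "Cod C t = Cod C s"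
      "AM (fcomp C G F) t = AM (fcomp C G F) s \<cdot>\<^bsub>E\<^esub> w"
    obtain r where r: "r \<in> Arr D" "Dom D r = OM F (Dom C t)" "Cod D r = OM F (Dom C s)"
      "AM G r = w" "AM F s \<cdot>\<^bsub>D\<^esub> r = AM F t"
      using G.cartesian_ex[OF assms(6), of "AM F t" w] t assms(5) by auto
    obtain q where q: "q \<in> Arr C" "Dom C q = Dom C t" "Cod C q = Dom C s" "AM F q = r"
      using full_ftorE[OF assms(2) _ _ r(1-3)] t(1) assms(5) by auto
    moreover have "s \<cdot>\<^bsub>C\<^esub> q = t"
      by (rule faithful_ftorD[OF assms(3) F.C.category_axioms])
        (use q r t assms(5) in \<open>auto simp: F.AM_Comp_Arr\<close>)
    ultimately show "\<exists>r. r \<in> Arr C \<and> Dom C r = Dom C t \<and> Cod C r = Dom C s \<and>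
        AM (fcomp C G F) r = w \<and> s \<cdot>\<^bsub>C\<^esub> r = t"
      using r by auto
  next
    fix q r
    assume q: "q \<in> Arr C" "r \<in> Arr C" "Dom C q = Dom C r" "Cod C q = Dom C s" "Cod C r = Dom C s"
      "AM (fcomp C G F) q = AM (fcomp C G F) r" "s \<cdot>\<^bsub>C\<^esub> q = s \<cdot>\<^bsub>C\<^esub> r"
    have "AM F q = AM F r"
      by (rule G.cartesian_unique[OF assms(6)])
        (use q assms(5) in \<open>auto simp flip: F.AM_Comp_Arr\<close>)
    then show "q = r"
      by (rule faithful_ftorD[OF assms(3) F.C.category_axioms, rotated -1]) (use q in auto)
  qed
qed

lemma (in category) square_Comp:
  assumes "s \<in> Arr (arrow_cat C)" "m \<in> Arr C" "Cod C m = Dom C (Lft s)"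
  shows "Rgt s \<cdot>\<^bsub>C\<^esub> (Top s \<cdot>\<^bsub>C\<^esub> m) = Bot s \<cdot>\<^bsub>C\<^esub> (Lft s \<cdot>\<^bsub>C\<^esub> m)"
  using assms unfolding arrow_cat_Arr_iff by (metis Comp_assoc_Arr)

text \<open>A cone over the pullback is a test square. In one direction its leg \<open>k\<close> is
  the left side of the test square followed by \<open>w\<close>; in the other \<open>k\<close>
  itself becomes the left side and \<open>w\<close> an identity. Pullback squares thereby inherit
  the closure properties of cartesian arrows.\<close>

lemma pullback_square_iff_cartesian:
  assumes "category C"
  shows "pullback_square C s \<longleftrightarrow> cartesian (arrow_cat C) C (cod_ftor C) s"
proof -
  interpret category C by fact
  interpret cod: cat_functor "arrow_cat C" C "cod_ftor C" by (rule cat_functor_cod_ftor) fact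
  show ?thesis
  proof
    assume pb: "pullback_square C s"
    then have s [simp]: "s \<in> Arr (arrow_cat C)" by (simp add: pullback_square_def)
    note s' [simp] = s[unfolded arrow_cat_Arr_iff]
    have pb: "\<exists>!m. m \<in> homset C (Dom C h) (Dom C (Lft s)) \<and> Top s \<cdot>\<^bsub>C\<^esub> m = h \<and> Lft s \<cdot>\<^bsub>C\<^esub> m = k"
      if "h \<in> Arr C" "k \<in> Arr C" "Dom C h = Dom C k" "Cod C h = Dom C (Rgt s)"
        "Cod C k = Cod C (Lft s)" "Rgt s \<cdot>\<^bsub>C\<^esub> h = Bot s \<cdot>\<^bsub>C\<^esub> k" for h k
      using pb that by (auto simp: pullback_square_def)
    show "cartesian (arrow_cat C) C (cod_ftor C) s"
    proof (rule cod.cartesianI)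
      show "s \<in> Arr (arrow_cat C)" by (fact s)
    next
      fix t w
      assume t: "t \<in> Arr (arrow_cat C)" "w \<in> Arr C" "Dom C w = OM (cod_ftor C) (Dom (arrow_cat C) t)"
        "Cod C w = OM (cod_ftor C) (Dom (arrow_cat C) s)" "Cod (arrow_cat C) t = Cod (arrow_cat C) s"
        "AM (cod_ftor C) t = AM (cod_ftor C) s \<cdot>\<^bsub>C\<^esub> w"
      note t' = t(1)[unfolded arrow_cat_Arr_iff]
      have "\<exists>!m. m \<in> homset C (Dom C (Top t)) (Dom C (Lft s)) \<and>
          Top s \<cdot>\<^bsub>C\<^esub> m = Top t \<and> Lft s \<cdot>\<^bsub>C\<^esub> m = w \<cdot>\<^bsub>C\<^esub> Lft t"
        by (rule pb) (use t t' in \<open>auto simp flip: Comp_assoc_Arr\<close>)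
      then obtain m where "m \<in> homset C (Dom C (Top t)) (Dom C (Lft s))"
          "Top s \<cdot>\<^bsub>C\<^esub> m = Top t" "Lft s \<cdot>\<^bsub>C\<^esub> m = w \<cdot>\<^bsub>C\<^esub> Lft t"
        by blast
      then show "\<exists>r. r \<in> Arr (arrow_cat C) \<and> Dom (arrow_cat C) r = Dom (arrow_cat C) t \<and>
          Cod (arrow_cat C) r = Dom (arrow_cat C) s \<and> AM (cod_ftor C) r = w \<and>
          s \<cdot>\<^bsub>arrow_cat C\<^esub> r = t"
        using t t' by (intro exI[of _ "\<lparr> Lft = Lft t, Rgt = Lft s, Top = m, Bot = w \<rparr>"])
          (auto simp: arrow_cat_Arr_iff homset_def)
    next
      fix q r
      assume q: "q \<in> Arr (arrow_cat C)" "r \<in> Arr (arrow_cat C)"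
        "Dom (arrow_cat C) q = Dom (arrow_cat C) r" "Cod (arrow_cat C) q = Dom (arrow_cat C) s"
        "Cod (arrow_cat C) r = Dom (arrow_cat C) s" "AM (cod_ftor C) q = AM (cod_ftor C) r"
        "s \<cdot>\<^bsub>arrow_cat C\<^esub> q = s \<cdot>\<^bsub>arrow_cat C\<^esub> r"
      note q' = q(1)[unfolded arrow_cat_Arr_iff] q(2)[unfolded arrow_cat_Arr_iff]
      have "\<exists>!m. m \<in> homset C (Dom C (Top s \<cdot>\<^bsub>C\<^esub> Top q)) (Dom C (Lft s)) \<and>
          Top s \<cdot>\<^bsub>C\<^esub> m = Top s \<cdot>\<^bsub>C\<^esub> Top q \<and> Lft s \<cdot>\<^bsub>C\<^esub> m = Lft s \<cdot>\<^bsub>C\<^esub> Top q"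
        by (rule pb) (use q q' square_Comp[OF s] in auto)
      moreover have "Top r \<in> homset C (Dom C (Top s \<cdot>\<^bsub>C\<^esub> Top q)) (Dom C (Lft s)) \<and>
          Top s \<cdot>\<^bsub>C\<^esub> Top r = Top s \<cdot>\<^bsub>C\<^esub> Top q \<and> Lft s \<cdot>\<^bsub>C\<^esub> Top r = Lft s \<cdot>\<^bsub>C\<^esub> Top q"
        using q q' by (auto simp: homset_def)
      moreover have "Top q \<in> homset C (Dom C (Top s \<cdot>\<^bsub>C\<^esub> Top q)) (Dom C (Lft s))"
        using q q' by (auto simp: homset_def)
      ultimately have "Top q = Top r" by blast
      then show "q = r" using q by (auto simp: square_eq_iff)
    qed
  next
    assume cart: "cartesian (arrow_cat C) C (cod_ftor C) s"
    then have s [simp]: "s \<in> Arr (arrow_cat C)" by (rule cod.cartesian_Arr)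
    note s' [simp] = s[unfolded arrow_cat_Arr_iff]
    show "pullback_square C s"
      unfolding pullback_square_def
    proof (intro conjI s ballI impI)
      fix h k
      assume h: "h \<in> Arr C" and k: "k \<in> Arr C" and
        "Dom C h = Dom C k \<and> Cod C h = Dom C (Rgt s) \<and> Cod C k = Cod C (Lft s) \<and>
        Rgt s \<cdot>\<^bsub>C\<^esub> h = Bot s \<cdot>\<^bsub>C\<^esub> k"
      then have hk: "Dom C h = Dom C k" "Cod C h = Dom C (Rgt s)" "Cod C k = Cod C (Lft s)"
        "Rgt s \<cdot>\<^bsub>C\<^esub> h = Bot s \<cdot>\<^bsub>C\<^esub> k" by auto
      \<comment> \<open>The cone as a test square: left side \<open>k\<close>, top \<open>h\<close>
        and the bottom of \<open>s\<close>, so that the base arrow to be lifted is the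
        identity.\<close>
      let ?t = "\<lparr> Lft = k, Rgt = Rgt s, Top = h, Bot = Bot s \<rparr>"
      let ?sq = "\<lambda>m. \<lparr> Lft = k, Rgt = Lft s, Top = m, Bot = Ident C (Cod C k) \<rparr>"
      have t: "?t \<in> Arr (arrow_cat C)" using h k hk by (simp add: arrow_cat_Arr_iff)
      obtain r where r: "r \<in> Arr (arrow_cat C)" "Lft r = k" "Rgt r = Lft s"
        "Bot r = Ident C (Cod C k)" "Top s \<cdot>\<^bsub>C\<^esub> Top r = h"
        using cod.cartesian_ex[OF cart t, of "Ident C (Cod C k)"] h k hk t by auto
      show "\<exists>!m. m \<in> homset C (Dom C h) (Dom C (Lft s)) \<and> Top s \<cdot>\<^bsub>C\<^esub> m = h \<and> Lft s \<cdot>\<^bsub>C\<^esub> m = k"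
      proof (rule ex1I[of _ "Top r"])
        show "Top r \<in> homset C (Dom C h) (Dom C (Lft s)) \<and> Top s \<cdot>\<^bsub>C\<^esub> Top r = h \<and>
            Lft s \<cdot>\<^bsub>C\<^esub> Top r = k"
          using r h k hk by (auto simp: arrow_cat_Arr_iff homset_def)
      next
        fix m
        assume m: "m \<in> homset C (Dom C h) (Dom C (Lft s)) \<and> Top s \<cdot>\<^bsub>C\<^esub> m = h \<and> Lft s \<cdot>\<^bsub>C\<^esub> m = k"
        have sq: "?sq m \<in> Arr (arrow_cat C)"
          using m h k hk by (auto simp: arrow_cat_Arr_iff homset_def)
        have "?sq m = r"
          by (rule cod.cartesian_unique[OF cart]) (use sq m r k hk in \<open>auto simp: homset_def\<close>)
        then show "m = Top r" by auto
      qed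
    qed
  qed
qed


section \<open>Comprehension categories\<close>

lemma (in comprehension_category) category_Base: "category (Base X)"
  and category_Total: "category (Total X)"
  using Base Total by (auto simp: ext_category_def)

sublocale comprehension_category \<subseteq> B: category "Base X" by (rule category_Base)
sublocale comprehension_category \<subseteq> T: category "Total X" by (rule category_Total)
sublocale comprehension_category \<subseteq> A: category "arrow_cat (Base X)"
  by (rule category_arrow_cat) (rule category_Base)
sublocale comprehension_category \<subseteq> chi: cat_functor "Total X" "arrow_cat (Base X)" "Compr X"
  by (rule Compr)
sublocale comprehension_category \<subseteq> p: cat_functor "Total X" "Base X" "Proj X"
  using Proj by (simp add: fibration_def)
sublocale comprehension_category \<subseteq> cod: cat_functor "arrow_cat (Base X)" "Base X" "cod_ftor (Base X)"
  by (rule cat_functor_cod_ftor) (rule category_Base)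

context comprehension_category
begin

lemma Compr_Obj [simp]: "A \<in> Obj (Total X) \<Longrightarrow> OM (Compr X) A \<in> Arr (Base X)"
  using chi.OM_in by simp

text \<open>Since \<open>cod_Compr\<close> is a strict equation, \<open>Proj\<close> can be
  rewritten away; lying over is then phrased through codomains and bottom edges of comprehension
  squares.\<close>

lemma Proj_simps [simp]:
  "A \<in> Obj (Total X) \<Longrightarrow> OM (Proj X) A = Cod (Base X) (OM (Compr X) A)"
  "s \<in> Arr (Total X) \<Longrightarrow> AM (Proj X) s = Bot (AM (Compr X) s)"
  by (simp_all flip: cod_Compr)

lemma Compr_Arr [simp]:
  assumes "s \<in> Arr (Total X)"
  shows "Lft (AM (Compr X) s) = OM (Compr X) (Dom (Total X) s)"
    "Rgt (AM (Compr X) s) = OM (Compr X) (Cod (Total X) s)"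
    "Top (AM (Compr X) s) \<in> Arr (Base X)" "Bot (AM (Compr X) s) \<in> Arr (Base X)"
    "Dom (Base X) (Top (AM (Compr X) s)) = Dom (Base X) (OM (Compr X) (Dom (Total X) s))"
    "Cod (Base X) (Top (AM (Compr X) s)) = Dom (Base X) (OM (Compr X) (Cod (Total X) s))"
    "Dom (Base X) (Bot (AM (Compr X) s)) = Cod (Base X) (OM (Compr X) (Dom (Total X) s))"
    "Cod (Base X) (Bot (AM (Compr X) s)) = Cod (Base X) (OM (Compr X) (Cod (Total X) s))"
  using chi.AM_simps[OF assms] by (auto simp: arrow_cat_Arr_iff)

lemma cartesian_Compr:
  "cartesian (Total X) (Base X) (Proj X) s \<Longrightarrow>
    cartesian (arrow_cat (Base X)) (Base X) (cod_ftor (Base X)) (AM (Compr X) s)"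
  using Compr_cartesian by (simp add: pullback_square_iff_cartesian B.category_axioms)

lemma cartesian_lift:
  assumes "A \<in> Obj (Total X)" "f \<in> Arr (Base X)" "Cod (Base X) f = Cod (Base X) (OM (Compr X) A)"
  obtains s where "cartesian (Total X) (Base X) (Proj X) s" "s \<in> Arr (Total X)"
    "Cod (Total X) s = A" "Bot (AM (Compr X) s) = f"
proof -
  obtain s where s: "cartesian (Total X) (Base X) (Proj X) s" "Cod (Total X) s = A"
    "AM (Proj X) s = f"
    using Proj assms by (force simp: fibration_def)
  with p.cartesian_Arr[OF s(1)] show ?thesis by (intro that[of s]) auto
qed

lemma full_compcatE:
  assumes "full_compcat X" "A \<in> Obj (Total X)" "A' \<in> Obj (Total X)"
    "s \<in> Arr (arrow_cat (Base X))" "Lft s = OM (Compr X) A" "Rgt s = OM (Compr X) A'"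
  obtains u where "u \<in> Arr (Total X)" "Dom (Total X) u = A" "Cod (Total X) u = A'"
    "AM (Compr X) u = s"
  using full_ftorE[of "Total X" "arrow_cat (Base X)" "Compr X" A A' s] assms
  by (auto simp: full_compcat_def)

lemma full_compcatD:
  assumes "full_compcat X" "u \<in> Arr (Total X)" "v \<in> Arr (Total X)"
    "Dom (Total X) u = Dom (Total X) v" "Cod (Total X) u = Cod (Total X) v"
    "AM (Compr X) u = AM (Compr X) v"
  shows "u = v"
  using faithful_ftorD[of "Total X" "Compr X"] assms T.category_axioms
  by (simp add: full_compcat_def)

text \<open>\<open>Proj X\<close> is the codomain functor after a fully faithful functor, so it
  reflects cartesian arrows: in the full case being cartesian is a property of the comprehension
  square alone.\<close>

lemma cartesian_iff_full:
  assumes "full_compcat X" "s \<in> Arr (Total X)"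
  shows "cartesian (Total X) (Base X) (Proj X) s \<longleftrightarrow>
    cartesian (arrow_cat (Base X)) (Base X) (cod_ftor (Base X)) (AM (Compr X) s)"
  using cartesian_Compr cartesian_reflect[OF chi.cat_functor_axioms _ _ cod.cat_functor_axioms] assms
  by (auto simp: full_compcat_def cod_Compr)

end


section \<open>The 2-category of comprehension categories\<close>

sublocale pseudo_map \<subseteq> F: cat_functor "Base X" "Base Y" "BaseF P" by (rule BaseF)
sublocale pseudo_map \<subseteq> Fb: cat_functor "Total X" "Total Y" "TotF P" by (rule TotF)

context pseudo_map
begin

lemma TotF_over_simps [simp]:
  "A \<in> Obj (Total X) \<Longrightarrow> Cod (Base Y) (OM (Compr Y) (OM (TotF P) A))
    = OM (BaseF P) (Cod (Base X) (OM (Compr X) A))"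
  "s \<in> Arr (Total X) \<Longrightarrow> Bot (AM (Compr Y) (AM (TotF P) s)) = AM (BaseF P) (Bot (AM (Compr X) s))"
  using arg_cong[OF TotF_over, of "\<lambda>F. OM F A"] arg_cong[OF TotF_over, of "\<lambda>F. AM F s"] by auto

lemma Cmp_ext: "Cmp P \<in> extensional (Obj (Total X))"
  using Cmp by (auto simp: nat_iso_def nat_trans_def)

lemma Cmp_square [simp]:
  assumes "A \<in> Obj (Total X)"
  shows "Cmp P A \<in> Arr (arrow_cat (Base Y))" "iso_arrow (arrow_cat (Base Y)) (Cmp P A)"
    "Lft (Cmp P A) = OM (Compr Y) (OM (TotF P) A)" "Rgt (Cmp P A) = AM (BaseF P) (OM (Compr X) A)"
    "Bot (Cmp P A) = Ident (Base Y) (OM (BaseF P) (Cod (Base X) (OM (Compr X) A)))"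
proof -
  show *: "Cmp P A \<in> Arr (arrow_cat (Base Y))" "iso_arrow (arrow_cat (Base Y)) (Cmp P A)"
    "Lft (Cmp P A) = OM (Compr Y) (OM (TotF P) A)" "Rgt (Cmp P A) = AM (BaseF P) (OM (Compr X) A)"
    using Cmp assms by (auto simp: nat_iso_def nat_trans_def homset_def)
  show "Bot (Cmp P A) = Ident (Base Y) (OM (BaseF P) (Cod (Base X) (OM (Compr X) A)))"
    using Cmp_over[OF assms] *(1) assms by simp
qed

lemma Cmp_Top [simp]:
  assumes "A \<in> Obj (Total X)"
  shows "Top (Cmp P A) \<in> Arr (Base Y)" "iso_arrow (Base Y) (Top (Cmp P A))"
    "Dom (Base Y) (Top (Cmp P A)) = Dom (Base Y) (OM (Compr Y) (OM (TotF P) A))"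
    "Cod (Base Y) (Top (Cmp P A)) = OM (BaseF P) (Dom (Base X) (OM (Compr X) A))"
    "AM (BaseF P) (OM (Compr X) A) \<cdot>\<^bsub>Base Y\<^esub> Top (Cmp P A) = OM (Compr Y) (OM (TotF P) A)"
  using Cmp_square[OF assms] iso_arrow_arrow_cat_iff[OF Y.category_Base Cmp_square(1)[OF assms]]
    assms by (auto simp: arrow_cat_Arr_iff)

text \<open>Naturality of the comparison has content only on top edges; on bottom edges it repeats
  that \<open>TotF P\<close> lies over \<open>BaseF P\<close>.\<close>

lemma Cmp_natural:
  assumes "s \<in> Arr (Total X)"
  shows "Top (Cmp P (Cod (Total X) s)) \<cdot>\<^bsub>Base Y\<^esub> Top (AM (Compr Y) (AM (TotF P) s))
    = AM (BaseF P) (Top (AM (Compr X) s)) \<cdot>\<^bsub>Base Y\<^esub> Top (Cmp P (Dom (Total X) s))"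
proof -
  have "nat_trans (Total X) (arrow_cat (Base Y)) (fcomp (Total X) (Compr Y) (TotF P))
      (fcomp (Total X) (arrow_ftor (Base X) (BaseF P)) (Compr X)) (Cmp P)"
    using Cmp by (simp add: nat_iso_def)
  from nat_transD(7)[OF this assms] show ?thesis using assms by (simp add: square_eq_iff)
qed

end

text \<open>All conditions are reduced to comprehension squares and their top edges; the strict
  equation of functors and the natural isomorphism are rebuilt from them.\<close>

lemma pseudo_mapI:
  assumes X: "comprehension_category X" and Y: "comprehension_category Y"
    and F: "cat_functor (Base X) (Base Y) (BaseF P)"
    and Fb: "cat_functor (Total X) (Total Y) (TotF P)"
    and cod: "\<And>A. A \<in> Obj (Total X) \<Longrightarrow> Cod (Base Y) (OM (Compr Y) (OM (TotF P) A))
      = OM (BaseF P) (Cod (Base X) (OM (Compr X) A))"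
    and bot: "\<And>s. s \<in> Arr (Total X) \<Longrightarrow>
      Bot (AM (Compr Y) (AM (TotF P) s)) = AM (BaseF P) (Bot (AM (Compr X) s))"
    and cart: "\<And>s. cartesian (Total X) (Base X) (Proj X) s \<Longrightarrow>
      cartesian (Total Y) (Base Y) (Proj Y) (AM (TotF P) s)"
    and ext: "Cmp P \<in> extensional (Obj (Total X))"
    and sq: "\<And>A. A \<in> Obj (Total X) \<Longrightarrow> iso_arrow (arrow_cat (Base Y)) (Cmp P A) \<and>
      Lft (Cmp P A) = OM (Compr Y) (OM (TotF P) A) \<and> Rgt (Cmp P A) = AM (BaseF P) (OM (Compr X) A) \<and>
      Bot (Cmp P A) = Ident (Base Y) (OM (BaseF P) (Cod (Base X) (OM (Compr X) A)))"
    and nat: "\<And>s. s \<in> Arr (Total X) \<Longrightarrow>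
      Top (Cmp P (Cod (Total X) s)) \<cdot>\<^bsub>Base Y\<^esub> Top (AM (Compr Y) (AM (TotF P) s))
      = AM (BaseF P) (Top (AM (Compr X) s)) \<cdot>\<^bsub>Base Y\<^esub> Top (Cmp P (Dom (Total X) s))"
  shows "pseudo_map X Y P"
proof -
  interpret X: comprehension_category X by fact
  interpret Y: comprehension_category Y by fact
  interpret F: cat_functor "Base X" "Base Y" "BaseF P" by fact
  interpret Fb: cat_functor "Total X" "Total Y" "TotF P" by fact
  interpret G: cat_functor "arrow_cat (Base X)" "arrow_cat (Base Y)" "arrow_ftor (Base X) (BaseF P)"
    by (rule cat_functor_arrow_ftor) fact
  note [simp] = cod bot
  have over: "fcomp (Total X) (Proj Y) (TotF P) = fcomp (Total X) (BaseF P) (Proj X)"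
    by (rule ftor_eqI[of "Total X" "Base Y"])
      (auto intro: cat_functor_fcomp[OF Fb Y.p.cat_functor_axioms]
        cat_functor_fcomp[OF X.p.cat_functor_axioms F])
  have square: "Cmp P A \<in> Arr (arrow_cat (Base Y))" if "A \<in> Obj (Total X)" for A
    using sq[OF that] by (simp add: iso_arrow_def)
  have iso: "nat_iso (Total X) (arrow_cat (Base Y)) (fcomp (Total X) (Compr Y) (TotF P))
      (fcomp (Total X) (arrow_ftor (Base X) (BaseF P)) (Compr X)) (Cmp P)"
    unfolding nat_iso_def
    by (intro conjI nat_transI ballI cat_functor_fcomp[OF Fb Y.chi.cat_functor_axioms]
        cat_functor_fcomp[OF X.chi.cat_functor_axioms G.cat_functor_axioms] ext)
      (use sq square nat in \<open>simp_all add: square_eq_iff\<close>)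
  show ?thesis
    by unfold_locales (use F Fb over cart iso sq square in auto)
qed

text \<open>The sides and the bottom of a comparison square are fixed by the functors, which leaves
  the top as its only free part.\<close>

lemma pseudo_map_eqI:
  assumes "pseudo_map X Y P" "pseudo_map X Y Q" "BaseF P = BaseF Q" "TotF P = TotF Q"
    and "\<And>A. A \<in> Obj (Total X) \<Longrightarrow> Top (Cmp P A) = Top (Cmp Q A)"
  shows "P = Q"
proof -
  interpret P: pseudo_map X Y P by fact
  interpret Q: pseudo_map X Y Q by fact
  have "Cmp P = Cmp Q"
    by (rule extensionalityI[OF P.Cmp_ext Q.Cmp_ext]) (simp add: square_eq_iff assms)
  then show ?thesis using assms by simp
qed

context transformation
begin

lemmas BaseT_simps [simp] = nat_transD(4-6)[OF BaseT]
  and TotT_simps [simp] = nat_transD(4-6)[OF TotT]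

lemma TotT_Bot [simp]: "A \<in> Obj (Total X) \<Longrightarrow>
    Bot (AM (Compr Y) (TotT t A)) = BaseT t (Cod (Base X) (OM (Compr X) A))"
  using TotT_over[of A] by simp

end

lemma transformationI:
  assumes P: "pseudo_map X Y (Src t)" and Q: "pseudo_map X Y (Tgt t)"
    and "nat_trans (Base X) (Base Y) (BaseF (Src t)) (BaseF (Tgt t)) (BaseT t)"
    and T: "nat_trans (Total X) (Total Y) (TotF (Src t)) (TotF (Tgt t)) (TotT t)"
    and "\<And>A. A \<in> Obj (Total X) \<Longrightarrow>
      Bot (AM (Compr Y) (TotT t A)) = BaseT t (Cod (Base X) (OM (Compr X) A))"
    and "\<And>A. A \<in> Obj (Total X) \<Longrightarrow>
      Top (Cmp (Tgt t) A) \<cdot>\<^bsub>Base Y\<^esub> Top (AM (Compr Y) (TotT t A))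
      = BaseT t (Dom (Base X) (OM (Compr X) A)) \<cdot>\<^bsub>Base Y\<^esub> Top (Cmp (Src t) A)"
  shows "transformation X Y t"
proof -
  interpret P: pseudo_map X Y "Src t" by fact
  interpret Q: pseudo_map X Y "Tgt t" by fact
  show ?thesis by unfold_locales (use assms nat_transD(4)[OF T] in auto)
qed

lemma trafo_eqI:
  assumes "transformation X Y t" "transformation X Y u" "Src t = Src u" "Tgt t = Tgt u"
    and "\<And>x. x \<in> Obj (Base X) \<Longrightarrow> BaseT t x = BaseT u x"
    and "\<And>A. A \<in> Obj (Total X) \<Longrightarrow> TotT t A = TotT u A"
  shows "t = u"
proof -
  interpret t: transformation X Y t by fact
  interpret u: transformation X Y u by fact
  have "BaseT t = BaseT u" "TotT t = TotT u"
    using extensionalityI[OF nat_transD(3)[OF t.BaseT] nat_transD(3)[OF u.BaseT] assms(5)]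
      extensionalityI[OF nat_transD(3)[OF t.TotT] nat_transD(3)[OF u.TotT] assms(6)] by auto
  then show ?thesis using assms by simp
qed

section \<open>Identities and compositions of pseudo maps and transformations\<close>

lemma pmap_simps [simp]:
  "BaseF (pmap_id X) = id_ftor (Base X)" "TotF (pmap_id X) = id_ftor (Total X)"
  "A \<in> Obj (Total X) \<Longrightarrow> Top (Cmp (pmap_id X) A) = Ident (Base X) (Dom (Base X) (OM (Compr X) A))"
  "BaseF (pmap_comp X Y Z Q P) = fcomp (Base X) (BaseF Q) (BaseF P)"
  "TotF (pmap_comp X Y Z Q P) = fcomp (Total X) (TotF Q) (TotF P)"
  "A \<in> Obj (Total X) \<Longrightarrow> Top (Cmp (pmap_comp X Y Z Q P) A)
    = Top (AM (arrow_ftor (Base Y) (BaseF Q)) (Cmp P A)) \<cdot>\<^bsub>Base Z\<^esub> Top (Cmp Q (OM (TotF P) A))"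
  by (auto simp: pmap_id_def pmap_comp_def)

lemma trafo_simps [simp]:
  "Src (trafo_id X Y P) = P" "Tgt (trafo_id X Y P) = P"
  "Src (trafo_vcomp X Y u t) = Src t" "Tgt (trafo_vcomp X Y u t) = Tgt u"
  "Src (trafo_hcomp X Y Z u t) = pmap_comp X Y Z (Src u) (Src t)"
  "Tgt (trafo_hcomp X Y Z u t) = pmap_comp X Y Z (Tgt u) (Tgt t)"
  "BaseT (trafo_id X Y P) = (\<lambda>x \<in> Obj (Base X). Ident (Base Y) (OM (BaseF P) x))"
  "TotT (trafo_id X Y P) = (\<lambda>A \<in> Obj (Total X). Ident (Total Y) (OM (TotF P) A))"
  "BaseT (trafo_vcomp X Y u t) = (\<lambda>x \<in> Obj (Base X). BaseT u x \<cdot>\<^bsub>Base Y\<^esub> BaseT t x)"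
  "TotT (trafo_vcomp X Y u t) = (\<lambda>A \<in> Obj (Total X). TotT u A \<cdot>\<^bsub>Total Y\<^esub> TotT t A)"
  "BaseT (trafo_hcomp X Y Z u t) = (\<lambda>x \<in> Obj (Base X).
     BaseT u (OM (BaseF (Tgt t)) x) \<cdot>\<^bsub>Base Z\<^esub> AM (BaseF (Src u)) (BaseT t x))"
  "TotT (trafo_hcomp X Y Z u t) = (\<lambda>A \<in> Obj (Total X).
     TotT u (OM (TotF (Tgt t)) A) \<cdot>\<^bsub>Total Z\<^esub> AM (TotF (Src u)) (TotT t A))"
  by (auto simp: trafo_id_def trafo_vcomp_def trafo_hcomp_def)

lemma pseudo_map_pmap_id:
  assumes "comprehension_category X"
  shows "pseudo_map X X (pmap_id X)"
proof -
  interpret comprehension_category X by fact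
  show ?thesis
    by (rule pseudo_mapI) (auto simp: pmap_id_def assms iso_arrow_arrow_cat_iff[OF category_Base]
        arrow_cat_Arr_iff cat_functor_id_ftor B.category_axioms T.category_axioms
        p.cartesian_Arr)
qed

lemma pseudo_map_pmap_comp:
  assumes "pseudo_map X Y P" "pseudo_map Y Z Q"
  shows "pseudo_map X Z (pmap_comp X Y Z Q P)"
proof -
  interpret P: pseudo_map X Y P by fact
  interpret Q: pseudo_map Y Z Q by fact
  interpret G: cat_functor "arrow_cat (Base Y)" "arrow_cat (Base Z)" "arrow_ftor (Base Y) (BaseF Q)"
    by (rule cat_functor_arrow_ftor) (rule Q.BaseF)
  let ?QP = "pmap_comp X Y Z Q P"
  show ?thesis
  proof (rule pseudo_mapI)
    show "comprehension_category X" "comprehension_category Z" by unfold_locales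
    show "cat_functor (Base X) (Base Z) (BaseF ?QP)" "cat_functor (Total X) (Total Z) (TotF ?QP)"
      by (auto simp: pmap_comp_def intro: cat_functor_fcomp P.BaseF Q.BaseF P.TotF Q.TotF)
  next
    fix A assume A: "A \<in> Obj (Total X)"
    show "Cod (Base Z) (OM (Compr Z) (OM (TotF ?QP) A))
        = OM (BaseF ?QP) (Cod (Base X) (OM (Compr X) A))"
      using A by (simp add: pmap_comp_def)
    have "iso_arrow (arrow_cat (Base Z)) (AM (arrow_ftor (Base Y) (BaseF Q)) (Cmp P A)
        \<cdot>\<^bsub>arrow_cat (Base Z)\<^esub> Cmp Q (OM (TotF P) A))"
      using A by (intro Q.Y.A.iso_arrow_Comp G.iso_arrow_AM) auto
    then show "iso_arrow (arrow_cat (Base Z)) (Cmp ?QP A) \<and>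
        Lft (Cmp ?QP A) = OM (Compr Z) (OM (TotF ?QP) A) \<and>
        Rgt (Cmp ?QP A) = AM (BaseF ?QP) (OM (Compr X) A) \<and>
        Bot (Cmp ?QP A) = Ident (Base Z) (OM (BaseF ?QP) (Cod (Base X) (OM (Compr X) A)))"
      using A by (simp add: pmap_comp_def)
  next
    fix s assume s: "s \<in> Arr (Total X)"
    show "Bot (AM (Compr Z) (AM (TotF ?QP) s)) = AM (BaseF ?QP) (Bot (AM (Compr X) s))"
      using s by (simp add: pmap_comp_def)
    let ?B = "Cod (Total X) s" and ?A = "Dom (Total X) s"
    \<comment> \<open>Two naturality squares are pasted: that of \<open>Cmp Q\<close> at the image
      of \<open>s\<close>, then the image under \<open>BaseF Q\<close> of that of
      \<open>Cmp P\<close> at \<open>s\<close>.\<close>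
    have "AM (BaseF Q) (Top (Cmp P ?B)) \<cdot>\<^bsub>Base Z\<^esub> Top (Cmp Q (OM (TotF P) ?B))
          \<cdot>\<^bsub>Base Z\<^esub> Top (AM (Compr Z) (AM (TotF Q) (AM (TotF P) s)))
        = AM (BaseF Q) (Top (Cmp P ?B)) \<cdot>\<^bsub>Base Z\<^esub>
          (AM (BaseF Q) (Top (AM (Compr Y) (AM (TotF P) s))) \<cdot>\<^bsub>Base Z\<^esub> Top (Cmp Q (OM (TotF P) ?A)))"
      using s Q.Cmp_natural[of "AM (TotF P) s"] by (simp add: Q.Y.B.Comp_assoc_Arr)
    also have "\<dots> = AM (BaseF Q) (Top (Cmp P ?B) \<cdot>\<^bsub>Base Y\<^esub> Top (AM (Compr Y) (AM (TotF P) s)))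
          \<cdot>\<^bsub>Base Z\<^esub> Top (Cmp Q (OM (TotF P) ?A))"
      using s by (simp add: Q.Y.B.Comp_assoc_Arr Q.F.AM_Comp_Arr)
    also have "\<dots> = AM (BaseF Q) (AM (BaseF P) (Top (AM (Compr X) s))) \<cdot>\<^bsub>Base Z\<^esub>
          (AM (BaseF Q) (Top (Cmp P ?A)) \<cdot>\<^bsub>Base Z\<^esub> Top (Cmp Q (OM (TotF P) ?A)))"
      unfolding P.Cmp_natural[OF s] using s by (simp add: Q.Y.B.Comp_assoc_Arr Q.F.AM_Comp_Arr)
    finally show "Top (Cmp ?QP ?B) \<cdot>\<^bsub>Base Z\<^esub> Top (AM (Compr Z) (AM (TotF ?QP) s))
        = AM (BaseF ?QP) (Top (AM (Compr X) s)) \<cdot>\<^bsub>Base Z\<^esub> Top (Cmp ?QP ?A)"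
      using s by (simp add: pmap_comp_def)
  next
    fix s assume s: "cartesian (Total X) (Base X) (Proj X) s"
    then show "cartesian (Total Z) (Base Z) (Proj Z) (AM (TotF ?QP) s)"
      using Q.TotF_cartesian[OF P.TotF_cartesian[OF s]] P.X.p.cartesian_Arr[OF s]
      by (simp add: pmap_comp_def)
  qed (simp add: pmap_comp_def)
qed

lemma transformation_trafo_id:
  assumes "pseudo_map X Y P"
  shows "transformation X Y (trafo_id X Y P)"
proof -
  interpret P: pseudo_map X Y P by fact
  show ?thesis
    by (rule transformationI)
      (auto simp: assms intro: nat_trans_Ident P.BaseF P.TotF)
qed

lemma transformation_trafo_vcomp:
  assumes "transformation X Y t" "transformation X Y u" "Src u = Tgt t"
  shows "transformation X Y (trafo_vcomp X Y u t)"
proof -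
  interpret t: transformation X Y t by fact
  interpret u: transformation X Y u by fact
  show ?thesis
  proof (rule transformationI)
    fix A assume A: "A \<in> Obj (Total X)"
    show "Bot (AM (Compr Y) (TotT (trafo_vcomp X Y u t) A))
        = BaseT (trafo_vcomp X Y u t) (Cod (Base X) (OM (Compr X) A))"
      using A assms(3) by (simp add: t.Src.Y.chi.AM_Comp_Arr)
    let ?x = "Dom (Base X) (OM (Compr X) A)"
    have "Top (Cmp (Tgt u) A) \<cdot>\<^bsub>Base Y\<^esub> Top (AM (Compr Y) (TotT u A \<cdot>\<^bsub>Total Y\<^esub> TotT t A))
        = Top (Cmp (Tgt u) A) \<cdot>\<^bsub>Base Y\<^esub> Top (AM (Compr Y) (TotT u A)) \<cdot>\<^bsub>Base Y\<^esub> Top (AM (Compr Y) (TotT t A))"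
      using A assms(3) by (simp add: t.Src.Y.chi.AM_Comp_Arr t.Src.Y.B.Comp_assoc_Arr)
    also have "\<dots> = BaseT u ?x \<cdot>\<^bsub>Base Y\<^esub> (Top (Cmp (Tgt t) A) \<cdot>\<^bsub>Base Y\<^esub> Top (AM (Compr Y) (TotT t A)))"
      unfolding u.TotT_Cmp[OF A] using A assms(3) by (simp add: t.Src.Y.B.Comp_assoc_Arr)
    also have "\<dots> = BaseT u ?x \<cdot>\<^bsub>Base Y\<^esub> BaseT t ?x \<cdot>\<^bsub>Base Y\<^esub> Top (Cmp (Src t) A)"
      unfolding t.TotT_Cmp[OF A] using A assms(3) by (simp add: t.Src.Y.B.Comp_assoc_Arr)
    finally show "Top (Cmp (Tgt (trafo_vcomp X Y u t)) A) \<cdot>\<^bsub>Base Y\<^esub>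
          Top (AM (Compr Y) (TotT (trafo_vcomp X Y u t) A))
        = BaseT (trafo_vcomp X Y u t) ?x \<cdot>\<^bsub>Base Y\<^esub> Top (Cmp (Src (trafo_vcomp X Y u t)) A)"
      using A by simp
  qed (use t.BaseT u.BaseT t.TotT u.TotT assms(3) t.Src.pseudo_map_axioms u.Tgt.pseudo_map_axioms
      in \<open>auto intro: nat_trans_vcomp\<close>)
qed

lemma transformation_trafo_hcomp:
  assumes "transformation X Y t" "transformation Y Z u"
  shows "transformation X Z (trafo_hcomp X Y Z u t)"
proof -
  interpret t: transformation X Y t by fact
  interpret u: transformation Y Z u by fact
  let ?P = "Src t" and ?P' = "Tgt t" and ?Q = "Src u" and ?Q' = "Tgt u"
  show ?thesis
  proof (rule transformationI)
    fix A assume A: "A \<in> Obj (Total X)"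
    let ?A' = "OM (TotF ?P') A" and ?x = "Dom (Base X) (OM (Compr X) A)"
    show "Bot (AM (Compr Z) (TotT (trafo_hcomp X Y Z u t) A))
        = BaseT (trafo_hcomp X Y Z u t) (Cod (Base X) (OM (Compr X) A))"
      using A by (simp add: u.Src.Y.chi.AM_Comp_Arr)
    note assoc = u.Src.Y.B.Comp_assoc_Arr
    \<comment> \<open>The component of \<open>u\<close> moves left past the comparisons: first
      compatibility of \<open>u\<close> with its comparisons, then naturality of
      \<open>BaseT u\<close> at the top of \<open>Cmp ?P' A\<close> and of \<open>Cmp ?Q\<close> at
      \<open>TotT t A\<close>, and last compatibility of \<open>t\<close> under
      \<open>BaseF ?Q\<close>.\<close>
    have "AM (BaseF ?Q') (Top (Cmp ?P' A)) \<cdot>\<^bsub>Base Z\<^esub> Top (Cmp ?Q' ?A') \<cdot>\<^bsub>Base Z\<^esub>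
          Top (AM (Compr Z) (TotT u ?A' \<cdot>\<^bsub>Total Z\<^esub> AM (TotF ?Q) (TotT t A)))
        = AM (BaseF ?Q') (Top (Cmp ?P' A)) \<cdot>\<^bsub>Base Z\<^esub>
          (Top (Cmp ?Q' ?A') \<cdot>\<^bsub>Base Z\<^esub> Top (AM (Compr Z) (TotT u ?A'))) \<cdot>\<^bsub>Base Z\<^esub>
          Top (AM (Compr Z) (AM (TotF ?Q) (TotT t A)))"
      using A by (simp add: u.Src.Y.chi.AM_Comp_Arr assoc)
    also have "\<dots> = AM (BaseF ?Q') (Top (Cmp ?P' A)) \<cdot>\<^bsub>Base Z\<^esub>
          BaseT u (Dom (Base Y) (OM (Compr Y) ?A')) \<cdot>\<^bsub>Base Z\<^esub>
          (Top (Cmp ?Q ?A') \<cdot>\<^bsub>Base Z\<^esub> Top (AM (Compr Z) (AM (TotF ?Q) (TotT t A))))"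
      using A by (simp add: u.TotT_Cmp assoc)
    also have "\<dots> = BaseT u (OM (BaseF ?P') ?x) \<cdot>\<^bsub>Base Z\<^esub> AM (BaseF ?Q) (Top (Cmp ?P' A)) \<cdot>\<^bsub>Base Z\<^esub>
          (AM (BaseF ?Q) (Top (AM (Compr Y) (TotT t A))) \<cdot>\<^bsub>Base Z\<^esub> Top (Cmp ?Q (OM (TotF ?P) A)))"
      using A nat_transD(7)[OF u.BaseT, of "Top (Cmp ?P' A)"] u.Src.Cmp_natural[of "TotT t A"] by simp
    also have "\<dots> = BaseT u (OM (BaseF ?P') ?x) \<cdot>\<^bsub>Base Z\<^esub>
          AM (BaseF ?Q) (Top (Cmp ?P' A) \<cdot>\<^bsub>Base Y\<^esub> Top (AM (Compr Y) (TotT t A))) \<cdot>\<^bsub>Base Z\<^esub>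
          Top (Cmp ?Q (OM (TotF ?P) A))"
      using A by (simp add: u.Src.F.AM_Comp_Arr assoc)
    also have "\<dots> = BaseT u (OM (BaseF ?P') ?x) \<cdot>\<^bsub>Base Z\<^esub> AM (BaseF ?Q) (BaseT t ?x) \<cdot>\<^bsub>Base Z\<^esub>
          (AM (BaseF ?Q) (Top (Cmp ?P A)) \<cdot>\<^bsub>Base Z\<^esub> Top (Cmp ?Q (OM (TotF ?P) A)))"
      unfolding t.TotT_Cmp[OF A] using A by (simp add: u.Src.F.AM_Comp_Arr assoc)
    finally show "Top (Cmp (Tgt (trafo_hcomp X Y Z u t)) A) \<cdot>\<^bsub>Base Z\<^esub>
          Top (AM (Compr Z) (TotT (trafo_hcomp X Y Z u t) A))
        = BaseT (trafo_hcomp X Y Z u t) ?x \<cdot>\<^bsub>Base Z\<^esub> Top (Cmp (Src (trafo_hcomp X Y Z u t)) A)"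
      using A by simp
  qed (auto intro!: nat_trans_hcomp t.BaseT u.BaseT t.TotT u.TotT pseudo_map_pmap_comp t.Src.pseudo_map_axioms t.Tgt.pseudo_map_axioms
      u.Src.pseudo_map_axioms u.Tgt.pseudo_map_axioms)
qed

section \<open>Hom-categories and the laws of the 2-category\<close>

lemma pmap_cat_simps [simp]:
  "Obj (pmap_cat X Y) = {P. pseudo_map X Y P}" "Arr (pmap_cat X Y) = {t. transformation X Y t}"
  "Dom (pmap_cat X Y) = Src" "Cod (pmap_cat X Y) = Tgt" "Ident (pmap_cat X Y) = trafo_id X Y"
  "Comp (pmap_cat X Y) = trafo_vcomp X Y"
  by (auto simp: pmap_cat_def)

lemma transformation_Src: "transformation X Y t \<Longrightarrow> pseudo_map X Y (Src t)"
  and transformation_Tgt: "transformation X Y t \<Longrightarrow> pseudo_map X Y (Tgt t)"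
  by (auto simp: transformation_def)

lemma category_pmap_cat: "category (pmap_cat X Y)"
proof (rule categoryI; clarsimp)
  fix t assume t: "transformation X Y t"
  then interpret t: transformation X Y t .
  show "pseudo_map X Y (Src t) \<and> pseudo_map X Y (Tgt t)"
    using t transformation_Src transformation_Tgt by blast
  note ids = transformation_trafo_id[OF transformation_Src[OF t]]
    transformation_trafo_id[OF transformation_Tgt[OF t]]
  have "trafo_vcomp X Y t (trafo_id X Y (Src t)) = t"
    by (rule trafo_eqI[OF transformation_trafo_vcomp[OF ids(1) t] t])
      auto
  moreover have "trafo_vcomp X Y (trafo_id X Y (Tgt t)) t = t"
    by (rule trafo_eqI[OF transformation_trafo_vcomp[OF t ids(2)] t])
      auto
  ultimately show "trafo_vcomp X Y t (trafo_id X Y (Src t)) = t \<and>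
      trafo_vcomp X Y (trafo_id X Y (Tgt t)) t = t" ..
next
  fix t u v
  assume tuv: "transformation X Y t" "transformation X Y u" "transformation X Y v"
    "Src u = Tgt t" "Src v = Tgt u"
  interpret t: transformation X Y t by fact
  interpret u: transformation X Y u by fact
  interpret v: transformation X Y v by fact
  show "trafo_vcomp X Y (trafo_vcomp X Y v u) t = trafo_vcomp X Y v (trafo_vcomp X Y u t)"
    by (rule trafo_eqI[of X Y])
      (use tuv in \<open>auto simp: t.Src.Y.B.Comp_assoc_Arr t.Src.Y.T.Comp_assoc_Arr
        intro!: transformation_trafo_vcomp\<close>)
qed (auto intro: transformation_trafo_id transformation_trafo_vcomp)

lemma prod_cat_simps [simp]:
  "Obj (prod_cat C D) = Obj C \<times> Obj D" "Arr (prod_cat C D) = Arr C \<times> Arr D"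
  "Dom (prod_cat C D) = map_prod (Dom C) (Dom D)" "Cod (prod_cat C D) = map_prod (Cod C) (Cod D)"
  "Ident (prod_cat C D) = map_prod (Ident C) (Ident D)"
  "x \<cdot>\<^bsub>prod_cat C D\<^esub> y = (fst x \<cdot>\<^bsub>C\<^esub> fst y, snd x \<cdot>\<^bsub>D\<^esub> snd y)"
  by (auto simp: prod_cat_def case_prod_unfold)

lemma category_prod_cat:
  assumes "category C" "category D"
  shows "category (prod_cat C D)"
proof -
  interpret C: category C by fact
  interpret D: category D by fact
  show ?thesis by (rule categoryI) (auto simp: C.Comp_assoc_Arr D.Comp_assoc_Arr)
qed

text \<open>Interchange at a single object; all of it rests on naturality of \<open>u\<close> at
  \<open>g\<close>. The form for plain natural transformations covers both the base and the total
  components of 2-cells.\<close>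

lemma nat_trans_interchange:
  assumes u: "nat_trans D E G G' u" and v: "nat_trans D E G' G'' v"
    and f: "f \<in> Arr D" "g \<in> Arr D" "Dom D g = Cod D f" "Cod D g = y"
  shows "v y \<cdot>\<^bsub>E\<^esub> u y \<cdot>\<^bsub>E\<^esub> AM G (g \<cdot>\<^bsub>D\<^esub> f)
    = v y \<cdot>\<^bsub>E\<^esub> AM G' g \<cdot>\<^bsub>E\<^esub> (u (Dom D g) \<cdot>\<^bsub>E\<^esub> AM G f)"
proof -
  interpret G: cat_functor D E G by (rule nat_transD(1)[OF u])
  interpret G': cat_functor D E G' by (rule nat_transD(2)[OF u])
  interpret G'': cat_functor D E G'' by (rule nat_transD(2)[OF v])
  have y [simp]: "y \<in> Obj D" using f by auto
  note [simp] = nat_transD(4-6)[OF u] nat_transD(4-6)[OF v]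
  have "v y \<cdot>\<^bsub>E\<^esub> u y \<cdot>\<^bsub>E\<^esub> AM G (g \<cdot>\<^bsub>D\<^esub> f) = v y \<cdot>\<^bsub>E\<^esub> (u y \<cdot>\<^bsub>E\<^esub> AM G g \<cdot>\<^bsub>E\<^esub> AM G f)"
    using f by (simp add: G.AM_Comp_Arr G.D.Comp_assoc_Arr)
  also have "u y \<cdot>\<^bsub>E\<^esub> AM G g = AM G' g \<cdot>\<^bsub>E\<^esub> u (Dom D g)"
    using nat_transD(7)[OF u f(2)] f by simp
  also have "v y \<cdot>\<^bsub>E\<^esub> (AM G' g \<cdot>\<^bsub>E\<^esub> u (Dom D g) \<cdot>\<^bsub>E\<^esub> AM G f)
      = v y \<cdot>\<^bsub>E\<^esub> AM G' g \<cdot>\<^bsub>E\<^esub> (u (Dom D g) \<cdot>\<^bsub>E\<^esub> AM G f)"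
    using f by (simp add: G.D.Comp_assoc_Arr)
  finally show ?thesis .
qed

lemma trafo_hcomp_vcomp:
  assumes "transformation X Y t" "transformation X Y t'" "Src t' = Tgt t"
    and "transformation Y Z u" "transformation Y Z u'" "Src u' = Tgt u"
  shows "trafo_hcomp X Y Z (trafo_vcomp Y Z u' u) (trafo_vcomp X Y t' t)
    = trafo_vcomp X Z (trafo_hcomp X Y Z u' t') (trafo_hcomp X Y Z u t)"
proof -
  interpret t: transformation X Y t by fact
  interpret t': transformation X Y t' by fact
  interpret u: transformation Y Z u by fact
  interpret u': transformation Y Z u' by fact
  show ?thesis
    using assms(3,6) nat_trans_interchange[OF u.BaseT u'.BaseT[unfolded assms(6)]]
      nat_trans_interchange[OF u.TotT u'.TotT[unfolded assms(6)]]
    by (intro trafo_eqI[of X Z] transformation_trafo_hcomp transformation_trafo_vcomp assms)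
      (auto intro: assms)
qed

lemma trafo_hcomp_id:
  assumes "pseudo_map X Y P" "pseudo_map Y Z Q"
  shows "trafo_hcomp X Y Z (trafo_id Y Z Q) (trafo_id X Y P) = trafo_id X Z (pmap_comp X Y Z Q P)"
proof -
  interpret P: pseudo_map X Y P by fact
  interpret Q: pseudo_map Y Z Q by fact
  show ?thesis
    by (rule trafo_eqI[OF transformation_trafo_hcomp[OF transformation_trafo_id[OF assms(1)]
            transformation_trafo_id[OF assms(2)]]
          transformation_trafo_id[OF pseudo_map_pmap_comp[OF assms]]])
      auto
qed

lemma pmap_comp_id:
  assumes "pseudo_map X Y P"
  shows "pmap_comp X X Y P (pmap_id X) = P" "pmap_comp X Y Y (pmap_id Y) P = P"
proof -
  interpret P: pseudo_map X Y P by fact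
  note ids = pseudo_map_pmap_id[OF P.X.comprehension_category_axioms]
    pseudo_map_pmap_id[OF P.Y.comprehension_category_axioms]
  interpret I: pseudo_map X X "pmap_id X" by (rule ids)
  show "pmap_comp X X Y P (pmap_id X) = P"
    by (rule pseudo_map_eqI[OF pseudo_map_pmap_comp[OF ids(1) assms] assms])
      (auto simp: arrow_cat_Arr_iff fcomp_id_right[OF P.BaseF]
        fcomp_id_right[OF P.TotF])
  show "pmap_comp X Y Y (pmap_id Y) P = P"
    by (rule pseudo_map_eqI[OF pseudo_map_pmap_comp[OF assms ids(2)] assms])
      (auto simp: fcomp_id_left[OF P.BaseF] fcomp_id_left[OF P.TotF])
qed

lemma trafo_hcomp_id_pmap_id:
  assumes "transformation X Y t"
  shows "trafo_hcomp X X Y t (trafo_id X X (pmap_id X)) = t"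
    and "trafo_hcomp X Y Y (trafo_id Y Y (pmap_id Y)) t = t"
proof -
  interpret t: transformation X Y t by fact
  note ids = transformation_trafo_id[OF pseudo_map_pmap_id[OF t.Src.X.comprehension_category_axioms]]
    transformation_trafo_id[OF pseudo_map_pmap_id[OF t.Src.Y.comprehension_category_axioms]]
  note maps = t.Src.pseudo_map_axioms t.Tgt.pseudo_map_axioms
  show "trafo_hcomp X X Y t (trafo_id X X (pmap_id X)) = t"
    by (rule trafo_eqI[OF transformation_trafo_hcomp[OF ids(1) assms] assms])
      (simp_all add: pmap_comp_id[OF maps(1)] pmap_comp_id[OF maps(2)])
  show "trafo_hcomp X Y Y (trafo_id Y Y (pmap_id Y)) t = t"
    by (rule trafo_eqI[OF transformation_trafo_hcomp[OF assms ids(2)] assms])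
      (simp_all add: pmap_comp_id[OF maps(1)] pmap_comp_id[OF maps(2)])
qed

lemma pmap_comp_assoc:
  assumes "pseudo_map W X P" "pseudo_map X Y Q" "pseudo_map Y Z R"
  shows "pmap_comp W X Z (pmap_comp X Y Z R Q) P = pmap_comp W Y Z R (pmap_comp W X Y Q P)"
proof -
  interpret P: pseudo_map W X P by fact
  interpret Q: pseudo_map X Y Q by fact
  interpret R: pseudo_map Y Z R by fact
  interpret QP: pseudo_map W Y "pmap_comp W X Y Q P" by (rule pseudo_map_pmap_comp) fact+
  show ?thesis
    by (rule pseudo_map_eqI[of W Z])
      (auto intro!: pseudo_map_pmap_comp assms simp: R.F.AM_Comp_Arr
        R.Y.B.Comp_assoc_Arr fcomp_assoc[OF P.BaseF] fcomp_assoc[OF P.TotF])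
qed

lemma trafo_hcomp_assoc:
  assumes "transformation W X t" "transformation X Y u" "transformation Y Z v"
  shows "trafo_hcomp W X Z (trafo_hcomp X Y Z v u) t = trafo_hcomp W Y Z v (trafo_hcomp W X Y u t)"
proof -
  interpret t: transformation W X t by fact
  interpret u: transformation X Y u by fact
  interpret v: transformation Y Z v by fact
  show ?thesis
    by (rule trafo_eqI[of W Z])
      (auto intro!: transformation_trafo_hcomp pmap_comp_assoc assms transformation_Src
        transformation_Tgt simp: v.Src.F.AM_Comp_Arr
        v.Src.Fb.AM_Comp_Arr v.Src.Y.B.Comp_assoc_Arr v.Src.Y.T.Comp_assoc_Arr)
qed

lemma CompCat_simps [simp]:
  "Ob0 CompCat = {X. comprehension_category X}" "HomCat CompCat = pmap_cat" "One CompCat = pmap_id"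
  "\<lbrakk>pseudo_map Y Z Q; pseudo_map X Y P\<rbrakk> \<Longrightarrow> comp1 CompCat X Y Z Q P = pmap_comp X Y Z Q P"
  "\<lbrakk>transformation Y Z u; transformation X Y t\<rbrakk> \<Longrightarrow> comp2 CompCat X Y Z u t = trafo_hcomp X Y Z u t"
  by (auto simp: CompCat_def)

lemma two_category_CompCat: "two_category CompCat"
proof (rule two_category.intro)
  fix X Y Z :: "'a compcat"
  show "cat_functor (prod_cat (HomCat CompCat Y Z) (HomCat CompCat X Y)) (HomCat CompCat X Z)
      (HComp CompCat X Y Z)"
  proof (rule cat_functorI)
    show "OM (HComp CompCat X Y Z) \<in> extensional (Obj (prod_cat (HomCat CompCat Y Z) (HomCat CompCat X Y)))"
      and "AM (HComp CompCat X Y Z) \<in> extensional (Arr (prod_cat (HomCat CompCat Y Z) (HomCat CompCat X Y)))"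
      by (auto simp: CompCat_def)
  qed (auto simp: category_prod_cat category_pmap_cat pseudo_map_pmap_comp
      transformation_trafo_hcomp transformation_trafo_vcomp transformation_trafo_id
      transformation_Src transformation_Tgt trafo_hcomp_id trafo_hcomp_vcomp)
qed (auto simp: category_pmap_cat pseudo_map_pmap_id pseudo_map_pmap_comp transformation_trafo_hcomp
    transformation_trafo_id pmap_comp_id trafo_hcomp_id_pmap_id pmap_comp_assoc trafo_hcomp_assoc)


section \<open>Maps into full comprehension categories\<close>

context comprehension_category
begin

text \<open>As \<tau> is invertible, the equation forces the square of \<open>u\<close> to be the
  conjugate of \<open>r\<close>, and fullness realises that square. Arrow parts of pseudo maps arise
  when \<open>r\<close> is the image of a comprehension square, components of 2-cells when
  \<open>r\<close> is a naturality square.\<close>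

lemma full_conjugate:
  assumes "full_compcat X" "A \<in> Obj (Total X)" "B \<in> Obj (Total X)"
    and \<sigma>: "iso_arrow (arrow_cat (Base X)) \<sigma>" "Lft \<sigma> = OM (Compr X) A"
    and \<tau>: "iso_arrow (arrow_cat (Base X)) \<tau>" "Lft \<tau> = OM (Compr X) B"
    and r: "r \<in> Arr (arrow_cat (Base X))" "Lft r = Rgt \<sigma>" "Rgt r = Rgt \<tau>"
  obtains u where "u \<in> Arr (Total X)" "Dom (Total X) u = A" "Cod (Total X) u = B"
    "\<tau> \<cdot>\<^bsub>arrow_cat (Base X)\<^esub> AM (Compr X) u = r \<cdot>\<^bsub>arrow_cat (Base X)\<^esub> \<sigma>"
proof -
  note [simp del] = arrow_cat_simps(5)
  have [simp]: "\<sigma> \<in> Arr (arrow_cat (Base X))" "\<tau> \<in> Arr (arrow_cat (Base X))"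
    using \<sigma> \<tau> by (auto simp: iso_arrow_def)
  obtain \<tau>' where \<tau>': "\<tau>' \<in> Arr (arrow_cat (Base X))" "Lft \<tau>' = Rgt \<tau>" "Rgt \<tau>' = Lft \<tau>"
    "\<tau> \<cdot>\<^bsub>arrow_cat (Base X)\<^esub> \<tau>' = Ident (arrow_cat (Base X)) (Rgt \<tau>)"
    using \<tau>(1) by (metis A.iso_arrowE arrow_cat_simps(2,3))
  note Comp = A.Comp_simps[unfolded arrow_cat_simps(2,3)]
  have r\<sigma>: "r \<cdot>\<^bsub>arrow_cat (Base X)\<^esub> \<sigma> \<in> Arr (arrow_cat (Base X))"
    "Lft (r \<cdot>\<^bsub>arrow_cat (Base X)\<^esub> \<sigma>) = OM (Compr X) A" "Rgt (r \<cdot>\<^bsub>arrow_cat (Base X)\<^esub> \<sigma>) = Rgt \<tau>"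
    using r \<sigma>(2) by (simp_all add: Comp)
  let ?q = "\<tau>' \<cdot>\<^bsub>arrow_cat (Base X)\<^esub> (r \<cdot>\<^bsub>arrow_cat (Base X)\<^esub> \<sigma>)"
  have q: "?q \<in> Arr (arrow_cat (Base X))" "Lft ?q = OM (Compr X) A" "Rgt ?q = OM (Compr X) B"
    using r\<sigma> \<tau>' \<tau>(2) by (simp_all add: Comp)
  obtain u where u: "u \<in> Arr (Total X)" "Dom (Total X) u = A" "Cod (Total X) u = B"
    "AM (Compr X) u = ?q"
    using full_compcatE[OF assms(1-3) q] .
  have "\<tau> \<cdot>\<^bsub>arrow_cat (Base X)\<^esub> ?q
      = \<tau> \<cdot>\<^bsub>arrow_cat (Base X)\<^esub> \<tau>' \<cdot>\<^bsub>arrow_cat (Base X)\<^esub> (r \<cdot>\<^bsub>arrow_cat (Base X)\<^esub> \<sigma>)"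
    by (rule A.Comp_assoc_Arr[symmetric]) (use r\<sigma> \<tau>' in auto)
  also have "\<dots> = r \<cdot>\<^bsub>arrow_cat (Base X)\<^esub> \<sigma>"
    unfolding \<tau>'(4) by (rule A.Comp_Ident_left) (use r\<sigma> in auto)
  finally show ?thesis using u by (intro that[of u]) auto
qed

text \<open>Uniqueness counterpart of \<open>full_conjugate\<close>: equations in the total category
  are checked after composing with a comparison square, where naturality is available.\<close>

lemma full_cancel:
  assumes "full_compcat X" "u \<in> Arr (Total X)" "v \<in> Arr (Total X)"
    "Dom (Total X) u = Dom (Total X) v" "Cod (Total X) u = Cod (Total X) v"
    and "iso_arrow (arrow_cat (Base X)) \<tau>" "Lft \<tau> = OM (Compr X) (Cod (Total X) u)"
    and "\<tau> \<cdot>\<^bsub>arrow_cat (Base X)\<^esub> AM (Compr X) u = \<tau> \<cdot>\<^bsub>arrow_cat (Base X)\<^esub> AM (Compr X) v"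
  shows "u = v"
proof (rule full_compcatD[OF assms(1-5)])
  show "AM (Compr X) u = AM (Compr X) v"
    by (rule A.iso_arrow_mono[OF assms(6) _ _ _ _ assms(8)]) (use assms in auto)
qed

end

lemma (in pseudo_map) Cmp_square_natural:
  assumes "s \<in> Arr (Total X)"
  shows "Cmp P (Cod (Total X) s) \<cdot>\<^bsub>arrow_cat (Base Y)\<^esub> AM (Compr Y) (AM (TotF P) s)
    = AM (arrow_ftor (Base X) (BaseF P)) (AM (Compr X) s) \<cdot>\<^bsub>arrow_cat (Base Y)\<^esub> Cmp P (Dom (Total X) s)"
  using assms by (auto simp: Cmp_natural)

sublocale pseudo_map \<subseteq> AF: cat_functor "arrow_cat (Base X)" "arrow_cat (Base Y)" "arrow_ftor (Base X) (BaseF P)"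
  by (rule cat_functor_arrow_ftor) (rule BaseF)

text \<open>The square is the comprehension of \<open>AM (TotF P) s\<close> conjugated by comparison
  isomorphisms, hence cartesian. So \<open>BaseF P\<close> preserves the pullback squares that stem
  from cartesian arrows, whatever it does to other pullbacks.\<close>

lemma (in pseudo_map) cartesian_arrow_ftor:
  assumes "cartesian (Total X) (Base X) (Proj X) s"
  shows "cartesian (arrow_cat (Base Y)) (Base Y) (cod_ftor (Base Y))
    (AM (arrow_ftor (Base X) (BaseF P)) (AM (Compr X) s))"
proof -
  note [simp del] = arrow_cat_simps(5) arrow_ftor_simps(2)
  have s [simp]: "s \<in> Arr (Total X)" using assms by (rule X.p.cartesian_Arr)
  let ?A = "arrow_cat (Base Y)" and ?r = "AM (arrow_ftor (Base X) (BaseF P)) (AM (Compr X) s)"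
  have r: "?r \<in> Arr ?A" "Lft ?r = AM (BaseF P) (OM (Compr X) (Dom (Total X) s))"
    using AF.AM_simps(1,2)[of "AM (Compr X) s"] by auto
  obtain c where c: "c \<in> Arr ?A" "Lft c = Rgt (Cmp P (Dom (Total X) s))"
    "Rgt c = Lft (Cmp P (Dom (Total X) s))" "iso_arrow ?A c"
    "Cmp P (Dom (Total X) s) \<cdot>\<^bsub>?A\<^esub> c = Ident ?A (Rgt (Cmp P (Dom (Total X) s)))"
    using Cmp_square(2)[of "Dom (Total X) s"] s
    by (metis X.T.Dom_Obj Y.A.iso_arrowE arrow_cat_simps(2,3))
  have "?r = ?r \<cdot>\<^bsub>?A\<^esub> (Cmp P (Dom (Total X) s) \<cdot>\<^bsub>?A\<^esub> c)"
    unfolding c(5) by (rule Y.A.Comp_Ident_right[symmetric]) (use r in auto)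
  also have "\<dots> = ?r \<cdot>\<^bsub>?A\<^esub> Cmp P (Dom (Total X) s) \<cdot>\<^bsub>?A\<^esub> c"
    by (rule Y.A.Comp_assoc_Arr[symmetric]) (use r c in auto)
  also have "\<dots> = Cmp P (Cod (Total X) s) \<cdot>\<^bsub>?A\<^esub> AM (Compr Y) (AM (TotF P) s) \<cdot>\<^bsub>?A\<^esub> c"
    by (simp add: Cmp_square_natural)
  finally have eq: "?r = Cmp P (Cod (Total X) s) \<cdot>\<^bsub>?A\<^esub> AM (Compr Y) (AM (TotF P) s) \<cdot>\<^bsub>?A\<^esub> c" .
  show ?thesis unfolding eq
    by (intro Y.cod.cartesian_Comp Y.cod.cartesian_iso Y.cartesian_Compr TotF_cartesian assms)
      (use c in \<open>auto simp: arrow_cat_simps(5)\<close>)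
qed

text \<open>Naturality of the comparison at \<open>s\<close> expresses \<open>AM (TotF P) s\<close>
  through the common data, up to an invertible square that \<open>full_cancel\<close>
  removes.\<close>

lemma pseudo_map_eq_full:
  assumes "pseudo_map X Y P" "pseudo_map X Y Q" "full_compcat Y"
    and "BaseF P = BaseF Q" "OM (TotF P) = OM (TotF Q)" "Cmp P = Cmp Q"
  shows "P = Q"
proof -
  interpret P: pseudo_map X Y P by fact
  interpret Q: pseudo_map X Y Q by fact
  have "TotF P = TotF Q"
  proof (rule ftor_eqI[OF P.TotF Q.TotF])
    fix s assume s: "s \<in> Arr (Total X)"
    show "AM (TotF P) s = AM (TotF Q) s"
      by (rule P.Y.full_cancel[OF assms(3), of _ _ "Cmp P (Cod (Total X) s)"])
        (use s assms P.Cmp_square_natural[OF s] Q.Cmp_square_natural[OF s] in auto)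
  qed (simp add: assms)
  then show ?thesis using assms by simp
qed

text \<open>The square of \<open>TotT t A\<close> gets its bottom from \<open>BaseT t\<close> and,
  up to the invertible comparison, its top from \<open>TotT_Cmp\<close>; faithfulness turns this
  into equality of arrows.\<close>

lemma trafo_eq_full:
  assumes "transformation X Y t" "transformation X Y u" "full_compcat Y"
    and "Src t = Src u" "Tgt t = Tgt u" "BaseT t = BaseT u"
  shows "t = u"
proof -
  interpret t: transformation X Y t by fact
  interpret u: transformation X Y u by fact
  show ?thesis
  proof (rule trafo_eqI[OF assms(1,2,4,5)])
    fix A assume A: "A \<in> Obj (Total X)"
    show "TotT t A = TotT u A"
      by (rule t.Src.Y.full_cancel[OF assms(3), of _ _ "Cmp (Tgt t) A"])
        (use A assms t.TotT_Cmp[OF A] u.TotT_Cmp[OF A] in auto)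
  qed (simp add: assms)
qed

text \<open>The naturality squares of \<alpha> at comprehensions, conjugated by the comparisons of
  \<open>P\<close> and \<open>Q\<close>, become squares between comprehensions in \<open>Y\<close>
  and therefore come from arrows of \<open>Total Y\<close>.\<close>

lemma transformation_exists_full:
  assumes "pseudo_map X Y P" "pseudo_map X Y Q" "full_compcat Y"
    and \<alpha>: "nat_trans (Base X) (Base Y) (BaseF P) (BaseF Q) \<alpha>"
  obtains t where "transformation X Y t" "Src t = P" "Tgt t = Q" "BaseT t = \<alpha>"
proof -
  interpret P: pseudo_map X Y P by fact
  interpret Q: pseudo_map X Y Q by fact
  note [simp] = nat_transD(4-6)[OF \<alpha>]
  let ?A = "arrow_cat (Base Y)"
  define a where "a A = \<lparr> Lft = AM (BaseF P) (OM (Compr X) A), Rgt = AM (BaseF Q) (OM (Compr X) A),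
      Top = \<alpha> (Dom (Base X) (OM (Compr X) A)), Bot = \<alpha> (Cod (Base X) (OM (Compr X) A)) \<rparr>" for A
  have a [simp]: "a A \<in> Arr ?A" "Lft (a A) = Rgt (Cmp P A)" "Rgt (a A) = Rgt (Cmp Q A)"
    "Top (a A) = \<alpha> (Dom (Base X) (OM (Compr X) A))" "Bot (a A) = \<alpha> (Cod (Base X) (OM (Compr X) A))"
    if "A \<in> Obj (Total X)" for A
    using that nat_transD(7)[OF \<alpha>, of "OM (Compr X) A"] by (auto simp: a_def arrow_cat_Arr_iff)
  have "\<exists>u. A \<in> Obj (Total X) \<longrightarrow> u \<in> Arr (Total Y) \<and> Dom (Total Y) u = OM (TotF P) A \<and>
      Cod (Total Y) u = OM (TotF Q) A \<and> Cmp Q A \<cdot>\<^bsub>?A\<^esub> AM (Compr Y) u = a A \<cdot>\<^bsub>?A\<^esub> Cmp P A" for A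
    using P.Y.full_conjugate[OF assms(3), of "OM (TotF P) A" "OM (TotF Q) A" "Cmp P A" "Cmp Q A" "a A"]
    by (metis P.Cmp_square(2,3) P.Fb.OM_in Q.Cmp_square(2,3) Q.Fb.OM_in a(1-3))
  then obtain T0 where T0: "A \<in> Obj (Total X) \<Longrightarrow> T0 A \<in> Arr (Total Y) \<and>
      Dom (Total Y) (T0 A) = OM (TotF P) A \<and> Cod (Total Y) (T0 A) = OM (TotF Q) A \<and>
      Cmp Q A \<cdot>\<^bsub>?A\<^esub> AM (Compr Y) (T0 A) = a A \<cdot>\<^bsub>?A\<^esub> Cmp P A" for A
    by metis
  \<comment> \<open>The restriction gives the value \<open>undefined\<close> off the objects, as
    extensionality of 2-cells demands.\<close>
  define T where "T = restrict T0 (Obj (Total X))"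
  have T_ext: "T \<in> extensional (Obj (Total X))" by (simp add: T_def)
  have T [simp]: "T A \<in> Arr (Total Y)" "Dom (Total Y) (T A) = OM (TotF P) A"
    "Cod (Total Y) (T A) = OM (TotF Q) A" "Bot (AM (Compr Y) (T A)) = Bot (a A)"
    and T_Top: "Top (Cmp Q A) \<cdot>\<^bsub>Base Y\<^esub> Top (AM (Compr Y) (T A)) = Top (a A) \<cdot>\<^bsub>Base Y\<^esub> Top (Cmp P A)"
    if "A \<in> Obj (Total X)" for A
    using T0[OF that] that P.Y.Compr_Arr[of "T0 A"] by (auto simp: T_def)
  have natural: "T (Cod (Total X) s) \<cdot>\<^bsub>Total Y\<^esub> AM (TotF P) s = AM (TotF Q) s \<cdot>\<^bsub>Total Y\<^esub> T (Dom (Total X) s)"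
    if s: "s \<in> Arr (Total X)" for s
  proof (rule P.Y.full_cancel[OF assms(3), of _ _ "Cmp Q (Cod (Total X) s)"])
    let ?c = "Cod (Total X) s" and ?d = "Dom (Total X) s" and ?s = "AM (Compr X) s"
    let ?\<chi> = "AM (Compr Y)"
    \<comment> \<open>Top edges are compared by moving the comparison through: the defining equation
      of \<open>T\<close>, naturality of \<open>Cmp P\<close> and of \<alpha>, the equation of
      \<open>T\<close> again, naturality of \<open>Cmp Q\<close>.\<close>
    have "Top (Cmp Q ?c) \<cdot>\<^bsub>Base Y\<^esub> (Top (?\<chi> (T ?c)) \<cdot>\<^bsub>Base Y\<^esub> Top (?\<chi> (AM (TotF P) s)))
        = Top (Cmp Q ?c) \<cdot>\<^bsub>Base Y\<^esub> Top (?\<chi> (T ?c)) \<cdot>\<^bsub>Base Y\<^esub> Top (?\<chi> (AM (TotF P) s))"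
      using s by (simp add: P.Y.B.Comp_assoc_Arr)
    also have "\<dots> = Top (a ?c) \<cdot>\<^bsub>Base Y\<^esub> (Top (Cmp P ?c) \<cdot>\<^bsub>Base Y\<^esub> Top (?\<chi> (AM (TotF P) s)))"
      using s by (simp add: T_Top P.Y.B.Comp_assoc_Arr)
    also have "\<dots> = Top (a ?c) \<cdot>\<^bsub>Base Y\<^esub> AM (BaseF P) (Top ?s) \<cdot>\<^bsub>Base Y\<^esub> Top (Cmp P ?d)"
      using s by (simp add: P.Cmp_natural P.Y.B.Comp_assoc_Arr)
    also have "Top (a ?c) \<cdot>\<^bsub>Base Y\<^esub> AM (BaseF P) (Top ?s) = AM (BaseF Q) (Top ?s) \<cdot>\<^bsub>Base Y\<^esub> Top (a ?d)"
      using s nat_transD(7)[OF \<alpha>, of "Top ?s"] by simp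
    also have "\<dots> \<cdot>\<^bsub>Base Y\<^esub> Top (Cmp P ?d)
        = AM (BaseF Q) (Top ?s) \<cdot>\<^bsub>Base Y\<^esub> (Top (Cmp Q ?d) \<cdot>\<^bsub>Base Y\<^esub> Top (?\<chi> (T ?d)))"
      using s by (simp add: T_Top P.Y.B.Comp_assoc_Arr)
    also have "\<dots> = Top (Cmp Q ?c) \<cdot>\<^bsub>Base Y\<^esub> Top (?\<chi> (AM (TotF Q) s)) \<cdot>\<^bsub>Base Y\<^esub> Top (?\<chi> (T ?d))"
      using s by (simp add: Q.Cmp_natural flip: P.Y.B.Comp_assoc_Arr)
    also have "\<dots> = Top (Cmp Q ?c) \<cdot>\<^bsub>Base Y\<^esub> (Top (?\<chi> (AM (TotF Q) s)) \<cdot>\<^bsub>Base Y\<^esub> Top (?\<chi> (T ?d)))"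
      using s by (simp add: P.Y.B.Comp_assoc_Arr)
    finally have top: "Top (Cmp Q ?c) \<cdot>\<^bsub>Base Y\<^esub> (Top (?\<chi> (T ?c)) \<cdot>\<^bsub>Base Y\<^esub> Top (?\<chi> (AM (TotF P) s)))
        = Top (Cmp Q ?c) \<cdot>\<^bsub>Base Y\<^esub> (Top (?\<chi> (AM (TotF Q) s)) \<cdot>\<^bsub>Base Y\<^esub> Top (?\<chi> (T ?d)))" .
    have bot: "\<alpha> (Cod (Base X) (OM (Compr X) ?c)) \<cdot>\<^bsub>Base Y\<^esub> AM (BaseF P) (Bot ?s)
        = AM (BaseF Q) (Bot ?s) \<cdot>\<^bsub>Base Y\<^esub> \<alpha> (Cod (Base X) (OM (Compr X) ?d))"
      using s nat_transD(7)[OF \<alpha>, of "Bot ?s"] by simp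
    show "Cmp Q ?c \<cdot>\<^bsub>?A\<^esub> ?\<chi> (T ?c \<cdot>\<^bsub>Total Y\<^esub> AM (TotF P) s)
        = Cmp Q ?c \<cdot>\<^bsub>?A\<^esub> ?\<chi> (AM (TotF Q) s \<cdot>\<^bsub>Total Y\<^esub> T ?d)"
      using s top bot by (simp add: P.Y.chi.AM_Comp_Arr)
  qed (use s in auto)
  have "transformation X Y \<lparr> Src = P, Tgt = Q, BaseT = \<alpha>, TotT = T \<rparr>"
    by (rule transformationI)
      (use assms natural T_Top T_ext in \<open>auto intro!: nat_transI P.TotF Q.TotF\<close>)
  then show ?thesis by (rule that) auto
qed

text \<open>Identities of the common base functor lift in both directions. The composites have
  identity base components and are therefore identity 2-cells, so the total functors never have to
  be compared.\<close>

lemma isomorphic_full: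
  assumes "pseudo_map X Y P" "pseudo_map X Y Q" "full_compcat Y" "BaseF P = BaseF Q"
  shows "isomorphic (pmap_cat X Y) P Q"
proof -
  interpret P: pseudo_map X Y P by fact
  let ?\<iota> = "\<lambda>x \<in> Obj (Base X). Ident (Base Y) (OM (BaseF P) x)"
  have \<iota>: "nat_trans (Base X) (Base Y) (BaseF P) (BaseF Q) ?\<iota>"
    "nat_trans (Base X) (Base Y) (BaseF Q) (BaseF P) ?\<iota>"
    using nat_trans_Ident[OF P.BaseF] assms(4) by auto
  obtain t where t: "transformation X Y t" "Src t = P" "Tgt t = Q" "BaseT t = ?\<iota>"
    using transformation_exists_full[OF assms(1-3) \<iota>(1)] .
  obtain u where u: "transformation X Y u" "Src u = Q" "Tgt u = P" "BaseT u = ?\<iota>"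
    using transformation_exists_full[OF assms(2,1,3) \<iota>(2)] .
  have "trafo_vcomp X Y u t = trafo_id X Y P"
    by (rule trafo_eq_full[of X Y]) (use t u assms P.F.OM_in in
        \<open>auto intro!: transformation_trafo_vcomp transformation_trafo_id restrict_ext\<close>)
  moreover have "trafo_vcomp X Y t u = trafo_id X Y Q"
    by (rule trafo_eq_full[of X Y]) (use t u assms P.F.OM_in in
        \<open>auto intro!: transformation_trafo_vcomp transformation_trafo_id restrict_ext\<close>)
  ultimately have "iso_arrow (pmap_cat X Y) t"
    by (intro category.iso_arrowI[OF category_pmap_cat, of t X Y u]) (use t u in auto)
  then show ?thesis
    by (rule category.isomorphicI[OF category_pmap_cat]) (use t in auto)
qed

text \<open>The arrow part is forced: \<open>s\<close> goes to the unique arrow whose square is the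
  image of its comprehension square conjugated by \<sigma>. The condition on cartesian arrows
  concerns only \<open>F\<close> and the squares of \<open>X\<close>, so it can be verified before
  the total functor exists.\<close>

lemma pseudo_map_exists_full:
  fixes F :: "('u, 'u, 'u, 'u) ftor"
  assumes X: "comprehension_category X" and Y: "comprehension_category Y" "full_compcat Y"
    and F: "cat_functor (Base X) (Base Y) F"
    and h: "h \<in> extensional (Obj (Total X))" "\<And>A. A \<in> Obj (Total X) \<Longrightarrow> h A \<in> Obj (Total Y)"
    and \<sigma>: "\<sigma> \<in> extensional (Obj (Total X))"
      "\<And>A. A \<in> Obj (Total X) \<Longrightarrow> iso_arrow (arrow_cat (Base Y)) (\<sigma> A) \<and>
        Lft (\<sigma> A) = OM (Compr Y) (h A) \<and> Rgt (\<sigma> A) = AM F (OM (Compr X) A) \<and>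
        Bot (\<sigma> A) = Ident (Base Y) (OM F (Cod (Base X) (OM (Compr X) A)))"
    and cart: "\<And>s. cartesian (Total X) (Base X) (Proj X) s \<Longrightarrow>
      cartesian (arrow_cat (Base Y)) (Base Y) (cod_ftor (Base Y))
        (AM (arrow_ftor (Base X) F) (AM (Compr X) s))"
  obtains P where "pseudo_map X Y P" "BaseF P = F" "OM (TotF P) = h" "Cmp P = \<sigma>"
proof -
  interpret X: comprehension_category X by fact
  interpret Y: comprehension_category Y by fact
  interpret F: cat_functor "Base X" "Base Y" F by fact
  interpret AF: cat_functor "arrow_cat (Base X)" "arrow_cat (Base Y)" "arrow_ftor (Base X) F"
    by (rule cat_functor_arrow_ftor) fact
  let ?A = "arrow_cat (Base Y)" and ?F = "\<lambda>s. AM (arrow_ftor (Base X) F) (AM (Compr X) s)"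
  have \<sigma>_simps [simp]: "iso_arrow ?A (\<sigma> A)" "\<sigma> A \<in> Arr ?A"
    "Lft (\<sigma> A) = OM (Compr Y) (h A)" "Rgt (\<sigma> A) = AM F (OM (Compr X) A)"
    "Bot (\<sigma> A) = Ident (Base Y) (OM F (Cod (Base X) (OM (Compr X) A)))"
    "Top (\<sigma> A) \<in> Arr (Base Y)" "Dom (Base Y) (Top (\<sigma> A)) = Dom (Base Y) (OM (Compr Y) (h A))"
    "Cod (Base Y) (Top (\<sigma> A)) = OM F (Dom (Base X) (OM (Compr X) A))"
    if "A \<in> Obj (Total X)" for A
    using \<sigma>(2)[OF that] that by (auto simp: iso_arrow_def[of ?A] arrow_cat_Arr_iff)
  have cod [simp]: "Cod (Base Y) (OM (Compr Y) (h A)) = OM F (Cod (Base X) (OM (Compr X) A))"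
    if "A \<in> Obj (Total X)" for A
    using \<sigma>_simps(2)[OF that] that by (auto simp: arrow_cat_Arr_iff)
  have F_Arr: "?F s \<in> Arr ?A" if "s \<in> Arr (Total X)" for s
    by (intro AF.AM_simps X.chi.AM_simps that)
  have "\<exists>u. s \<in> Arr (Total X) \<longrightarrow> u \<in> Arr (Total Y) \<and> Dom (Total Y) u = h (Dom (Total X) s) \<and>
      Cod (Total Y) u = h (Cod (Total X) s) \<and>
      \<sigma> (Cod (Total X) s) \<cdot>\<^bsub>?A\<^esub> AM (Compr Y) u = ?F s \<cdot>\<^bsub>?A\<^esub> \<sigma> (Dom (Total X) s)" for s
  proof (cases "s \<in> Arr (Total X)")
    case True
    show ?thesis
      by (rule Y.full_conjugate[OF Y(2), of "h (Dom (Total X) s)" "h (Cod (Total X) s)"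
            "\<sigma> (Dom (Total X) s)" "\<sigma> (Cod (Total X) s)" "?F s"])
        (use True h(2) F_Arr[OF True] in auto)
  qed simp
  then obtain M0 where M0: "s \<in> Arr (Total X) \<Longrightarrow> M0 s \<in> Arr (Total Y) \<and>
      Dom (Total Y) (M0 s) = h (Dom (Total X) s) \<and> Cod (Total Y) (M0 s) = h (Cod (Total X) s) \<and>
      \<sigma> (Cod (Total X) s) \<cdot>\<^bsub>?A\<^esub> AM (Compr Y) (M0 s) = ?F s \<cdot>\<^bsub>?A\<^esub> \<sigma> (Dom (Total X) s)" for s
    by metis
  define M where "M = restrict M0 (Arr (Total X))"
  have M_ext: "M \<in> extensional (Arr (Total X))" by (simp add: M_def)
  have M [simp]: "M s \<in> Arr (Total Y)" "Dom (Total Y) (M s) = h (Dom (Total X) s)"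
    "Cod (Total Y) (M s) = h (Cod (Total X) s)"
    and M_sq: "\<sigma> (Cod (Total X) s) \<cdot>\<^bsub>?A\<^esub> AM (Compr Y) (M s) = ?F s \<cdot>\<^bsub>?A\<^esub> \<sigma> (Dom (Total X) s)"
    if "s \<in> Arr (Total X)" for s
    using M0[OF that] that by (simp_all add: M_def)
  have M_Top: "Top (\<sigma> (Cod (Total X) s)) \<cdot>\<^bsub>Base Y\<^esub> Top (AM (Compr Y) (M s))
      = AM F (Top (AM (Compr X) s)) \<cdot>\<^bsub>Base Y\<^esub> Top (\<sigma> (Dom (Total X) s))"
    and M_Bot [simp]: "Bot (AM (Compr Y) (M s)) = AM F (Bot (AM (Compr X) s))"
    if "s \<in> Arr (Total X)" for s
    using M_sq[OF that] that h(2) by auto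
  define P where "P = \<lparr> BaseF = F, TotF = \<lparr> OM = h, AM = M \<rparr>, Cmp = \<sigma> \<rparr>"
  \<comment> \<open>Both functor laws are checked after composing with \<sigma>, which turns
    \<open>M\<close> into the action of \<open>F\<close> on squares.\<close>
  have "cat_functor (Total X) (Total Y) \<lparr> OM = h, AM = M \<rparr>"
  proof (rule cat_functorI)
    fix A assume A: "A \<in> Obj (Total X)"
    show "AM \<lparr> OM = h, AM = M \<rparr> (Ident (Total X) A) = Ident (Total Y) (OM \<lparr> OM = h, AM = M \<rparr> A)"
      by (rule Y.full_cancel[OF Y(2), of _ _ "\<sigma> A"])
        (use A h(2) M_Top[of "Ident (Total X) A"] in \<open>auto simp: square_eq_iff\<close>)
  next
    fix s t assume st: "s \<in> Arr (Total X)" "t \<in> Arr (Total X)" "Dom (Total X) t = Cod (Total X) s"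
    have "Top (\<sigma> (Cod (Total X) t)) \<cdot>\<^bsub>Base Y\<^esub> (Top (AM (Compr Y) (M t)) \<cdot>\<^bsub>Base Y\<^esub> Top (AM (Compr Y) (M s)))
        = AM F (Top (AM (Compr X) t)) \<cdot>\<^bsub>Base Y\<^esub> Top (\<sigma> (Cod (Total X) s)) \<cdot>\<^bsub>Base Y\<^esub> Top (AM (Compr Y) (M s))"
      using st h(2) M_Top[of t] by (simp flip: Y.B.Comp_assoc_Arr)
    also have "\<dots> = AM F (Top (AM (Compr X) t)) \<cdot>\<^bsub>Base Y\<^esub>
        (AM F (Top (AM (Compr X) s)) \<cdot>\<^bsub>Base Y\<^esub> Top (\<sigma> (Dom (Total X) s)))"
      using st h(2) M_Top[of s] by (simp add: Y.B.Comp_assoc_Arr)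
    also have "\<dots> = Top (\<sigma> (Cod (Total X) t)) \<cdot>\<^bsub>Base Y\<^esub> Top (AM (Compr Y) (M (t \<cdot>\<^bsub>Total X\<^esub> s)))"
      using st h(2) M_Top[of "t \<cdot>\<^bsub>Total X\<^esub> s"]
      by (simp add: X.chi.AM_Comp_Arr F.AM_Comp_Arr Y.B.Comp_assoc_Arr)
    finally have top: "Top (\<sigma> (Cod (Total X) t)) \<cdot>\<^bsub>Base Y\<^esub>
        (Top (AM (Compr Y) (M t)) \<cdot>\<^bsub>Base Y\<^esub> Top (AM (Compr Y) (M s)))
        = Top (\<sigma> (Cod (Total X) t)) \<cdot>\<^bsub>Base Y\<^esub> Top (AM (Compr Y) (M (t \<cdot>\<^bsub>Total X\<^esub> s)))" .
    show "AM \<lparr> OM = h, AM = M \<rparr> (t \<cdot>\<^bsub>Total X\<^esub> s)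
        = AM \<lparr> OM = h, AM = M \<rparr> t \<cdot>\<^bsub>Total Y\<^esub> AM \<lparr> OM = h, AM = M \<rparr> s"
      by (rule Y.full_cancel[OF Y(2), of _ _ "\<sigma> (Cod (Total X) t)"])
        (use st h(2) top in \<open>auto simp: Y.chi.AM_Comp_Arr X.chi.AM_Comp_Arr F.AM_Comp_Arr\<close>)
  qed (use h M_ext in \<open>auto simp: X.T.category_axioms Y.T.category_axioms\<close>)
  moreover have "cartesian (Total Y) (Base Y) (Proj Y) (M s)"
    if s: "cartesian (Total X) (Base X) (Proj X) s" for s
  proof -
    note [simp del] = arrow_cat_simps(5) arrow_ftor_simps(2)
    have s' [simp]: "s \<in> Arr (Total X)" using s by (rule X.p.cartesian_Arr)
    let ?\<sigma> = "\<sigma> (Cod (Total X) s)"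
    obtain c where c: "c \<in> Arr ?A" "Lft c = Rgt ?\<sigma>" "Rgt c = Lft ?\<sigma>" "iso_arrow ?A c"
      "c \<cdot>\<^bsub>?A\<^esub> ?\<sigma> = Ident ?A (Lft ?\<sigma>)"
      using \<sigma>_simps(1)[OF X.T.Cod_Obj[OF s']]
      by (metis Y.A.iso_arrowE arrow_cat_simps(2,3))
    have r: "?F s \<in> Arr ?A" "Lft (?F s) = AM F (OM (Compr X) (Dom (Total X) s))"
      "Rgt (?F s) = AM F (OM (Compr X) (Cod (Total X) s))"
      using AF.AM_simps[of "AM (Compr X) s"] by auto
    have "AM (Compr Y) (M s) = c \<cdot>\<^bsub>?A\<^esub> ?\<sigma> \<cdot>\<^bsub>?A\<^esub> AM (Compr Y) (M s)"
      unfolding c(5) by (rule Y.A.Comp_Ident_left[symmetric]) (use s' h(2) in auto)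
    also have "\<dots> = c \<cdot>\<^bsub>?A\<^esub> (?\<sigma> \<cdot>\<^bsub>?A\<^esub> AM (Compr Y) (M s))"
      by (rule Y.A.Comp_assoc_Arr) (use c s' h(2) in auto)
    finally have eq: "AM (Compr Y) (M s) = c \<cdot>\<^bsub>?A\<^esub> (?F s \<cdot>\<^bsub>?A\<^esub> \<sigma> (Dom (Total X) s))"
      by (simp add: M_sq)
    \<comment> \<open>The cartesian square provided by \<open>cart\<close> is composed with
      isomorphisms on both sides; fullness of \<open>Y\<close> then reflects the result to
      \<open>Total Y\<close>.\<close>
    have "cartesian ?A (Base Y) (cod_ftor (Base Y)) (AM (Compr Y) (M s))"
      unfolding eq
      by (intro Y.cod.cartesian_Comp Y.cod.cartesian_iso cart s)
        (use c r in \<open>auto simp: arrow_cat_simps(5)\<close>)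
    then show ?thesis by (simp add: Y.cartesian_iff_full[OF Y(2)])
  qed
  ultimately have "pseudo_map X Y P"
    by (intro pseudo_mapI) (use assms(1,2) F \<sigma> M_Top in \<open>auto simp: P_def\<close>)
  then show ?thesis by (rule that) (auto simp: P_def)
qed


section \<open>Comparing maps between different total categories\<close>

text \<open>
  Cores collect the data which determine 1-cells and 2-cells into a full comprehension category;
  they depend on the comprehension categories involved only through the skeletons of the latter.
  Replacing the total categories while keeping the skeletons thus transports 1-cells and 2-cells
  (\<open>recast\<close>). The action of the left adjoint on 1-cells and 2-cells and the isomorphisms of
  hom-categories are all of this form, so every required equation reduces to one between cores.
\<close>

definition skel :: "'u compcat \<Rightarrow> ('u, 'u) cat \<times> 'u set \<times> ('u \<Rightarrow> 'u)" where
  "skel X = (Base X, Obj (Total X), OM (Compr X))"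

definition pcore :: "'u pmap \<Rightarrow> ('u, 'u, 'u, 'u) ftor \<times> ('u \<Rightarrow> 'u) \<times> ('u \<Rightarrow> 'u square)" where
  "pcore P = (BaseF P, OM (TotF P), Cmp P)"

definition tcore where
  "tcore t = (pcore (Src t), pcore (Tgt t), BaseT t)"

lemma pcore_pmap_id: "skel X = skel X' \<Longrightarrow> pcore (pmap_id X) = pcore (pmap_id X')"
  by (simp add: skel_def pcore_def pmap_id_def id_ftor_def)

lemma pcore_pmap_comp:
  assumes "skel X = skel X'" "skel Y = skel Y'" "skel Z = skel Z'"
    and "pcore P = pcore P'" "pcore Q = pcore Q'"
  shows "pcore (pmap_comp X Y Z Q P) = pcore (pmap_comp X' Y' Z' Q' P')"
  using assms by (simp add: skel_def pcore_def pmap_comp_def fcomp_def)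

lemma tcore_trafo_id:
  "\<lbrakk>skel X = skel X'; skel Y = skel Y'; pcore P = pcore P'\<rbrakk>
    \<Longrightarrow> tcore (trafo_id X Y P) = tcore (trafo_id X' Y' P')"
  by (simp add: skel_def pcore_def tcore_def)

lemma tcore_trafo_vcomp:
  "\<lbrakk>skel X = skel X'; skel Y = skel Y'; tcore t = tcore t'; tcore u = tcore u'\<rbrakk>
    \<Longrightarrow> tcore (trafo_vcomp X Y u t) = tcore (trafo_vcomp X' Y' u' t')"
  by (simp add: skel_def tcore_def)

lemma tcore_trafo_hcomp:
  assumes "skel X = skel X'" "skel Y = skel Y'" "skel Z = skel Z'"
    and "tcore t = tcore t'" "tcore u = tcore u'"
  shows "tcore (trafo_hcomp X Y Z u t) = tcore (trafo_hcomp X' Y' Z' u' t')"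
  using assms pcore_pmap_comp[OF assms(1-3), of "Src t" "Src t'" "Src u" "Src u'"]
    pcore_pmap_comp[OF assms(1-3), of "Tgt t" "Tgt t'" "Tgt u" "Tgt u'"]
  by (simp add: tcore_def) (simp add: skel_def pcore_def)

lemma pseudo_map_eq_core:
  "\<lbrakk>pseudo_map X Y P; pseudo_map X Y Q; full_compcat Y; pcore P = pcore Q\<rbrakk> \<Longrightarrow> P = Q"
  by (auto simp: pcore_def intro: pseudo_map_eq_full)

lemma trafo_eq_core:
  assumes "transformation X Y t" "transformation X Y u" "full_compcat Y" "tcore t = tcore u"
  shows "t = u"
  using assms by (intro trafo_eq_full[OF assms(1-3)] pseudo_map_eq_core[of X Y])
    (auto simp: tcore_def transformation_Src transformation_Tgt)

text \<open>Fullness is asked of the new target, where arrows have to be produced from squares. The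
  old target stays arbitrary because the left adjoint starts from cells between arbitrary
  comprehension categories.\<close>

definition recastable :: "'u compcat \<Rightarrow> 'u compcat \<Rightarrow> 'u compcat \<Rightarrow> 'u compcat \<Rightarrow> bool" where
  "recastable X Y X' Y' \<longleftrightarrow> comprehension_category X \<and> comprehension_category Y \<and>
     comprehension_category X' \<and> comprehension_category Y' \<and>
     skel X = skel X' \<and> skel Y = skel Y' \<and> full_compcat Y'"

text \<open>The core data carry over verbatim. The point is that \<open>BaseF P\<close> must respect
  the pullback squares of \<open>X'\<close>, while its behaviour is given only on those of
  \<open>X\<close>.\<close>

lemma pseudo_map_core_exists:
  assumes r: "recastable X Y X' Y'" and P: "pseudo_map X Y P"
  obtains P' where "pseudo_map X' Y' P'" "pcore P' = pcore P"
proof -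
  interpret P: pseudo_map X Y P by fact
  interpret X': comprehension_category X' using r by (simp add: recastable_def)
  interpret Y': comprehension_category Y' using r by (simp add: recastable_def)
  have [simp]: "Base X' = Base X" "Obj (Total X') = Obj (Total X)" "OM (Compr X') = OM (Compr X)"
    "Base Y' = Base Y" "Obj (Total Y') = Obj (Total Y)" "OM (Compr Y') = OM (Compr Y)"
    using r by (auto simp: recastable_def skel_def)
  have cart: "cartesian (arrow_cat (Base Y)) (Base Y) (cod_ftor (Base Y))
      (AM (arrow_ftor (Base X) (BaseF P)) (AM (Compr X') s))"
    if s: "cartesian (Total X') (Base X') (Proj X') s" for s
  proof -
    note [simp del] = arrow_cat_simps(5) arrow_ftor_simps(2)
    have s' [simp]: "s \<in> Arr (Total X')" using s by (rule X'.p.cartesian_Arr)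
    have sX: "Rgt (AM (Compr X') s) = OM (Compr X) (Cod (Total X') s)"
      "Bot (AM (Compr X') s) \<in> Arr (Base X)"
      "Cod (Base X) (Bot (AM (Compr X') s)) = Cod (Base X) (OM (Compr X) (Cod (Total X') s))"
      "Cod (Total X') s \<in> Obj (Total X)" "AM (Compr X') s \<in> Arr (arrow_cat (Base X))"
      using X'.Compr_Arr[OF s'] X'.T.Cod_Obj[OF s'] X'.chi.AM_simps(1)[OF s'] by simp_all
    \<comment> \<open>The arrow \<open>s\<close> of \<open>X'\<close> may have no counterpart in
      \<open>X\<close>. A cartesian lift in \<open>X\<close> with the same codomain and bottom has a
      comprehension that differs from that of \<open>s\<close> by an isomorphism, and any functor
      preserves isomorphisms.\<close>
    obtain s1 where s1: "cartesian (Total X) (Base X) (Proj X) s1" "s1 \<in> Arr (Total X)"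
      "Cod (Total X) s1 = Cod (Total X') s" "Bot (AM (Compr X) s1) = Bot (AM (Compr X') s)"
      using P.X.cartesian_lift[OF sX(4,2,3)] .
    obtain v where v: "iso_arrow (arrow_cat (Base X)) v"
      "Rgt v = Lft (AM (Compr X) s1)" "AM (Compr X) s1 \<cdot>\<^bsub>arrow_cat (Base X)\<^esub> v = AM (Compr X') s"
      by (rule P.X.cod.cartesian_comparison[OF P.X.cartesian_Compr[OF s1(1)]
            X'.cartesian_Compr[OF s, simplified]])
        (use s1 sX in auto)
    have v_Arr: "v \<in> Arr (arrow_cat (Base X))" using v(1) by (simp add: iso_arrow_def)
    have "AM (arrow_ftor (Base X) (BaseF P)) (AM (Compr X') s)
        = AM (arrow_ftor (Base X) (BaseF P)) (AM (Compr X) s1) \<cdot>\<^bsub>arrow_cat (Base Y)\<^esub>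
          AM (arrow_ftor (Base X) (BaseF P)) v"
      unfolding v(3)[symmetric] by (rule P.AF.AM_Comp_Arr) (use v v_Arr s1 in auto)
    moreover have "cartesian (arrow_cat (Base Y)) (Base Y) (cod_ftor (Base Y)) \<dots>"
      by (rule P.Y.cod.cartesian_Comp[OF
            P.Y.cod.cartesian_iso[OF P.AF.iso_arrow_AM[OF v(1)]] P.cartesian_arrow_ftor[OF s1(1)]])
        (use v v_Arr s1 in \<open>auto simp: arrow_ftor_simps(2)\<close>)
    ultimately show ?thesis by simp
  qed
  obtain P' where "pseudo_map X' Y' P'" "BaseF P' = BaseF P" "OM (TotF P') = OM (TotF P)"
    "Cmp P' = Cmp P"
    by (rule pseudo_map_exists_full[of X' Y' "BaseF P" "OM (TotF P)" "Cmp P"])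
      (use r cart P.Cmp_ext P.Fb.OM_ext in
        \<open>auto simp: recastable_def P.BaseF P.Cmp_square simp del: arrow_ftor_simps(2)\<close>)
  then show ?thesis by (intro that[of P']) (auto simp: pcore_def)
qed

lemma transformation_core_exists:
  assumes r: "recastable X Y X' Y'" and t: "transformation X Y t"
  obtains t' where "transformation X' Y' t'" "tcore t' = tcore t"
proof -
  interpret t: transformation X Y t by fact
  obtain P where P: "pseudo_map X' Y' P" "pcore P = pcore (Src t)"
    using pseudo_map_core_exists[OF r transformation_Src[OF t]] .
  obtain Q where Q: "pseudo_map X' Y' Q" "pcore Q = pcore (Tgt t)"
    using pseudo_map_core_exists[OF r transformation_Tgt[OF t]] .
  have "nat_trans (Base X') (Base Y') (BaseF P) (BaseF Q) (BaseT t)"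
    using t.BaseT P Q r by (simp add: recastable_def skel_def pcore_def)
  then obtain t' where "transformation X' Y' t'" "Src t' = P" "Tgt t' = Q" "BaseT t' = BaseT t"
    using transformation_exists_full[OF P(1) Q(1)] r by (metis recastable_def)
  then show ?thesis using P Q by (intro that[of t']) (auto simp: tcore_def)
qed

text \<open>The descriptions are proper because a cell into a full comprehension category is
  determined by its core.\<close>

definition recast :: "'u compcat \<Rightarrow> 'u compcat \<Rightarrow> 'u compcat \<Rightarrow> 'u compcat
    \<Rightarrow> ('u pmap, 'u trafo, 'u pmap, 'u trafo) ftor" where
  "recast X Y X' Y' = \<lparr>
     OM = (\<lambda>P \<in> Obj (pmap_cat X Y). THE P'. pseudo_map X' Y' P' \<and> pcore P' = pcore P),
     AM = (\<lambda>t \<in> Arr (pmap_cat X Y). THE t'. transformation X' Y' t' \<and> tcore t' = tcore t) \<rparr>"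

lemma recast_OM:
  assumes "recastable X Y X' Y'" "pseudo_map X Y P"
  shows "pseudo_map X' Y' (OM (recast X Y X' Y') P)" "pcore (OM (recast X Y X' Y') P) = pcore P"
proof -
  have "full_compcat Y'" using assms(1) by (simp add: recastable_def)
  then have "\<exists>!P'. pseudo_map X' Y' P' \<and> pcore P' = pcore P"
    using pseudo_map_core_exists[OF assms] pseudo_map_eq_core by metis
  then have "pseudo_map X' Y' (OM (recast X Y X' Y') P) \<and> pcore (OM (recast X Y X' Y') P) = pcore P"
    unfolding recast_def using assms(2) by simp (rule theI')
  then show "pseudo_map X' Y' (OM (recast X Y X' Y') P)" "pcore (OM (recast X Y X' Y') P) = pcore P"
    by auto
qed

lemma recast_AM:
  assumes "recastable X Y X' Y'" "transformation X Y t"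
  shows "transformation X' Y' (AM (recast X Y X' Y') t)" "tcore (AM (recast X Y X' Y') t) = tcore t"
proof -
  have "full_compcat Y'" using assms(1) by (simp add: recastable_def)
  then have "\<exists>!t'. transformation X' Y' t' \<and> tcore t' = tcore t"
    using transformation_core_exists[OF assms] trafo_eq_core by metis
  then have "transformation X' Y' (AM (recast X Y X' Y') t) \<and> tcore (AM (recast X Y X' Y') t) = tcore t"
    unfolding recast_def using assms(2) by simp (rule theI')
  then show "transformation X' Y' (AM (recast X Y X' Y') t)" "tcore (AM (recast X Y X' Y') t) = tcore t"
    by auto
qed

text \<open>Recasting keeps cores and the operations on cells respect them, so each functor law is
  an equation between cells with equal cores into a full target.\<close>

lemma cat_functor_recast:
  assumes r: "recastable X Y X' Y'"
  shows "cat_functor (pmap_cat X Y) (pmap_cat X' Y') (recast X Y X' Y')"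
proof -
  note OM = recast_OM[OF r] and AM = recast_AM[OF r]
  have full: "full_compcat Y'" and skel: "skel X' = skel X" "skel Y' = skel Y"
    using r by (auto simp: recastable_def)
  have "OM (recast X Y X' Y') \<in> extensional (Obj (pmap_cat X Y))"
    "AM (recast X Y X' Y') \<in> extensional (Arr (pmap_cat X Y))"
    by (auto simp: recast_def)
  then show ?thesis
  proof (rule cat_functorI[rotated 2])
    fix t assume "t \<in> Arr (pmap_cat X Y)"
    then have t: "transformation X Y t" by simp
    note t' = transformation_Src[OF t] transformation_Tgt[OF t]
    have "Src (AM (recast X Y X' Y') t) = OM (recast X Y X' Y') (Src t)"
      "Tgt (AM (recast X Y X' Y') t) = OM (recast X Y X' Y') (Tgt t)"
      using OM[OF t'(1)] OM[OF t'(2)] AM[OF t]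
      by (auto intro!: pseudo_map_eq_core[OF _ _ full] transformation_Src transformation_Tgt
          simp: tcore_def)
    then show "AM (recast X Y X' Y') t \<in> Arr (pmap_cat X' Y') \<and>
        Dom (pmap_cat X' Y') (AM (recast X Y X' Y') t)
          = OM (recast X Y X' Y') (Dom (pmap_cat X Y) t) \<and>
        Cod (pmap_cat X' Y') (AM (recast X Y X' Y') t)
          = OM (recast X Y X' Y') (Cod (pmap_cat X Y) t)"
      using AM[OF t] by simp
  next
    fix P assume "P \<in> Obj (pmap_cat X Y)"
    then have P: "pseudo_map X Y P" by simp
    show "AM (recast X Y X' Y') (Ident (pmap_cat X Y) P)
        = Ident (pmap_cat X' Y') (OM (recast X Y X' Y') P)"
      using OM[OF P] AM[OF transformation_trafo_id[OF P]]
      by (auto intro!: trafo_eq_core[OF _ _ full] transformation_trafo_id tcore_trafo_id skel[symmetric])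
  next
    fix t u assume "t \<in> Arr (pmap_cat X Y)" "u \<in> Arr (pmap_cat X Y)"
      "Dom (pmap_cat X Y) u = Cod (pmap_cat X Y) t"
    then have t: "transformation X Y t" and u: "transformation X Y u" and tu: "Src u = Tgt t"
      by auto
    have "Src (AM (recast X Y X' Y') u) = Tgt (AM (recast X Y X' Y') t)"
      using AM[OF t] AM[OF u] tu
      by (auto intro!: pseudo_map_eq_core[OF _ _ full] transformation_Src transformation_Tgt
          simp: tcore_def)
    then show "AM (recast X Y X' Y') (u \<cdot>\<^bsub>pmap_cat X Y\<^esub> t)
        = AM (recast X Y X' Y') u \<cdot>\<^bsub>pmap_cat X' Y'\<^esub> AM (recast X Y X' Y') t"
      using AM[OF t] AM[OF u] AM[OF transformation_trafo_vcomp[OF t u tu]]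
      by (auto intro!: trafo_eq_core[OF _ _ full] transformation_trafo_vcomp tcore_trafo_vcomp
          skel[symmetric])
  qed (auto simp: category_pmap_cat OM(1))
qed

text \<open>Recasting back keeps cores as well, so it is inverse once the old target is also
  full.\<close>

lemma cat_isomorphism_recast:
  assumes r: "recastable X Y X' Y'" and "full_compcat Y"
  shows "cat_isomorphism (pmap_cat X Y) (pmap_cat X' Y') (recast X Y X' Y')"
proof -
  have r': "recastable X' Y' X Y" using assms by (simp add: recastable_def)
  have inverse: "fcomp (pmap_cat X Y) (recast X' Y' X Y) (recast X Y X' Y') = id_ftor (pmap_cat X Y)"
    if r: "recastable X Y X' Y'" and r': "recastable X' Y' X Y" for X Y X' Y' :: "'u compcat"
  proof (rule ftor_eqI)
    show "cat_functor (pmap_cat X Y) (pmap_cat X Y) (fcomp (pmap_cat X Y) (recast X' Y' X Y) (recast X Y X' Y'))"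
      by (rule cat_functor_fcomp[OF cat_functor_recast[OF r] cat_functor_recast[OF r']])
    show "cat_functor (pmap_cat X Y) (pmap_cat X Y) (id_ftor (pmap_cat X Y))"
      by (rule cat_functor_id_ftor) (rule category_pmap_cat)
    have full: "full_compcat Y" using r' by (simp add: recastable_def)
    fix P assume P: "P \<in> Obj (pmap_cat X Y)"
    then show "OM (fcomp (pmap_cat X Y) (recast X' Y' X Y) (recast X Y X' Y')) P
        = OM (id_ftor (pmap_cat X Y)) P"
      using recast_OM[OF r, of P] recast_OM[OF r', of "OM (recast X Y X' Y') P"]
      by (auto intro: pseudo_map_eq_core[OF _ _ full])
  next
    have full: "full_compcat Y" using r' by (simp add: recastable_def)
    fix t assume "t \<in> Arr (pmap_cat X Y)"
    then show "AM (fcomp (pmap_cat X Y) (recast X' Y' X Y) (recast X Y X' Y')) t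
        = AM (id_ftor (pmap_cat X Y)) t"
      using recast_AM[OF r, of t] recast_AM[OF r', of "AM (recast X Y X' Y') t"]
      by (auto intro: trafo_eq_core[OF _ _ full])
  qed
  show ?thesis
    unfolding cat_isomorphism_def
    by (intro conjI exI[of _ "recast X' Y' X Y"] cat_functor_recast inverse r r')
qed


section \<open>Comprehension categories from classes of arrows\<close>

text \<open>
  Objects of the new total category are labels \<open>A\<close> of arrows \<open>m A\<close>, and its arrows are all
  squares between these, coded as elements of the ambient type.
\<close>

definition code :: "'u \<times> 'u \<times> 'u \<times> 'u \<Rightarrow> 'u" where
  "code = (SOME c. inj c)"

text \<open>An infinite type is equinumerous with its square; nesting the resulting pairing three
  times codes quadruples.\<close>

lemma inj_code:
  assumes "infinite (UNIV :: 'u set)"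
  shows "inj (code :: 'u \<times> 'u \<times> 'u \<times> 'u \<Rightarrow> 'u)"
proof -
  obtain p :: "'u \<times> 'u \<Rightarrow> 'u" where p: "inj p"
    using card_of_Times_same_infinite[OF assms] by (auto simp: card_of_ordIso[symmetric] bij_betw_def)
  have "inj (\<lambda>(a, b, c, d). p (a, p (b, p (c, d))))"
    by (auto intro!: injI simp: inj_eq[OF p])
  then show ?thesis unfolding code_def by (rule someI[of inj])
qed

definition code_src :: "'u \<Rightarrow> 'u" where
  "code_src a = (case inv code a of (A, B, t, b) \<Rightarrow> A)"

definition code_tgt :: "'u \<Rightarrow> 'u" where
  "code_tgt a = (case inv code a of (A, B, t, b) \<Rightarrow> B)"

definition code_square :: "('u \<Rightarrow> 'u) \<Rightarrow> 'u \<Rightarrow> 'u square" where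
  "code_square m a = (case inv code a of (A, B, t, b) \<Rightarrow>
     \<lparr> Lft = m A, Rgt = m B, Top = t, Bot = b \<rparr>)"

text \<open>Source and target labels are recorded rather than the sides of the square: labels
  determine the sides through \<open>m\<close>, whereas \<open>m\<close> may identify labels and
  hom-sets must stay disjoint.\<close>

definition encode :: "'u \<Rightarrow> 'u \<Rightarrow> 'u square \<Rightarrow> 'u" where
  "encode A B s = code (A, B, Top s, Bot s)"

text \<open>Membership in \<open>range code\<close> guards against \<open>inv code\<close>, whose
  values elsewhere are arbitrary: each labelled square gets exactly one code.\<close>

definition coded :: "('u, 'u) cat \<Rightarrow> 'u set \<Rightarrow> ('u \<Rightarrow> 'u) \<Rightarrow> 'u set" where
  "coded C S m = {a \<in> range code. code_src a \<in> S \<and> code_tgt a \<in> S \<and>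
     code_square m a \<in> Arr (arrow_cat C)}"

text \<open>Every operation is \<open>undefined\<close> outside its carrier, as
  \<open>ext_category\<close> requires of a total category.\<close>

definition squares_cat :: "('u, 'u) cat \<Rightarrow> 'u set \<Rightarrow> ('u \<Rightarrow> 'u) \<Rightarrow> ('u, 'u) cat" where
  "squares_cat C S m = \<lparr>
     Obj = S,
     Arr = coded C S m,
     Dom = restrict code_src (coded C S m),
     Cod = restrict code_tgt (coded C S m),
     Ident = (\<lambda>A \<in> S. encode A A (Ident (arrow_cat C) (m A))),
     Comp = (\<lambda>b a. if a \<in> coded C S m \<and> b \<in> coded C S m \<and> code_src b = code_tgt a
       then encode (code_src a) (code_tgt b) (code_square m b \<cdot>\<^bsub>arrow_cat C\<^esub> code_square m a)
       else undefined) \<rparr>"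

definition squares_ftor :: "('u, 'u) cat \<Rightarrow> 'u set \<Rightarrow> ('u \<Rightarrow> 'u) \<Rightarrow> ('u, 'u, 'u, 'u square) ftor" where
  "squares_ftor C S m = \<lparr> OM = restrict m S, AM = restrict (code_square m) (coded C S m) \<rparr>"

definition squares_compcat :: "('u, 'u) cat \<Rightarrow> 'u set \<Rightarrow> ('u \<Rightarrow> 'u) \<Rightarrow> 'u compcat" where
  "squares_compcat C S m = \<lparr>
     Base = C,
     Total = squares_cat C S m,
     Proj = fcomp (squares_cat C S m) (cod_ftor C) (squares_ftor C S m),
     Compr = squares_ftor C S m \<rparr>"

text \<open>The closure condition is what makes the new projection a fibration: some pullback of
  each arrow of the class along each base arrow has its left side in the class again, without any
  coherent choice.\<close>

locale arrow_class =
  fixes C :: "('u, 'u) cat" and S :: "'u set" and m :: "'u \<Rightarrow> 'u"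
  assumes infinite: "infinite (UNIV :: 'u set)"
    and ext: "ext_category C"
    and m_Arr [simp]: "A \<in> S \<Longrightarrow> m A \<in> Arr C"
    and pullbacks: "\<lbrakk>A \<in> S; f \<in> Arr C; Cod C f = Cod C (m A)\<rbrakk> \<Longrightarrow>
      \<exists>B s. B \<in> S \<and> cartesian (arrow_cat C) C (cod_ftor C) s \<and> Lft s = m B \<and> Rgt s = m A \<and> Bot s = f"
begin

sublocale C: category C using ext by (simp add: ext_category_def)
sublocale A: category "arrow_cat C" by (rule category_arrow_cat) (rule C.category_axioms)
sublocale cod: cat_functor "arrow_cat C" C "cod_ftor C"
  by (rule cat_functor_cod_ftor) (rule C.category_axioms)

lemma encode [simp]:
  assumes "A \<in> S" "B \<in> S" "s \<in> Arr (arrow_cat C)" "Lft s = m A" "Rgt s = m B"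
  shows "encode A B s \<in> coded C S m" "code_src (encode A B s) = A" "code_tgt (encode A B s) = B"
    "code_square m (encode A B s) = s"
proof -
  have [simp]: "\<lparr> Lft = m A, Rgt = m B, Top = Top s, Bot = Bot s \<rparr> = s"
    using assms(4,5) by (simp add: square_eq_iff)
  show "encode A B s \<in> coded C S m" "code_src (encode A B s) = A" "code_tgt (encode A B s) = B"
    "code_square m (encode A B s) = s"
    using assms inj_code[OF infinite]
    by (auto simp: encode_def coded_def code_src_def code_tgt_def code_square_def)
qed

lemma coded [simp]:
  assumes "a \<in> coded C S m"
  shows "code_src a \<in> S" "code_tgt a \<in> S" "code_square m a \<in> Arr (arrow_cat C)"
    "Lft (code_square m a) = m (code_src a)" "Rgt (code_square m a) = m (code_tgt a)"
  using assms by (auto simp: coded_def code_src_def code_tgt_def code_square_def split: prod.splits)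

lemma coded_eqI:
  assumes "a \<in> coded C S m" "b \<in> coded C S m" "code_src a = code_src b" "code_tgt a = code_tgt b"
    "code_square m a = code_square m b"
  shows "a = b"
proof -
  have "inv code a = inv code b"
    using assms(3-5) by (auto simp: code_src_def code_tgt_def code_square_def split: prod.splits)
  then show ?thesis
    using assms(1,2) by (metis (mono_tags, lifting) coded_def f_inv_into_f mem_Collect_eq)
qed

lemma coded_Comp:
  assumes "a \<in> coded C S m" "b \<in> coded C S m" "code_src b = code_tgt a"
  shows "code_square m b \<cdot>\<^bsub>arrow_cat C\<^esub> code_square m a \<in> Arr (arrow_cat C)"
  by (rule A.Comp_simps) (use assms in auto)

lemma squares_cat_simps [simp]:
  "Obj (squares_cat C S m) = S" "Arr (squares_cat C S m) = coded C S m"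
  "a \<in> coded C S m \<Longrightarrow> Dom (squares_cat C S m) a = code_src a"
  "a \<in> coded C S m \<Longrightarrow> Cod (squares_cat C S m) a = code_tgt a"
  "A \<in> S \<Longrightarrow> Ident (squares_cat C S m) A = encode A A (Ident (arrow_cat C) (m A))"
  "\<lbrakk>a \<in> coded C S m; b \<in> coded C S m; code_src b = code_tgt a\<rbrakk> \<Longrightarrow> b \<cdot>\<^bsub>squares_cat C S m\<^esub> a
    = encode (code_src a) (code_tgt b) (code_square m b \<cdot>\<^bsub>arrow_cat C\<^esub> code_square m a)"
  by (simp_all add: squares_cat_def)

lemma ext_category_squares_cat: "ext_category (squares_cat C S m)"
proof -
  note [simp del] = arrow_cat_simps(4,5)
  note [simp] = A.Ident_simps[unfolded arrow_cat_simps(1-3)] A.Comp_simps[unfolded arrow_cat_simps(2,3)]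
  have "category (squares_cat C S m)"
  proof (rule categoryI)
    fix f g h
    assume "f \<in> Arr (squares_cat C S m)" "g \<in> Arr (squares_cat C S m)" "h \<in> Arr (squares_cat C S m)"
      "Dom (squares_cat C S m) g = Cod (squares_cat C S m) f"
      "Dom (squares_cat C S m) h = Cod (squares_cat C S m) g"
    then show "h \<cdot>\<^bsub>squares_cat C S m\<^esub> g \<cdot>\<^bsub>squares_cat C S m\<^esub> f
        = h \<cdot>\<^bsub>squares_cat C S m\<^esub> (g \<cdot>\<^bsub>squares_cat C S m\<^esub> f)"
      using A.Comp_assoc_Arr[of "code_square m f" "code_square m g" "code_square m h"]
      by auto
  next
    fix f assume "f \<in> Arr (squares_cat C S m)"
    then have f: "f \<in> coded C S m" by simp
    have "f \<cdot>\<^bsub>squares_cat C S m\<^esub> Ident (squares_cat C S m) (Dom (squares_cat C S m) f) = f"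
      by (rule coded_eqI)
        (use f A.Comp_Ident_right[of "code_square m f" "m (code_src f)"] in auto)
    moreover have "Ident (squares_cat C S m) (Cod (squares_cat C S m) f) \<cdot>\<^bsub>squares_cat C S m\<^esub> f = f"
      by (rule coded_eqI)
        (use f A.Comp_Ident_left[of "code_square m f" "m (code_tgt f)"] in auto)
    ultimately show "f \<cdot>\<^bsub>squares_cat C S m\<^esub> Ident (squares_cat C S m) (Dom (squares_cat C S m) f) = f \<and>
        Ident (squares_cat C S m) (Cod (squares_cat C S m) f) \<cdot>\<^bsub>squares_cat C S m\<^esub> f = f" ..
  qed auto
  then show ?thesis by (auto simp: ext_category_def squares_cat_def)
qed

sublocale T: category "squares_cat C S m"
  using ext_category_squares_cat by (simp add: ext_category_def)

lemma squares_ftor_simps [simp]: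
  "A \<in> S \<Longrightarrow> OM (squares_ftor C S m) A = m A"
  "a \<in> coded C S m \<Longrightarrow> AM (squares_ftor C S m) a = code_square m a"
  by (simp_all add: squares_ftor_def)

lemma cat_functor_squares_ftor: "cat_functor (squares_cat C S m) (arrow_cat C) (squares_ftor C S m)"
proof (rule cat_functorI)
  fix A assume "A \<in> Obj (squares_cat C S m)"
  then show "AM (squares_ftor C S m) (Ident (squares_cat C S m) A)
      = Ident (arrow_cat C) (OM (squares_ftor C S m) A)"
    using encode[of A A "Ident (arrow_cat C) (m A)"] A.Ident_simps(1)[of "m A"] by simp
next
  fix f g
  assume "f \<in> Arr (squares_cat C S m)" "g \<in> Arr (squares_cat C S m)"
    "Dom (squares_cat C S m) g = Cod (squares_cat C S m) f"
  then show "AM (squares_ftor C S m) (g \<cdot>\<^bsub>squares_cat C S m\<^esub> f)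
      = AM (squares_ftor C S m) g \<cdot>\<^bsub>arrow_cat C\<^esub> AM (squares_ftor C S m) f"
    using coded_Comp[of f g] by simp
qed (auto simp: T.category_axioms A.category_axioms squares_ftor_def)

sublocale chi: cat_functor "squares_cat C S m" "arrow_cat C" "squares_ftor C S m"
  by (rule cat_functor_squares_ftor)
sublocale p: cat_functor "squares_cat C S m" C "fcomp (squares_cat C S m) (cod_ftor C) (squares_ftor C S m)"
  by (rule cat_functor_fcomp) unfold_locales

lemma full_ftor_squares_ftor: "full_ftor (squares_cat C S m) (arrow_cat C) (squares_ftor C S m)"
  unfolding full_ftor_def
proof (intro ballI)
  fix A B s
  assume "A \<in> Obj (squares_cat C S m)" "B \<in> Obj (squares_cat C S m)"
    "s \<in> homset (arrow_cat C) (OM (squares_ftor C S m) A) (OM (squares_ftor C S m) B)"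
  then show "\<exists>f \<in> homset (squares_cat C S m) A B. AM (squares_ftor C S m) f = s"
    using encode[of A B s] by (intro bexI[of _ "encode A B s"]) (auto simp: homset_def)
qed

lemma faithful_ftor_squares_ftor: "faithful_ftor (squares_cat C S m) (squares_ftor C S m)"
  by (auto simp: faithful_ftor_def inj_on_def homset_def intro: coded_eqI)

lemma cartesian_squares:
  assumes "a \<in> coded C S m" "cartesian (arrow_cat C) C (cod_ftor C) (code_square m a)"
  shows "cartesian (squares_cat C S m) C (fcomp (squares_cat C S m) (cod_ftor C) (squares_ftor C S m)) a"
  by (rule cartesian_reflect[OF chi.cat_functor_axioms full_ftor_squares_ftor
        faithful_ftor_squares_ftor cod.cat_functor_axioms]) (use assms in auto)

lemma cartesian_squares_lift:
  assumes "A \<in> S" "f \<in> Arr C" "Cod C f = Cod C (m A)"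
  obtains a where "a \<in> coded C S m" "code_tgt a = A" "Bot (code_square m a) = f"
    "cartesian (arrow_cat C) C (cod_ftor C) (code_square m a)"
proof -
  obtain B s where s: "B \<in> S" "cartesian (arrow_cat C) C (cod_ftor C) s" "Lft s = m B" "Rgt s = m A"
    "Bot s = f" using pullbacks[OF assms] by auto
  with encode[OF s(1) assms(1) cod.cartesian_Arr[OF s(2)]] show ?thesis
    by (intro that[of "encode B A s"]) auto
qed

lemma comprehension_category_squares: "comprehension_category (squares_compcat C S m)"
proof (rule comprehension_category.intro; simp add: squares_compcat_def)
  show "ext_category C" "ext_category (squares_cat C S m)"
    by (fact ext ext_category_squares_cat)+
  show "cat_functor (squares_cat C S m) (arrow_cat C) (squares_ftor C S m)"
    by (rule cat_functor_squares_ftor)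
  let ?p = "fcomp (squares_cat C S m) (cod_ftor C) (squares_ftor C S m)"
  show "fibration (squares_cat C S m) C ?p"
    unfolding fibration_def
  proof (intro conjI ballI impI)
    show "cat_functor (squares_cat C S m) C ?p" by (rule p.cat_functor_axioms)
    fix A f assume "A \<in> Obj (squares_cat C S m)" "f \<in> Arr C" "Cod C f = OM ?p A"
    then obtain a where "a \<in> coded C S m" "code_tgt a = A" "Bot (code_square m a) = f"
      "cartesian (arrow_cat C) C (cod_ftor C) (code_square m a)"
      using cartesian_squares_lift[of A f] by auto
    then show "\<exists>s. cartesian (squares_cat C S m) C ?p s \<and> Cod (squares_cat C S m) s = A \<and> AM ?p s = f"
      using cartesian_squares by (intro exI[of _ a]) auto
  qed
  \<comment> \<open>Being cartesian here tests only squares whose left side lies in the class, so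
    \<open>a\<close> is not visibly a pullback. It is compared with a lift \<open>b\<close> that is
    one, and the two differ by an isomorphism.\<close>
  fix a assume a: "cartesian (squares_cat C S m) C ?p a"
  then have a_coded: "a \<in> coded C S m" using p.cartesian_Arr by simp
  have "code_square m a \<in> Arr (arrow_cat C)" using a_coded by simp
  then obtain b where b: "b \<in> coded C S m" "code_tgt b = code_tgt a"
    "Bot (code_square m b) = Bot (code_square m a)"
    "cartesian (arrow_cat C) C (cod_ftor C) (code_square m b)"
    using cartesian_squares_lift[of "code_tgt a" "Bot (code_square m a)"] a_coded
    by (auto simp: arrow_cat_Arr_iff)
  obtain v where v: "iso_arrow (squares_cat C S m) v" "Dom (squares_cat C S m) v = code_src a"
    "Cod (squares_cat C S m) v = code_src b" "b \<cdot>\<^bsub>squares_cat C S m\<^esub> v = a"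
    by (rule p.cartesian_comparison[OF cartesian_squares[OF b(1,4)] a]) (use b a_coded in auto)
  have v_coded: "v \<in> coded C S m" using v(1) by (simp add: iso_arrow_def)
  have "AM (squares_ftor C S m) a = code_square m b \<cdot>\<^bsub>arrow_cat C\<^esub> code_square m v"
    using chi.AM_Comp_Arr[of v b] v v_coded b by (auto simp del: arrow_cat_simps(5))
  moreover have "cartesian (arrow_cat C) C (cod_ftor C) \<dots>"
    by (rule cod.cartesian_Comp)
      (use b v v_coded chi.iso_arrow_AM[OF v(1)] in \<open>auto intro: cod.cartesian_iso\<close>)
  ultimately show "pullback_square C (AM (squares_ftor C S m) a)"
    by (simp only: pullback_square_iff_cartesian[OF C.category_axioms])
qed

lemma full_squares: "full_compcat (squares_compcat C S m)"
  using full_ftor_squares_ftor faithful_ftor_squares_ftor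
  by (simp add: full_compcat_def squares_compcat_def)

end


section \<open>Full image and repletion\<close>

definition full_image :: "'u compcat \<Rightarrow> 'u compcat" where
  "full_image X = squares_compcat (Base X) (Obj (Total X)) (OM (Compr X))"

definition iso_closure :: "'u compcat \<Rightarrow> 'u set" where
  "iso_closure X = {g \<in> Arr (Base X). \<exists>A \<in> Obj (Total X).
     isomorphic (arrow_cat (Base X)) (OM (Compr X) A) g}"

definition repletion :: "'u compcat \<Rightarrow> 'u compcat" where
  "repletion X = squares_compcat (Base X) (iso_closure X) (\<lambda>g. g)"

context comprehension_category
begin

lemma arrow_class_full_image:
  assumes "infinite (UNIV :: 'u set)"
  shows "arrow_class (Base X) (Obj (Total X)) (OM (Compr X))"
proof
  fix A f
  assume "A \<in> Obj (Total X)" "f \<in> Arr (Base X)" "Cod (Base X) f = Cod (Base X) (OM (Compr X) A)"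
  then obtain s where "cartesian (Total X) (Base X) (Proj X) s" "s \<in> Arr (Total X)"
    "Cod (Total X) s = A" "Bot (AM (Compr X) s) = f"
    by (rule cartesian_lift)
  then show "\<exists>B s. B \<in> Obj (Total X) \<and>
      cartesian (arrow_cat (Base X)) (Base X) (cod_ftor (Base X)) s \<and>
      Lft s = OM (Compr X) B \<and> Rgt s = OM (Compr X) A \<and> Bot s = f"
    using cartesian_Compr by (intro exI[of _ "Dom (Total X) s"] exI[of _ "AM (Compr X) s"]) auto
qed (use assms Base in auto)

lemma Compr_iso_closure [simp]:
  assumes "A \<in> Obj (Total X)"
  shows "OM (Compr X) A \<in> iso_closure X"
  using assms A.isomorphic_refl[of "OM (Compr X) A"] by (auto simp: iso_closure_def)

text \<open>Comparison squares must be identities on codomains, while the closure uses arbitrary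
  isomorphisms of arrows. Reindexing along the bottom of the inverse isomorphism absorbs the
  codomain part: that inverse and the lift are both cartesian over the same base arrow, hence
  vertically isomorphic.\<close>

lemma iso_closure_vertical:
  assumes "g \<in> iso_closure X"
  obtains A s where "A \<in> Obj (Total X)" "iso_arrow (arrow_cat (Base X)) s"
    "Lft s = OM (Compr X) A" "Rgt s = g" "Bot s = Ident (Base X) (Cod (Base X) g)"
proof -
  obtain A r where A: "A \<in> Obj (Total X)" and r: "iso_arrow (arrow_cat (Base X)) r"
    "Lft r = OM (Compr X) A" "Rgt r = g"
    using assms by (auto simp: iso_closure_def isomorphic_def homset_def)
  obtain r' where r': "r' \<in> Arr (arrow_cat (Base X))" "Lft r' = Rgt r" "Rgt r' = Lft r"
    "iso_arrow (arrow_cat (Base X)) r'" "r \<cdot>\<^bsub>arrow_cat (Base X)\<^esub> r' = Ident (arrow_cat (Base X)) (Rgt r)"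
    using r(1) by (metis A.iso_arrowE arrow_cat_simps(2,3))
  obtain s where s: "cartesian (Total X) (Base X) (Proj X) s" "s \<in> Arr (Total X)"
    "Cod (Total X) s = A" "Bot (AM (Compr X) s) = Bot r'"
    using cartesian_lift[OF A, of "Bot r'"] r r'(1-3) by (auto simp: arrow_cat_Arr_iff)
  obtain v where v: "iso_arrow (arrow_cat (Base X)) v" "Lft v = Lft (AM (Compr X) s)" "Rgt v = Lft r'"
    "AM (cod_ftor (Base X)) v = Ident (Base X) (OM (cod_ftor (Base X)) (Lft r'))"
    by (rule cod.cartesian_comparison[OF cod.cartesian_iso[OF r'(4)] cartesian_Compr[OF s(1)]])
      (use s r r' in auto)
  show ?thesis
    by (rule that[of "Dom (Total X) s" v])
      (use s v r r' in \<open>auto simp: iso_arrow_def[of "arrow_cat (Base X)"] arrow_cat_Arr_iff[of r']\<close>)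
qed

lemma arrow_class_repletion:
  assumes "infinite (UNIV :: 'u set)"
  shows "arrow_class (Base X) (iso_closure X) (\<lambda>g. g)"
proof
  fix g f
  assume g: "g \<in> iso_closure X" and f: "f \<in> Arr (Base X)" "Cod (Base X) f = Cod (Base X) g"
  obtain A v where v: "A \<in> Obj (Total X)" "iso_arrow (arrow_cat (Base X)) v"
    "Lft v = OM (Compr X) A" "Rgt v = g" "Bot v = Ident (Base X) (Cod (Base X) g)"
    using iso_closure_vertical[OF g] .
  have v_Arr: "v \<in> Arr (arrow_cat (Base X))" using v(2) by (simp add: iso_arrow_def)
  then have cod: "Cod (Base X) (OM (Compr X) A) = Cod (Base X) g"
    using v by (auto simp: arrow_cat_Arr_iff)
  obtain s where s: "cartesian (Total X) (Base X) (Proj X) s" "s \<in> Arr (Total X)"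
    "Cod (Total X) s = A" "Bot (AM (Compr X) s) = f"
    using cartesian_lift[OF v(1) f(1)] f(2) cod by auto
  \<comment> \<open>The comprehension isomorphic to \<open>g\<close> is reindexed in place of
    \<open>g\<close>, then followed by \<open>v\<close>. As \<open>v\<close> is vertical the bottom
    is still \<open>f\<close>, and the left side is a genuine comprehension.\<close>
  let ?s = "v \<cdot>\<^bsub>arrow_cat (Base X)\<^esub> AM (Compr X) s"
  have "cartesian (arrow_cat (Base X)) (Base X) (cod_ftor (Base X)) ?s"
    by (rule cod.cartesian_Comp[OF cartesian_Compr[OF s(1)] cod.cartesian_iso[OF v(2)]])
      (use v s in auto)
  moreover have "OM (Compr X) (Dom (Total X) s) \<in> iso_closure X"
    using s by simp
  ultimately show "\<exists>B s. B \<in> iso_closure X \<and>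
      cartesian (arrow_cat (Base X)) (Base X) (cod_ftor (Base X)) s \<and>
      Lft s = B \<and> Rgt s = g \<and> Bot s = f"
    by (intro exI[of _ "OM (Compr X) (Dom (Total X) s)"] exI[of _ ?s]) (use v s f in auto)
qed (use assms Base in \<open>auto simp: iso_closure_def\<close>)

text \<open>This is strict equality: the restriction in \<open>squares_ftor\<close> changes nothing,
  because \<open>OM (Compr X)\<close> is already extensional.\<close>

lemma skel_full_image: "skel (full_image X) = skel X"
  using chi.OM_ext
  by (simp add: skel_def full_image_def squares_compcat_def squares_cat_def squares_ftor_def
      extensional_restrict)

lemma replete_repletion:
  assumes "infinite (UNIV :: 'u set)"
  shows "replete (repletion X)"
proof -
  interpret R: arrow_class "Base X" "iso_closure X" "\<lambda>g. g"
    by (rule arrow_class_repletion) fact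
  have base: "Base (repletion X) = Base X"
    and image: "OM (Compr (repletion X)) ` Obj (Total (repletion X)) = iso_closure X"
    and inj: "inj_on (OM (Compr (repletion X))) (Obj (Total (repletion X)))"
    by (auto simp: repletion_def squares_compcat_def inj_on_def image_iff)
  have "subcategorical (repletion X)"
    using R.full_squares inj
    by (simp add: subcategorical_def full_compcat_def repletion_def[symmetric])
  moreover have "\<forall>f \<in> iso_closure X. \<forall>g \<in> Arr (Base X).
      isomorphic (arrow_cat (Base X)) f g \<longrightarrow> g \<in> iso_closure X"
    unfolding iso_closure_def by (blast intro: A.isomorphic_trans)
  ultimately show ?thesis
    unfolding replete_def image base arrow_cat_simps(1) ..
qed

text \<open>Both maps lie over the identity of the base, so \<open>isomorphic_full\<close> supplies
  the two isomorphisms, fullness being available on either side.\<close>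

lemma equivalent_repletion:
  assumes inf: "infinite (UNIV :: 'u set)" and full: "full_compcat X"
  obtains f g where "pseudo_map (repletion X) X f" "pseudo_map X (repletion X) g"
    "isomorphic (pmap_cat (repletion X) (repletion X)) (pmap_id (repletion X))
      (pmap_comp (repletion X) X (repletion X) g f)"
    "isomorphic (pmap_cat X X) (pmap_comp X (repletion X) X f g) (pmap_id X)"
proof -
  interpret R: arrow_class "Base X" "iso_closure X" "\<lambda>g. g"
    by (rule arrow_class_repletion) fact
  let ?R = "repletion X" and ?I = "id_ftor (Base X)"
  interpret R': comprehension_category ?R
    unfolding repletion_def by (rule R.comprehension_category_squares)
  have fullR: "full_compcat ?R" unfolding repletion_def by (rule R.full_squares)
  have [simp]: "Base ?R = Base X" "Obj (Total ?R) = iso_closure X"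
    "g \<in> iso_closure X \<Longrightarrow> OM (Compr ?R) g = g" for g
    by (simp_all add: repletion_def squares_compcat_def)
  have I: "cat_functor (Base X) (Base X) ?I" by (rule cat_functor_id_ftor) (rule category_Base)
  have AI: "AM (arrow_ftor (Base X) ?I) s = s" if "s \<in> Arr (arrow_cat (Base X))" for s
    using that by (simp add: arrow_cat_Arr_iff square_eq_iff)
  \<comment> \<open>Comparison for \<open>g\<close>: an object is sent to its own comprehension, so
    identity squares suffice.\<close>
  define c where "c = (\<lambda>A \<in> Obj (Total X). Ident (arrow_cat (Base X)) (OM (Compr X) A))"
  obtain g where g: "pseudo_map X ?R g" "BaseF g = ?I"
  proof (rule pseudo_map_exists_full[of X ?R ?I "OM (Compr X)" c])
    show "comprehension_category X" "comprehension_category ?R" by unfold_locales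
    show "OM (Compr X) \<in> extensional (Obj (Total X))" by (rule chi.OM_ext)
    show "c \<in> extensional (Obj (Total X))" by (simp add: c_def)
    show "iso_arrow (arrow_cat (Base ?R)) (c A) \<and> Lft (c A) = OM (Compr ?R) (OM (Compr X) A) \<and>
        Rgt (c A) = AM ?I (OM (Compr X) A) \<and>
        Bot (c A) = Ident (Base ?R) (OM ?I (Cod (Base X) (OM (Compr X) A)))"
      if "A \<in> Obj (Total X)" for A
      using that A.iso_arrow_Ident[of "OM (Compr X) A"] by (simp add: c_def)
    show "cartesian (arrow_cat (Base ?R)) (Base ?R) (cod_ftor (Base ?R))
        (AM (arrow_ftor (Base X) ?I) (AM (Compr X) s))"
      if "cartesian (Total X) (Base X) (Proj X) s" for s
      using cartesian_Compr[OF that] AI[OF chi.AM_simps(1)[OF p.cartesian_Arr[OF that]]] by simp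
  qed (use I fullR in auto)
  \<comment> \<open>For \<open>f\<close>, an arrow of the closure goes to a chosen object with a
    vertical isomorphism onto it. The membership condition stays inside the existentials so that
    choice yields total functions.\<close>
  have "\<exists>A s. g \<in> iso_closure X \<longrightarrow> A \<in> Obj (Total X) \<and> iso_arrow (arrow_cat (Base X)) s \<and>
      Lft s = OM (Compr X) A \<and> Rgt s = g \<and> Bot s = Ident (Base X) (Cod (Base X) g)" for g
    using iso_closure_vertical[of g] by metis
  then obtain h0 d0 where hd: "h0 g \<in> Obj (Total X) \<and> iso_arrow (arrow_cat (Base X)) (d0 g) \<and>
      Lft (d0 g) = OM (Compr X) (h0 g) \<and> Rgt (d0 g) = g \<and> Bot (d0 g) = Ident (Base X) (Cod (Base X) g)"
    if "g \<in> iso_closure X" for g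
    by metis
  obtain f where f: "pseudo_map ?R X f" "BaseF f = ?I"
  proof (rule pseudo_map_exists_full[of ?R X ?I "restrict h0 (iso_closure X)"
        "restrict d0 (iso_closure X)"])
    show "comprehension_category X" "comprehension_category ?R" by unfold_locales
    show "restrict h0 (iso_closure X) \<in> extensional (Obj (Total ?R))" by simp
    show "restrict d0 (iso_closure X) \<in> extensional (Obj (Total ?R))" by simp
    show "iso_arrow (arrow_cat (Base X)) (restrict d0 (iso_closure X) g) \<and>
        Lft (restrict d0 (iso_closure X) g) = OM (Compr X) (restrict h0 (iso_closure X) g) \<and>
        Rgt (restrict d0 (iso_closure X) g) = AM ?I (OM (Compr ?R) g) \<and>
        Bot (restrict d0 (iso_closure X) g)
          = Ident (Base X) (OM ?I (Cod (Base ?R) (OM (Compr ?R) g)))"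
      if "g \<in> Obj (Total ?R)" for g
      using that hd[of g] by simp
    show "cartesian (arrow_cat (Base X)) (Base X) (cod_ftor (Base X))
        (AM (arrow_ftor (Base ?R) ?I) (AM (Compr ?R) s))"
      if "cartesian (Total ?R) (Base ?R) (Proj ?R) s" for s
      using R'.cartesian_Compr[OF that] AI[of "AM (Compr ?R) s"]
        R'.chi.AM_simps(1)[OF R'.p.cartesian_Arr[OF that]] by simp
  qed (use I full hd in auto)
  have base: "BaseF (pmap_comp ?R X ?R g f) = ?I" "BaseF (pmap_comp X ?R X f g) = ?I"
    using f(2) g(2) fcomp_id_right[OF I] by auto
  show ?thesis
    by (rule that[OF f(1) g(1)])
      (use f g base full fullR in \<open>auto intro!: isomorphic_full pseudo_map_pmap_id pseudo_map_pmap_comp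
        R'.comprehension_category_axioms comprehension_category_axioms\<close>)
qed

end


section \<open>The inclusions\<close>

lemma full_sub2_simps [simp]:
  "Ob0 (full_sub2 K Q) = {a \<in> Ob0 K. Q a}" "HomCat (full_sub2 K Q) = HomCat K"
  "One (full_sub2 K Q) = One K" "HComp (full_sub2 K Q) = HComp K"
  by (simp_all add: full_sub2_def)

lemma two_category_full_sub2: "two_category K \<Longrightarrow> two_category (full_sub2 K Q)"
  by (simp add: two_category_def)

lemma two_functor_incl2:
  assumes K: "two_category K" and L: "two_category L" and "Ob0 K \<subseteq> Ob0 L"
    and "HomCat K = HomCat L" "One K = One L" "HComp K = HComp L"
  shows "two_functor K L (incl2 K)"
proof -
  interpret K: two_category K by fact
  interpret L: two_category L by fact
  show ?thesis
  proof (rule two_functor.intro[OF K L], rule two_functor_axioms.intro)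
    fix a b c f g assume "a \<in> Ob0 K" "b \<in> Ob0 K" "c \<in> Ob0 K" "f \<in> Obj (HomCat K a b)" "g \<in> Obj (HomCat K b c)"
    then show "OM (HomM (incl2 K) a c) (comp1 K a b c g f)
        = comp1 L (ObM (incl2 K) a) (ObM (incl2 K) b) (ObM (incl2 K) c)
            (OM (HomM (incl2 K) b c) g) (OM (HomM (incl2 K) a b) f)"
      using cat_functor.OM_in[OF K.HComp, of a b c "(g, f)"] assms(4-6) by (simp add: incl2_def)
  next
    fix a b c f g assume "a \<in> Ob0 K" "b \<in> Ob0 K" "c \<in> Ob0 K" "f \<in> Arr (HomCat K a b)" "g \<in> Arr (HomCat K b c)"
    then show "AM (HomM (incl2 K) a c) (comp2 K a b c g f)
        = comp2 L (ObM (incl2 K) a) (ObM (incl2 K) b) (ObM (incl2 K) c)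
            (AM (HomM (incl2 K) b c) g) (AM (HomM (incl2 K) a b) f)"
      using cat_functor.AM_simps(1)[OF K.HComp, of a b c "(g, f)"] assms(4-6) by (simp add: incl2_def)
  qed (use assms(3-6) K.HomCat K.One_in in \<open>auto simp: incl2_def cat_functor_id_ftor\<close>)
qed

text \<open>With equal hom-categories the inclusion is locally an identity functor, so only
  essential surjectivity remains.\<close>

lemma two_equivalence_incl2:
  assumes "two_functor K L (incl2 K)" "HomCat K = HomCat L"
    and "\<And>y. y \<in> Ob0 L \<Longrightarrow> \<exists>a \<in> Ob0 K. internally_equivalent L a y"
  shows "two_equivalence K L (incl2 K)"
proof -
  interpret two_functor K L "incl2 K" by fact
  show ?thesis
    unfolding two_equivalence_def
    using assms K.HomCat by (auto simp: incl2_def cat_equivalence_id_ftor)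
qed

lemma subcategorical_full: "subcategorical X \<Longrightarrow> full_compcat X"
  by (simp add: subcategorical_def full_compcat_def)

lemma replete_subcategorical: "replete X \<Longrightarrow> subcategorical X"
  by (simp add: replete_def)

text \<open>Hom-categories and compositions of a full sub-2-category are those of
  \<open>CompCat\<close>, so the equivalence lives in each one that contains both objects. Keeping
  \<open>Q\<close> abstract lets it be used for both inclusions.\<close>

lemma internally_equivalent_repletion:
  assumes inf: "infinite (UNIV :: 'u set)" and X: "comprehension_category (X :: 'u compcat)"
    and full: "full_compcat X" and Q: "Q X" "Q (repletion X)"
  shows "comprehension_category (repletion X)"
    and "internally_equivalent (full_sub2 CompCat Q) (repletion X) X"
proof -
  interpret comprehension_category X by fact
  obtain f g where fg: "pseudo_map (repletion X) X f" "pseudo_map X (repletion X) g"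
    "isomorphic (pmap_cat (repletion X) (repletion X)) (pmap_id (repletion X))
      (pmap_comp (repletion X) X (repletion X) g f)"
    "isomorphic (pmap_cat X X) (pmap_comp X (repletion X) X f g) (pmap_id X)"
    using equivalent_repletion[OF inf full] .
  show "comprehension_category (repletion X)" using fg(1) by (simp add: pseudo_map_def)
  show "internally_equivalent (full_sub2 CompCat Q) (repletion X) X"
    unfolding internally_equivalent_def
    by (intro bexI[of _ f] bexI[of _ g]) (use fg in auto)
qed

section \<open>The full image as left adjoint\<close>

lemma left_adjoint_full_image:
  assumes inf: "infinite (UNIV :: 'u set)"
  shows "has_left_two_adjoint (CompCat_full :: ('u compcat, 'u pmap, 'u trafo) twocat) CompCat
    (incl2 CompCat_full)"
proof -
  let ?K = "CompCat_full :: ('u compcat, 'u pmap, 'u trafo) twocat"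
  let ?L = "CompCat :: ('u compcat, 'u pmap, 'u trafo) twocat"
  let ?I = full_image
  let ?F = "\<lparr> ObM = full_image, HomM = \<lambda>X Y. recast X Y (?I X) (?I Y) \<rparr>
    :: ('u compcat, 'u pmap, 'u trafo, 'u compcat, 'u pmap, 'u trafo) twoftor"
  \<comment> \<open>Precomposition with the unit leaves cores unchanged, so it appears here as a
    recasting and the unit itself is never written down.\<close>
  let ?\<theta> = "\<lambda>X Y. recast (?I X) Y X Y"
  have K: "two_category ?K" and L: "two_category ?L"
    by (auto simp: CompCat_full_def intro: two_category_full_sub2 two_category_CompCat)
  have U: "two_functor ?K ?L (incl2 ?K)"
    by (rule two_functor_incl2[OF K L]) (auto simp: CompCat_full_def)
  have I: "comprehension_category (?I X)" "full_compcat (?I X)" "skel (?I X) = skel X"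
    if "comprehension_category X" for X :: "'u compcat"
    using arrow_class.comprehension_category_squares arrow_class.full_squares
      comprehension_category.arrow_class_full_image[OF that inf]
      comprehension_category.skel_full_image[OF that]
    unfolding full_image_def by blast+
  \<comment> \<open>The target \<open>Y\<close> is arbitrary here, since the new target
    \<open>?I Y\<close> is full; this gives the action of \<open>?F\<close> on cells.\<close>
  have r1: "recastable X Y (?I X) (?I Y)"
    if "comprehension_category X" "comprehension_category Y" for X Y :: "'u compcat"
    using that I by (simp add: recastable_def)
  have r2: "recastable (?I X) Y X Y"
    if "comprehension_category X" "comprehension_category Y" "full_compcat Y" for X Y :: "'u compcat"
    using that I by (simp add: recastable_def)
  note OM = recast_OM[OF r1] and AM = recast_AM[OF r1]
  have F: "two_functor ?L ?K ?F"
  proof (rule two_functor.intro[OF L K], rule two_functor_axioms.intro)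
    fix X :: "'u compcat" assume "X \<in> Ob0 ?L"
    then have X: "comprehension_category X" by simp
    note id = pseudo_map_pmap_id[OF X]
    show "OM (HomM ?F X X) (One ?L X) = One ?K (ObM ?F X)"
      by (simp add: CompCat_full_def)
        (rule pseudo_map_eq_core[OF OM(1)[OF X X id] pseudo_map_pmap_id[OF I(1)[OF X]] I(2)[OF X]],
          simp add: OM(2)[OF X X id] pcore_pmap_id[OF I(3)[OF X]])
  next
    fix X Y Z :: "'u compcat" and P Q
    assume "X \<in> Ob0 ?L" "Y \<in> Ob0 ?L" "Z \<in> Ob0 ?L" "P \<in> Obj (HomCat ?L X Y)" "Q \<in> Obj (HomCat ?L Y Z)"
    then have X: "comprehension_category X" and Y: "comprehension_category Y"
      and Z: "comprehension_category Z" and P: "pseudo_map X Y P" and Q: "pseudo_map Y Z Q"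
      by auto
    show "OM (HomM ?F X Z) (comp1 ?L X Y Z Q P)
        = comp1 ?K (ObM ?F X) (ObM ?F Y) (ObM ?F Z) (OM (HomM ?F Y Z) Q) (OM (HomM ?F X Y) P)"
      using OM[OF X Y P] OM[OF Y Z Q] OM[OF X Z pseudo_map_pmap_comp[OF P Q]] P Q
      by (auto simp: CompCat_full_def
          intro!: pseudo_map_eq_core[OF _ _ I(2)[OF Z]] pseudo_map_pmap_comp pcore_pmap_comp
            I(3)[OF X, symmetric] I(3)[OF Y, symmetric] I(3)[OF Z, symmetric])
  next
    fix X Y Z :: "'u compcat" and t u
    assume "X \<in> Ob0 ?L" "Y \<in> Ob0 ?L" "Z \<in> Ob0 ?L" "t \<in> Arr (HomCat ?L X Y)" "u \<in> Arr (HomCat ?L Y Z)"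
    then have X: "comprehension_category X" and Y: "comprehension_category Y"
      and Z: "comprehension_category Z" and t: "transformation X Y t" and u: "transformation Y Z u"
      by auto
    show "AM (HomM ?F X Z) (comp2 ?L X Y Z u t)
        = comp2 ?K (ObM ?F X) (ObM ?F Y) (ObM ?F Z) (AM (HomM ?F Y Z) u) (AM (HomM ?F X Y) t)"
      using AM[OF X Y t] AM[OF Y Z u] AM[OF X Z transformation_trafo_hcomp[OF t u]] t u
      by (auto simp: CompCat_full_def
          intro!: trafo_eq_core[OF _ _ I(2)[OF Z]] transformation_trafo_hcomp tcore_trafo_hcomp
            I(3)[OF X, symmetric] I(3)[OF Y, symmetric] I(3)[OF Z, symmetric])
  qed (auto simp: CompCat_full_def I r1 cat_functor_recast)
  have "two_adjunction ?K ?L ?F (incl2 ?K) ?\<theta>"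
  proof (rule two_adjunction.intro[OF F U], rule two_adjunction_axioms.intro)
    fix X Y :: "'u compcat" assume "X \<in> Ob0 ?L" "Y \<in> Ob0 ?K"
    then show "cat_isomorphism (HomCat ?K (ObM ?F X) Y) (HomCat ?L X (ObM (incl2 ?K) Y)) (?\<theta> X Y)"
      by (auto simp: CompCat_full_def incl2_def intro: cat_isomorphism_recast r2)
  next
    fix X X' Y Y' :: "'u compcat" and f h g
    assume "X \<in> Ob0 ?L" "X' \<in> Ob0 ?L" "Y \<in> Ob0 ?K" "Y' \<in> Ob0 ?K"
      "f \<in> Obj (HomCat ?L X' X)" "h \<in> Obj (HomCat ?K (ObM ?F X) Y)" "g \<in> Obj (HomCat ?K Y Y')"
    then have X: "comprehension_category X" and X': "comprehension_category X'"
      and Y: "comprehension_category Y" "full_compcat Y"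
      and Y': "comprehension_category Y'" "full_compcat Y'"
      and f: "pseudo_map X' X f" and h: "pseudo_map (?I X) Y h" and g: "pseudo_map Y Y' g"
      by (auto simp: CompCat_full_def)
    note f' = OM[OF X' X f] and h' = recast_OM[OF r2[OF X Y] h]
    note hf = pseudo_map_pmap_comp[OF f'(1) h]
    note ghf = pseudo_map_pmap_comp[OF hf g]
    \<comment> \<open>Every recasting keeps cores, so both sides have the core obtained by composing
      those of \<open>f\<close>, \<open>h\<close> and \<open>g\<close>; as \<open>Y'\<close> is full
      they coincide. The argument for 2-cells is the same.\<close>
    have "OM (?\<theta> X' Y') (pmap_comp (?I X') Y Y' g
          (pmap_comp (?I X') (?I X) Y h (OM (recast X' X (?I X') (?I X)) f)))
        = pmap_comp X' Y Y' g (pmap_comp X' X Y (OM (?\<theta> X Y) h) f)"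
      by (rule pseudo_map_eq_core[OF _ _ Y'(2)])
        (auto simp: recast_OM[OF r2[OF X' Y'] ghf] f' h' I X X'
          intro!: pseudo_map_pmap_comp f h' g pcore_pmap_comp)
    then show "OM (?\<theta> X' Y') (comp1 ?K (ObM ?F X') Y Y' g
          (comp1 ?K (ObM ?F X') (ObM ?F X) Y h (OM (HomM ?F X' X) f)))
        = comp1 ?L X' (ObM (incl2 ?K) Y) (ObM (incl2 ?K) Y') (OM (HomM (incl2 ?K) Y Y') g)
          (comp1 ?L X' X (ObM (incl2 ?K) Y) (OM (?\<theta> X Y) h) f)"
      using f g h f' h' hf pseudo_map_pmap_comp[OF f h'(1)] by (simp add: CompCat_full_def incl2_def)
  next
    fix X X' Y Y' :: "'u compcat" and f h g
    assume "X \<in> Ob0 ?L" "X' \<in> Ob0 ?L" "Y \<in> Ob0 ?K" "Y' \<in> Ob0 ?K"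
      "f \<in> Arr (HomCat ?L X' X)" "h \<in> Arr (HomCat ?K (ObM ?F X) Y)" "g \<in> Arr (HomCat ?K Y Y')"
    then have X: "comprehension_category X" and X': "comprehension_category X'"
      and Y: "comprehension_category Y" "full_compcat Y"
      and Y': "comprehension_category Y'" "full_compcat Y'"
      and f: "transformation X' X f" and h: "transformation (?I X) Y h" and g: "transformation Y Y' g"
      by (auto simp: CompCat_full_def)
    note f' = AM[OF X' X f] and h' = recast_AM[OF r2[OF X Y] h]
    note hf = transformation_trafo_hcomp[OF f'(1) h]
    note ghf = transformation_trafo_hcomp[OF hf g]
    have "AM (?\<theta> X' Y') (trafo_hcomp (?I X') Y Y' g
          (trafo_hcomp (?I X') (?I X) Y h (AM (recast X' X (?I X') (?I X)) f)))
        = trafo_hcomp X' Y Y' g (trafo_hcomp X' X Y (AM (?\<theta> X Y) h) f)"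
      by (rule trafo_eq_core[OF _ _ Y'(2)])
        (auto simp: recast_AM[OF r2[OF X' Y'] ghf] f' h' I X X'
          intro!: transformation_trafo_hcomp f h' g tcore_trafo_hcomp)
    then show "AM (?\<theta> X' Y') (comp2 ?K (ObM ?F X') Y Y' g
          (comp2 ?K (ObM ?F X') (ObM ?F X) Y h (AM (HomM ?F X' X) f)))
        = comp2 ?L X' (ObM (incl2 ?K) Y) (ObM (incl2 ?K) Y') (AM (HomM (incl2 ?K) Y Y') g)
          (comp2 ?L X' X (ObM (incl2 ?K) Y) (AM (?\<theta> X Y) h) f)"
      using f g h f' h' hf transformation_trafo_hcomp[OF f h'(1)]
      by (simp add: CompCat_full_def incl2_def)
  qed
  then show ?thesis unfolding has_left_two_adjoint_def by blast
qed

theorem theorem17: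
  assumes "infinite (UNIV :: 'u set)"
  shows "two_equivalence (CompCat_repl :: ('u compcat, 'u pmap, 'u trafo) twocat) CompCat_sub
           (incl2 CompCat_repl)
       \<and> two_equivalence (CompCat_sub :: ('u compcat, 'u pmap, 'u trafo) twocat) CompCat_full
           (incl2 CompCat_sub)
       \<and> has_left_two_adjoint (CompCat_full :: ('u compcat, 'u pmap, 'u trafo) twocat) CompCat
           (incl2 CompCat_full)"
proof (intro conjI)
  note subs = two_category_full_sub2[OF two_category_CompCat]
  note repletion = internally_equivalent_repletion[OF assms]
    comprehension_category.replete_repletion[OF _ assms]
  show "two_equivalence (CompCat_repl :: ('u compcat, 'u pmap, 'u trafo) twocat) CompCat_sub
      (incl2 CompCat_repl)"
    unfolding CompCat_repl_def CompCat_sub_def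
  proof (rule two_equivalence_incl2, rule two_functor_incl2)
    fix y :: "'u compcat" assume "y \<in> Ob0 (full_sub2 CompCat subcategorical)"
    then show "\<exists>a \<in> Ob0 (full_sub2 CompCat replete).
        internally_equivalent (full_sub2 CompCat subcategorical) a y"
      \<comment> \<open>The witness is replete, hence subcategorical and full, so the same one
        serves the second inclusion.\<close>
      by (intro bexI[of _ "repletion y"])
        (auto intro: repletion replete_subcategorical subcategorical_full)
  qed (auto intro: subs replete_subcategorical)
  show "two_equivalence (CompCat_sub :: ('u compcat, 'u pmap, 'u trafo) twocat) CompCat_full
      (incl2 CompCat_sub)"
    unfolding CompCat_sub_def CompCat_full_def
  proof (rule two_equivalence_incl2, rule two_functor_incl2)
    fix y :: "'u compcat" assume "y \<in> Ob0 (full_sub2 CompCat full_compcat)"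
    then show "\<exists>a \<in> Ob0 (full_sub2 CompCat subcategorical).
        internally_equivalent (full_sub2 CompCat full_compcat) a y"
      by (intro bexI[of _ "repletion y"])
        (auto intro: repletion replete_subcategorical subcategorical_full)
  qed (auto intro: subs subcategorical_full)
  show "has_left_two_adjoint (CompCat_full :: ('u compcat, 'u pmap, 'u trafo) twocat) CompCat
      (incl2 CompCat_full)"
    using left_adjoint_full_image[OF assms] .
qed

end
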